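(* Let $K\colon\mathbb{R}^{2}\to\mathbb{R}$ be a continuous function such that: (1) there exist $a,b>0$ with $K(x+a,y)=K(x,y+b)=K(x,y)$ for all $(x,y)\in\mathbb{R}^{2}$; (2) for these $a,b$, $\int_{[0,a]\times[0,b]}K(x,y)\,dx\,dy\neq 0$. Then for almost every $\lambda\in\mathbb{R}\setminus\{0\}$ (with respect to Lebesgue measure) there exists a $\lambda K$-loop.
   Context: Write $i$ for the rotation of $\mathbb{R}^2$ by $\frac{\pi}{2}$. A planar closed parametric curve is the image $\mathcal{C}$ of a nonconstant, periodic, continuous map $u\colon\mathbb{R}\to\mathbb{R}^{2}$; a parametrization $u$ of $\mathcal{C}$ is regular if $u$ is of class $C^1$ and $\dot u(t)\neq 0$ for every $t\in\mathbb{R}$. If $u$ is a regular parametrization of class $C^2$, the curvature is $\kappa(t)=\dfrac{\ddot u(t)\cdot i\dot u(t)}{|\dot u(t)|^{3}}$. For a continuous function $F\colon\mathbb{R}^2\to\mathbb{R}$, an $F$-loop is a planar closed curve admitting a regular (periodic) parametrization $u$ of class $C^2$ such that $\kappa(t)=F(u(t))$ for every $t\in\mathbb{R}$. A $\lambda K$-loop is an $F$-loop with $F=\lambda K$. *)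

theory Defs
  imports "HOL-Analysis.Analysis"
begin

definition rot :: "real \<times> real \<Rightarrow> real \<times> real" where
  "rot p = (- snd p, fst p)"

definition parametrizes :: "(real \<Rightarrow> real \<times> real) \<Rightarrow> (real \<times> real) set \<Rightarrow> bool" where
  "parametrizes u C \<longleftrightarrow>
     continuous_on UNIV u \<and> (\<exists>T>0. \<forall>t. u (t + T) = u t) \<and> \<not> u constant_on UNIV \<and> C = range u"

definition regular :: "(real \<Rightarrow> real \<times> real) \<Rightarrow> bool" where
  "regular u \<longleftrightarrow> u C1_differentiable_on UNIV \<and> (\<forall>t. vector_derivative u (at t) \<noteq> 0)"

definition class_C2 :: "(real \<Rightarrow> real \<times> real) \<Rightarrow> bool" where
  "class_C2 u \<longleftrightarrow>
     u C1_differentiable_on UNIV \<and> (\<lambda>t. vector_derivative u (at t)) C1_differentiable_on UNIV"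

text \<open>\<open>vector_derivative\<close> is total, so this value is meaningful only when
  \<^term>\<open>regular u\<close> and \<^term>\<open>class_C2 u\<close> hold.\<close>
definition curvature :: "(real \<Rightarrow> real \<times> real) \<Rightarrow> real \<Rightarrow> real" where
  "curvature u t =
     (let u' = (\<lambda>s. vector_derivative u (at s));
          u'' = (\<lambda>s. vector_derivative u' (at s))
      in (u'' t \<bullet> rot (u' t)) / norm (u' t) ^ 3)"

text \<open>A loop is a subset of the plane, the common image of its parametrizations.
  Self-intersections are allowed.\<close>
definition is_loop :: "(real \<times> real \<Rightarrow> real) \<Rightarrow> (real \<times> real) set \<Rightarrow> bool" where
  "is_loop F C \<longleftrightarrow>
     (\<exists>u. parametrizes u C \<and> regular u \<and> class_C2 u \<and> (\<forall>t. curvature u t = F (u t)))"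

end

theory Submission
  imports Defs "HOL-Complex_Analysis.Great_Picard"
begin

text \<open>
  Let \<open>\<mu> = 1 / \<lambda>\<close>. Reversing the orientation of a loop changes the sign of its curvature
  (\<open>is_loop_reverse\<close>), so that one may assume that the mean of \<open>K\<close> and \<open>\<mu>\<close> are positive. A closed
  curve of constant speed has curvature \<open>K / \<mu>\<close> when it is a nonconstant critical point of
  \<open>\<mu> * length - area\<close>, where \<open>area\<close> is the integral of \<open>K\<close> over the enclosed region, counted with
  multiplicity. This functional is positive on short loops, because the weighted area is at most
  quadratic in the length (\<open>area_bound\<close>), and negative on the boundary of a large rectangle that
  consists of \<open>p * p\<close> period cells, because the area grows like \<open>p\<^sup>2\<close> and the length like \<open>p\<close>. Hence it
  has a mountain pass level. What could go wrong is that almost critical loops near this level get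
  longer and longer.

  This is excluded for almost every \<open>\<mu>\<close> by the monotonicity argument of Struwe. The level is
  monotone in \<open>\<mu>\<close>, and the derivative of the functional in \<open>\<mu>\<close> is the length. So at a parameter where
  the difference quotients of the level stay bounded by \<open>B\<close> along some sequence, the almost optimal
  paths for a slightly larger parameter pass, near their top, only through loops of length at
  most \<open>B + 2\<close>; if none of these were critical, one could push the path down
  (\<open>no_descent_at_level\<close>).

  The variational argument is carried out in finite dimension, on closed polygons with \<open>N\<close> vertices.
  The length becomes the discrete energy \<open>disc_length\<close>, and the area becomes the weighted area of
  the staircase that joins consecutive vertices by a horizontal and then a vertical segment. With
  \<open>W\<close> such that \<open>\<partial>\<^sub>x \<partial>\<^sub>y W = K\<close> this area is a sum of differences of values of \<open>W\<close>, so that it is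
  continuously differentiable although \<open>K\<close> is only continuous, and its gradient consists of
  differences of \<open>\<partial>\<^sub>x W\<close> and \<open>\<partial>\<^sub>y W\<close>, that is, of values of \<open>K\<close> times increments of the polygon. Polygons
  of bounded length are compact modulo the lattice of periods, so one explicit gradient step replaces
  the deformation flow (\<open>uniform_descent\<close>, \<open>critical_polygon_exists\<close>).

  The levels are bounded uniformly in \<open>N\<close>. Applying the lemma of Fatou in the step of the difference
  quotients and again in \<open>N\<close> gives, for almost every \<open>\<mu>\<close>, one constant \<open>B\<close> that serves infinitely many
  \<open>N\<close> (\<open>AE_mono_seq_bounded_slopes\<close>). The resulting critical polygons solve a semi-implicit Euler
  scheme for \<open>u'' = (l / \<mu>) K(u) rot u'\<close>. A discrete Gronwall argument bounds their speed
  (\<open>el_speed_bound\<close>), and since a closed curve must turn, their length is bounded below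
  (\<open>el_length_lower_bound\<close>). By the theorem of Arzela and Ascoli a subsequence converges to a periodic
  solution (\<open>euler_scheme_limit\<close>) whose speed is constant and equal to its positive length
  (\<open>loop_from_euler_lagrange\<close>).
\<close>

section \<open>Periodic sequences and elementary estimates\<close>

lemma period_multiple:
  fixes f :: "real \<Rightarrow> 'a"
  assumes f: "\<And>x. f (x + c) = f x"
  shows "f (x + of_int k * c) = f x"
proof -
  have nat: "f (x + real n * c) = f x" for n x
  proof (induction n)
    case (Suc n)
    have "f (x + real (Suc n) * c) = f (x + real n * c + c)" by (simp add: algebra_simps)
    then show ?case using f Suc by simp
  qed simp
  show ?thesis
  proof (cases "0 \<le> k")
    case True
    then show ?thesis using nat[of x "nat k"] by simp
  next
    case False
    then show ?thesis using nat[of "x + of_int k * c" "nat (-k)"] by simp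
  qed
qed

lemma reduce_modulo_period:
  fixes x c :: real
  assumes c: "0 < c"
  shows "x + of_int (- \<lfloor>x / c\<rfloor>) * c \<in> {0..c}"
proof -
  have "x + of_int (- \<lfloor>x / c\<rfloor>) * c = frac (x / c) * c"
    using c by (simp add: frac_def field_simps)
  moreover have "0 \<le> frac (x / c) * c" "frac (x / c) * c \<le> 1 * c"
    using c frac_lt_1[of "x / c"] by (auto intro!: mult_right_mono)
  ultimately show ?thesis by simp
qed

lemma abs_fst_le: "\<bar>fst z\<bar> \<le> norm z" and abs_snd_le: "\<bar>snd z\<bar> \<le> norm z" for z :: "real \<times> real"
  by (metis norm_fst_le prod.collapse real_norm_def, metis norm_snd_le prod.collapse real_norm_def)

lemma norm_le_abs_sum: "norm z \<le> \<bar>fst z\<bar> + \<bar>snd z\<bar>" for z :: "real \<times> real"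
  using norm_Pair_le[of "fst z" "snd z"] by simp

lemma sum_cyclic_shift:
  fixes f :: "int \<Rightarrow> 'a::ab_group_add"
  assumes "\<And>j. f (j + int N) = f j"
  shows "(\<Sum>j\<in>{0..<int N}. f (j + 1)) = (\<Sum>j\<in>{0..<int N}. f j)"
proof (cases "N = 0")
  case False
  have "(\<Sum>j\<in>{0..<int N}. f (j + 1)) = sum f {1..<int N + 1}"
    by (rule sum.reindex_bij_witness[of _ "\<lambda>j. j - 1" "\<lambda>j. j + 1"]) auto
  also have "{1..<int N + 1} = insert (int N) {1..<int N}" using False by auto
  also have "sum f (insert (int N) {1..<int N}) = f 0 + sum f {1..<int N}"
    using assms[of 0] by simp
  also have "\<dots> = sum f (insert 0 {1..<int N})" by simp
  also have "insert 0 {1..<int N} = {0..<int N}" using False by auto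
  finally show ?thesis .
qed simp

lemma sum_cyclic_diff:
  fixes f :: "int \<Rightarrow> 'a::ab_group_add"
  assumes "\<And>j. f (j + int N) = f j"
  shows "(\<Sum>j\<in>{0..<int N}. f (j + 1) - f j) = 0"
  using sum_cyclic_shift[of f N] assms by (simp add: sum_subtractf)

lemma sum_int_telescope:
  fixes f :: "int \<Rightarrow> 'a::ab_group_add"
  assumes "i \<le> j"
  shows "(\<Sum>k\<in>{i..<j}. f (k + 1) - f k) = f j - f i"
  using assms
proof (induction j rule: int_ge_induct)
  case (step j)
  then have "{i..<j + 1} = insert j {i..<j}" by auto
  then show ?case using step by simp
qed simp

lemma int_steps_bound:
  fixes f :: "int \<Rightarrow> 'a::real_normed_vector"
  assumes "\<And>j. norm (f (j + 1) - f j) \<le> \<delta>"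
  shows "norm (f i - f j) \<le> \<delta> * \<bar>i - j\<bar>"
proof -
  have *: "norm (f j - f i) \<le> \<delta> * (j - i)" if "i \<le> j" for i j
  proof -
    have "f j - f i = (\<Sum>k\<in>{i..<j}. f (k + 1) - f k)" using that by (rule sum_int_telescope[symmetric])
    also have "norm \<dots> \<le> (\<Sum>k\<in>{i..<j}. \<delta>)" by (rule sum_norm_le) (rule assms)
    also have "\<dots> = \<delta> * (j - i)" using that by simp
    finally show ?thesis .
  qed
  show ?thesis
  proof (cases "i \<le> j")
    case True
    then show ?thesis using *[of i j] by (simp add: norm_minus_commute)
  next
    case False
    then show ?thesis using *[of j i] by simp
  qed
qed

text \<open>Unlike the mean value theorem for intervals, this form needs no order between the two points.\<close>

lemma mvt_between:
  fixes f :: "real \<Rightarrow> real"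
  assumes f: "\<And>x. (f has_real_derivative f' x) (at x)"
  shows "\<exists>z. \<bar>z - x\<bar> \<le> \<bar>y - x\<bar> \<and> f y - f x = f' z * (y - x)"
proof -
  consider "x < y" | "x = y" | "y < x" by linarith
  then show ?thesis
  proof cases
    case 1
    then obtain z where "x < z" "z < y" "f y - f x = (y - x) * f' z" using MVT2[of x y f f'] f by blast
    then show ?thesis by (intro exI[of _ z]) auto
  next
    case 3
    then obtain z where "y < z" "z < x" "f x - f y = (x - y) * f' z" using MVT2[of y x f f'] f by blast
    then show ?thesis by (intro exI[of _ z]) (auto simp: algebra_simps)
  qed auto
qed

lemma lipschitz_from_derivative_bound:
  fixes f :: "real \<Rightarrow> real"
  assumes "\<And>x. (f has_real_derivative f' x) (at x)" "\<And>x. \<bar>f' x\<bar> \<le> B"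
  shows "\<bar>f x - f y\<bar> \<le> B * \<bar>x - y\<bar>"
  using field_differentiable_bound[of UNIV f f' B x y] assms by simp

section \<open>Curves of constant speed and reversal of orientation\<close>

lemma inner_rot: "v \<bullet> rot v = 0" "rot v \<bullet> rot v = (norm v)\<^sup>2"
  by (auto simp: rot_def inner_prod_def power2_norm_eq_inner)

text \<open>If \<open>w'' = l F(w) rot w'\<close> and the speed is \<open>l\<close>, then the curvature is \<open>l F(w) l\<^sup>2 / l\<^sup>3\<close>.\<close>

lemma is_loop_of_constant_speed:
  fixes w v :: "real \<Rightarrow> real \<times> real"
  assumes F: "continuous_on UNIV F" and l: "0 < l"
    and per: "\<And>t. w (t + 1) = w t"
    and w: "\<And>t. (w has_vector_derivative v t) (at t)"
    and v: "\<And>t. (v has_vector_derivative (l * F (w t)) *\<^sub>R rot (v t)) (at t)"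
    and speed: "\<And>t. norm (v t) = l"
  shows "is_loop F (range w)"
proof -
  have w': "vector_derivative w (at t) = v t" for t by (rule vector_derivative_at[OF w])
  have v': "vector_derivative v (at t) = (l * F (w t)) *\<^sub>R rot (v t)" for t by (rule vector_derivative_at[OF v])
  have cw: "continuous_on UNIV w"
    by (intro continuous_at_imp_continuous_on ballI has_vector_derivative_continuous[OF w])
  have cv: "continuous_on UNIV v"
    by (intro continuous_at_imp_continuous_on ballI has_vector_derivative_continuous[OF v])
  have cv': "continuous_on UNIV (\<lambda>t. (l * F (w t)) *\<^sub>R rot (v t))"
    unfolding rot_def by (intro continuous_intros cv continuous_on_compose2[OF F cw]) auto
  have C1: "w C1_differentiable_on UNIV"
    unfolding C1_differentiable_on_def using w cv by blast
  have C2: "v C1_differentiable_on UNIV"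
    unfolding C1_differentiable_on_def
    by (rule exI[of _ "\<lambda>t. (l * F (w t)) *\<^sub>R rot (v t)"]) (use v cv' in blast)
  have nz: "v t \<noteq> 0" for t using speed[of t] l by auto
  have "\<not> w constant_on UNIV"
  proof
    assume "w constant_on UNIV"
    then obtain p where "w = (\<lambda>_. p)" by (auto simp: constant_on_def)
    then have "v 0 = 0" using w[of 0] by (metis has_vector_derivative_const vector_derivative_at)
    then show False using nz by blast
  qed
  then have "parametrizes w (range w)" using cw per by (auto simp: parametrizes_def intro: exI[of _ 1])
  moreover have "regular w" using C1 nz by (simp add: regular_def w')
  moreover have "class_C2 w" using C1 C2 by (simp add: class_C2_def w')
  moreover have "curvature w t = F (w t)" for t
  proof -
    have "curvature w t = (l * F (w t)) * (norm (v t))\<^sup>2 / norm (v t) ^ 3"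
      unfolding curvature_def Let_def w' v' by (simp add: inner_rot)
    then show ?thesis using l by (simp add: speed power2_eq_square power3_eq_cube)
  qed
  ultimately show ?thesis unfolding is_loop_def by blast
qed

text \<open>Traversing the curve backwards keeps \<open>u''\<close> and negates \<open>u'\<close>, and the curvature is odd in \<open>u'\<close>.\<close>

lemma is_loop_reverse:
  assumes "is_loop F C"
  shows "is_loop (\<lambda>p. - F p) C"
proof -
  obtain u where u: "parametrizes u C" "regular u" "class_C2 u" and curv: "\<And>t. curvature u t = F (u t)"
    using assms unfolding is_loop_def by blast
  define u' where "u' t = vector_derivative u (at t)" for t
  define u'' where "u'' t = vector_derivative u' (at t)" for t
  have C1: "u C1_differentiable_on UNIV" "u' C1_differentiable_on UNIV"
    using u(3) by (auto simp: class_C2_def u'_def[abs_def])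
  have du: "(u has_vector_derivative u' t) (at t)" and cu': "continuous_on UNIV u'" for t
    using C1(1) by (auto simp: C1_differentiable_on_eq vector_derivative_works[symmetric] u'_def[abs_def])
  have du': "(u' has_vector_derivative u'' t) (at t)" and cu'': "continuous_on UNIV u''" for t
    using C1(2) by (auto simp: C1_differentiable_on_eq vector_derivative_works[symmetric] u''_def[abs_def])
  define w where "w t = u (- t)" for t
  have flip: "((\<lambda>t. f (- t)) has_vector_derivative - f' (- t)) (at t)"
    if "\<And>t. (f has_vector_derivative f' t) (at t)" for f f' :: "real \<Rightarrow> real \<times> real" and t
    using vector_diff_chain_at[OF has_vector_derivative_minus[OF has_vector_derivative_id[of "at t"]], of f "f' (- t)"] that
    by (simp add: o_def)
  have cont_flip: "continuous_on UNIV (\<lambda>t. f (- t))" if "continuous_on UNIV f" for f :: "real \<Rightarrow> real \<times> real"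
    by (rule continuous_on_compose2[OF that]) (auto intro!: continuous_intros)
  have dw: "(w has_vector_derivative - u' (- t)) (at t)" for t
    unfolding w_def by (rule flip[OF du])
  have dw': "((\<lambda>t. - u' (- t)) has_vector_derivative u'' (- t)) (at t)" for t
    using has_vector_derivative_minus[OF flip[OF du', of t]] by simp
  have vw: "vector_derivative w (at t) = - u' (- t)" for t by (rule vector_derivative_at[OF dw])
  have vw': "vector_derivative (\<lambda>t. - u' (- t)) (at t) = u'' (- t)" for t by (rule vector_derivative_at[OF dw'])
  have "w C1_differentiable_on UNIV"
    unfolding C1_differentiable_on_def
    by (intro exI[of _ "\<lambda>t. - u' (- t)"] conjI ballI dw continuous_on_minus cont_flip cu')
  moreover have "(\<lambda>t. - u' (- t)) C1_differentiable_on UNIV"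
    unfolding C1_differentiable_on_def
    by (intro exI[of _ "\<lambda>t. u'' (- t)"] conjI ballI dw' cont_flip cu'')
  ultimately have "class_C2 w" "regular w"
    using u(2) by (auto simp: class_C2_def regular_def vw u'_def)
  moreover have "parametrizes w C"
  proof -
    obtain T where T: "0 < T" "\<And>t. u (t + T) = u t" using u(1) by (auto simp: parametrizes_def)
    have "w (t + T) = w t" for t using T(2)[of "- t - T"] by (simp add: w_def)
    moreover have range: "range w = range u"
      unfolding w_def by (metis (no_types, lifting) image_cong image_image surj_uminus range_composition)
    moreover have "continuous_on UNIV w" using u(1) cont_flip by (simp add: parametrizes_def w_def[abs_def])
    moreover have "\<not> w constant_on UNIV" if "\<not> u constant_on UNIV"
      using that by (auto simp: constant_on_def w_def) (metis minus_minus)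
    ultimately show ?thesis using u(1) T(1) by (auto simp: parametrizes_def)
  qed
  moreover have "curvature w t = - F (w t)" for t
  proof -
    have rot: "rot (- p) = - rot p" for p by (simp add: rot_def)
    have "curvature w t = - curvature u (- t)"
      unfolding curvature_def Let_def vw vw' u'_def[symmetric] u''_def[symmetric] by (simp add: rot)
    then show ?thesis by (simp add: curv w_def)
  qed
  ultimately show ?thesis unfolding is_loop_def by blast
qed

section \<open>Double primitives of a planar function\<close>

text \<open>The integral of \<open>f\<close> from \<open>0\<close> to \<open>x\<close> for either sign of \<open>x\<close>. Rescaling to the fixed interval
  \<open>{0..1}\<close> avoids a case distinction and makes the integral a parameter integral over a fixed
  domain, for which continuity and differentiation under the integral sign are available.\<close>

definition signed_integral :: "(real \<Rightarrow> real) \<Rightarrow> real \<Rightarrow> real" where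
  "signed_integral f x = x * integral {0..1} (\<lambda>\<tau>. f (x * \<tau>))"

text \<open>The function \<open>\<lambda>\<tau>. g (x * \<tau>)\<close> is a primitive of the rescaled integrand.\<close>

lemma signed_integral_eq_diff:
  assumes f: "continuous_on UNIV f" and x: "\<bar>x\<bar> \<le> R"
    and g: "\<And>t. t \<in> {-R..R} \<Longrightarrow> (g has_vector_derivative f t) (at t within {-R..R})"
  shows "signed_integral f x = g x - g 0"
proof -
  have "((\<lambda>\<tau>. x * f (x * \<tau>)) has_integral g (x * 1) - g (x * 0)) {0..1}"
  proof (rule fundamental_theorem_of_calculus)
    fix \<tau> :: real assume \<tau>: "\<tau> \<in> {0..1}"
    have sub: "(*) x ` {0..1} \<subseteq> {-R..R}"
    proof clarify
      fix \<sigma> :: real assume "\<sigma> \<in> {0..1}"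
      then have "\<bar>x * \<sigma>\<bar> \<le> R" using x by (simp add: abs_mult) (meson abs_ge_zero mult_left_le order_trans)
      then show "x * \<sigma> \<in> {-R..R}" by auto
    qed
    have "((g \<circ> (*) x) has_vector_derivative x *\<^sub>R f (x * \<tau>)) (at \<tau> within {0..1})"
    proof (rule vector_diff_chain_within)
      show "((*) x has_vector_derivative x) (at \<tau> within {0..1})"
        by (auto intro!: derivative_eq_intros)
      show "(g has_vector_derivative f (x * \<tau>)) (at (x * \<tau>) within (*) x ` {0..1})"
        using g[of "x * \<tau>"] sub \<tau> by (meson has_vector_derivative_within_subset image_eqI subset_iff)
    qed
    then show "((\<lambda>\<tau>. g (x * \<tau>)) has_vector_derivative x * f (x * \<tau>)) (at \<tau> within {0..1})"
      by (simp add: o_def)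
  qed simp
  then have "integral {0..1} (\<lambda>\<tau>. x * f (x * \<tau>)) = g x - g 0" by (auto dest: integral_unique)
  then show ?thesis by (simp add: signed_integral_def)
qed

lemma DERIV_signed_integral:
  assumes f: "continuous_on UNIV f"
  shows "(signed_integral f has_real_derivative f x) (at x)"
proof -
  define R where "R = \<bar>x\<bar> + 1"
  have "continuous_on {-R..R} f" using f by (rule continuous_on_subset) simp
  then obtain g where g: "\<And>t. t \<in> {-R..R} \<Longrightarrow> (g has_vector_derivative f t) (at t within {-R..R})"
    using antiderivative_continuous by blast
  have x: "x \<in> {-R<..<R}" by (auto simp: R_def)
  have "(g has_vector_derivative f x) (at x within {-R<..<R})"
    using x by (intro has_vector_derivative_within_subset[OF g]) auto
  then have "(g has_real_derivative f x) (at x)"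
    using x by (simp add: at_within_open[OF x] has_real_derivative_iff_has_vector_derivative)
  then have "((\<lambda>x. g x - g 0) has_real_derivative f x) (at x)"
    by (auto intro!: derivative_eq_intros)
  then show ?thesis
    by (rule DERIV_cong_ev[THEN iffD1, rotated -1, OF _ refl _ refl])
       (use x in \<open>auto intro!: eventually_nhds_in_open[THEN eventually_mono, of "{-R<..<R}"]
          signed_integral_eq_diff[OF f _ g, symmetric]\<close>)
qed

lemma signed_integral_nonneg:
  assumes f: "continuous_on UNIV f" and "0 \<le> x"
  shows "signed_integral f x = integral {0..x} f"
proof -
  have "(f has_integral signed_integral f x - signed_integral f 0) {0..x}"
    using assms DERIV_signed_integral[OF f]
    by (intro fundamental_theorem_of_calculus)
       (auto simp: has_real_derivative_iff_has_vector_derivative[symmetric] intro: has_field_derivative_at_within)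
  then show ?thesis by (auto dest!: integral_unique simp: signed_integral_def)
qed

lemma continuous_on_signed_integral:
  fixes f :: "'a::topological_space \<Rightarrow> real \<Rightarrow> real"
  assumes f: "continuous_on UNIV (\<lambda>(z, t). f z t)" and h: "continuous_on UNIV h"
  shows "continuous_on UNIV (\<lambda>z. signed_integral (f z) (h z))"
proof -
  have h': "continuous_on UNIV (\<lambda>p::'a \<times> real. h (fst p))"
    by (rule continuous_on_compose2[OF h]) (auto intro!: continuous_intros)
  have "continuous_on UNIV (\<lambda>p. (\<lambda>(z, t). f z t) (fst p, h (fst p) * snd p))"
    by (rule continuous_on_compose2[OF f]) (auto intro!: continuous_intros h')
  then have "continuous_on UNIV (\<lambda>z. integral (cbox 0 1) (\<lambda>\<tau>. f z (h z * \<tau>)))"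
    by (intro integral_continuous_on_param) (auto simp: split_beta intro: continuous_on_subset)
  then show ?thesis
    unfolding signed_integral_def by (auto intro!: continuous_intros h simp: box_real)
qed

text \<open>The functions \<open>V\<close> and \<open>U\<close> are the partial derivatives of \<open>W\<close>. Since all three vanish on the
  appropriate axes, periods of \<open>K\<close> become simple shift laws for them.\<close>

locale double_primitive =
  fixes K W U V :: "real \<Rightarrow> real \<Rightarrow> real"
  assumes W_x: "((\<lambda>x. W x y) has_real_derivative V x y) (at x)"
    and W_y: "((\<lambda>y. W x y) has_real_derivative U x y) (at y)"
    and V_y: "((\<lambda>y. V x y) has_real_derivative K x y) (at y)"
    and U_x: "((\<lambda>x. U x y) has_real_derivative K x y) (at x)"
    and W_0: "W 0 y = 0" "W x 0 = 0" and V_0: "V x 0 = 0" and U_0: "U 0 y = 0"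
    and cont_U: "continuous_on UNIV (\<lambda>z. U (fst z) (snd z))"
    and cont_V: "continuous_on UNIV (\<lambda>z. V (fst z) (snd z))"

text \<open>\<open>W\<close> integrates \<open>V\<close> in the first variable; differentiating under the integral sign yields its other
  partial derivative.\<close>

lemma double_primitive_exists:
  fixes K :: "real \<times> real \<Rightarrow> real"
  assumes K: "continuous_on UNIV K"
  obtains W U V where "double_primitive (\<lambda>x y. K (x, y)) W U V"
    "\<And>a b. 0 \<le> a \<Longrightarrow> 0 \<le> b \<Longrightarrow> W a b = integral (cbox (0, 0) (a, b)) K"
proof -
  define V where "V x y = signed_integral (\<lambda>t. K (x, t)) y" for x y
  define U where "U x y = signed_integral (\<lambda>s. K (s, y)) x" for x y
  define W where "W x y = signed_integral (\<lambda>s. V s y) x" for x y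
  have Kc: "continuous_on UNIV (\<lambda>t. K (x, t))" "continuous_on UNIV (\<lambda>s. K (s, y))" for x y
    by (rule continuous_on_compose2[OF K]; auto intro!: continuous_intros)+
  have cV: "continuous_on UNIV (\<lambda>z. V (fst z) (snd z))"
    unfolding V_def
    by (rule continuous_on_signed_integral)
       (auto intro!: continuous_intros continuous_on_compose2[OF K] simp: split_beta)
  have cU: "continuous_on UNIV (\<lambda>z. U (fst z) (snd z))"
    unfolding U_def
    by (rule continuous_on_signed_integral)
       (auto intro!: continuous_intros continuous_on_compose2[OF K] simp: split_beta)
  have cV1: "continuous_on UNIV (\<lambda>s. V s y)" for y
    using continuous_on_compose2[OF cV, of UNIV "\<lambda>s. (s, y)"] by (simp add: continuous_intros)
  have V_y: "((\<lambda>y. V x y) has_real_derivative K (x, y)) (at y)" for x y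
    using DERIV_signed_integral[OF Kc(1)] unfolding V_def by simp
  have W_y: "((\<lambda>y. W x y) has_real_derivative U x y) (at y)" for x y
  proof -
    have "((\<lambda>y. integral (cbox 0 1) (\<lambda>\<tau>. V (x * \<tau>) y)) has_field_derivative
            integral (cbox 0 1) (\<lambda>\<tau>. K (x * \<tau>, y))) (at y within UNIV)"
      by (rule leibniz_rule_field_derivative)
         (auto intro!: V_y continuous_intros integrable_continuous_real continuous_on_compose2[OF cV1]
            continuous_on_compose2[OF K] simp: split_beta)
    then show ?thesis
      unfolding W_def U_def signed_integral_def
      by (auto intro!: derivative_eq_intros simp: box_real)
  qed
  have "double_primitive (\<lambda>x y. K (x, y)) W U V"
  proof
    show "((\<lambda>x. W x y) has_real_derivative V x y) (at x)" for x y
      using DERIV_signed_integral[OF cV1] unfolding W_def by simp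
    show "((\<lambda>x. U x y) has_real_derivative K (x, y)) (at x)" for x y
      using DERIV_signed_integral[OF Kc(2)] unfolding U_def by simp
  qed (simp_all add: W_y V_y cU cV, simp_all add: W_def V_def U_def signed_integral_def)
  moreover have "W a b = integral (cbox (0, 0) (a, b)) K" if "0 \<le> a" "0 \<le> b" for a b
  proof -
    have "integral (cbox (0, 0) (a, b)) K =
        integral (cbox 0 a) (\<lambda>x. integral (cbox 0 b) (\<lambda>y. K (x, y)))"
      by (rule integral_prod_continuous) (rule continuous_on_subset[OF K subset_UNIV])
    also have "\<dots> = integral {0..a} (\<lambda>x. V x b)"
      using that by (simp add: V_def signed_integral_nonneg[OF Kc(1)] box_real)
    also have "\<dots> = W a b" using that by (simp add: W_def signed_integral_nonneg[OF cV1])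
    finally show ?thesis by simp
  qed
  ultimately show thesis by (rule that)
qed

context double_primitive begin

text \<open>In all of the following shift laws the difference of both sides has zero derivative in one
  variable and vanishes on an axis.\<close>

lemma V_period_x:
  assumes "\<And>x y. K (x + \<alpha>) y = K x y"
  shows "V (x + \<alpha>) y = V x y"
proof -
  have "((\<lambda>y. V (x + \<alpha>) y - V x y) has_real_derivative 0) (at y)" for y
    by (auto intro!: derivative_eq_intros V_y simp: assms)
  then have "V (x + \<alpha>) y - V x y = V (x + \<alpha>) 0 - V x 0" by (intro DERIV_isconst_all) auto
  then show ?thesis by (simp add: V_0)
qed

lemma U_period_y:
  assumes "\<And>x y. K x (y + \<beta>) = K x y"
  shows "U x (y + \<beta>) = U x y"
proof -
  have "((\<lambda>x. U x (y + \<beta>) - U x y) has_real_derivative 0) (at x)" for x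
    by (auto intro!: derivative_eq_intros U_x simp: assms)
  then have "U x (y + \<beta>) - U x y = U 0 (y + \<beta>) - U 0 y" by (intro DERIV_isconst_all) auto
  then show ?thesis by (simp add: U_0)
qed

lemma W_period_x:
  assumes "\<And>x y. K (x + \<alpha>) y = K x y"
  shows "W (x + \<alpha>) y = W x y + W \<alpha> y"
proof -
  have "((\<lambda>x. W (x + \<alpha>) y - W x y) has_real_derivative V (x + \<alpha>) y - V x y) (at x)" for x
    by (intro DERIV_diff DERIV_shift[THEN iffD1] W_x)
  then have "((\<lambda>x. W (x + \<alpha>) y - W x y) has_real_derivative 0) (at x)" for x
    by (simp add: V_period_x[OF assms])
  then have "W (x + \<alpha>) y - W x y = W (0 + \<alpha>) y - W 0 y" by (intro DERIV_isconst_all) auto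
  then show ?thesis by (simp add: W_0)
qed

lemma W_period_y:
  assumes "\<And>x y. K x (y + \<beta>) = K x y"
  shows "W x (y + \<beta>) = W x y + W x \<beta>"
proof -
  have "((\<lambda>y. W x (y + \<beta>) - W x y) has_real_derivative U x (y + \<beta>) - U x y) (at y)" for y
    by (intro DERIV_diff DERIV_shift[THEN iffD1] W_y)
  then have "((\<lambda>y. W x (y + \<beta>) - W x y) has_real_derivative 0) (at y)" for y
    by (simp add: U_period_y[OF assms])
  then have "W x (y + \<beta>) - W x y = W x (0 + \<beta>) - W x 0" by (intro DERIV_isconst_all) auto
  then show ?thesis by (simp add: W_0)
qed

lemma V_period_y:
  assumes "\<And>x y. K x (y + \<beta>) = K x y"
  shows "V x (y + \<beta>) = V x y + V x \<beta>"
proof -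
  have "((\<lambda>y. V x (y + \<beta>) - V x y) has_real_derivative K x (y + \<beta>) - K x y) (at y)" for y
    by (intro DERIV_diff DERIV_shift[THEN iffD1] V_y)
  then have "((\<lambda>y. V x (y + \<beta>) - V x y) has_real_derivative 0) (at y)" for y
    by (simp add: assms)
  then have "V x (y + \<beta>) - V x y = V x (0 + \<beta>) - V x 0" by (intro DERIV_isconst_all) auto
  then show ?thesis by (simp add: V_0)
qed

lemma U_period_x:
  assumes "\<And>x y. K (x + \<alpha>) y = K x y"
  shows "U (x + \<alpha>) y = U x y + U \<alpha> y"
proof -
  have "((\<lambda>x. U (x + \<alpha>) y - U x y) has_real_derivative K (x + \<alpha>) y - K x y) (at x)" for x
    by (intro DERIV_diff DERIV_shift[THEN iffD1] U_x)
  then have "((\<lambda>x. U (x + \<alpha>) y - U x y) has_real_derivative 0) (at x)" for x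
    by (simp add: assms)
  then have "U (x + \<alpha>) y - U x y = U (0 + \<alpha>) y - U 0 y" by (intro DERIV_isconst_all) auto
  then show ?thesis by (simp add: U_0)
qed

lemma W_lattice:
  assumes "\<And>x y. K (x + a) y = K x y" "\<And>x y. K x (y + b) = K x y"
  shows "W (real p * a) (real q * b) = real p * real q * W a b"
proof -
  have y: "W x (real q * b) = real q * W x b" for x
    by (induction q) (simp_all add: W_0 W_period_y[OF assms(2)] distrib_right add.commute[of b])
  have "W (real p * a) y = real p * W a y" for y
    by (induction p) (simp_all add: W_0 W_period_x[OF assms(1)] distrib_right add.commute[of a])
  then show ?thesis by (simp add: y)
qed

text \<open>Both partial derivatives exist and one of them is continuous in both variables.\<close>

lemma W_has_derivative:
  "((\<lambda>z. W (fst z) (snd z)) has_derivative (\<lambda>d. fst d * V (fst z) (snd z) + snd d * U (fst z) (snd z))) (at z)"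
proof -
  obtain x y where z: "z = (x, y)" by fastforce
  have "((\<lambda>(x, y). W x y) has_derivative
      (\<lambda>(tx, ty). V x y * tx + blinfun_scaleR_left (U x y) ty)) (at (x, y) within UNIV \<times> UNIV)"
  proof (rule has_derivative_partialsI)
    show "((\<lambda>x. W x y) has_derivative (*) (V x y)) (at x within UNIV)"
      using W_x[of y x] by (simp add: has_field_derivative_def)
    show "((\<lambda>y. W x y) has_derivative blinfun_apply (blinfun_scaleR_left (U x y))) (at y within UNIV)" for x y
    proof -
      have "blinfun_apply (blinfun_scaleR_left (U x y)) = (*) (U x y)" by (rule ext) simp
      then show ?thesis using W_y[of x y] by (simp add: has_field_derivative_def)
    qed
    have "isCont (\<lambda>z. U (fst z) (snd z)) (x, y)"
      using cont_U by (simp add: continuous_on_eq_continuous_at)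
    then have "isCont (\<lambda>z. blinfun_scaleR_left (U (fst z) (snd z))) (x, y)"
      by (intro continuous_intros bounded_linear.isCont[OF bounded_linear_blinfun_scaleR_left])
    then show "continuous (at (x, y) within UNIV \<times> UNIV) (\<lambda>(x, y). blinfun_scaleR_left (U x y))"
      by (simp add: split_beta')
  qed auto
  then show ?thesis by (simp add: z split_beta' mult.commute)
qed

end

section \<open>Difference quotients of monotone functions\<close>

text \<open>The integral of \<open>f (x + \<delta>) - f x\<close> telescopes: only a piece of length \<open>\<delta>\<close> at the right end
  survives from above, and its contribution is at most \<open>C * \<delta>\<close>.\<close>

lemma mono_difference_quotient_integral:
  fixes f :: "real \<Rightarrow> real"
  assumes f: "mono f" and bnd: "\<And>x. 0 \<le> f x" "\<And>x. f x \<le> C" and \<delta>: "0 < \<delta>" and ab: "\<alpha> \<le> \<beta>"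
  shows "(\<integral>\<^sup>+x. ennreal ((f (x + \<delta>) - f x) / \<delta>) * indicator {\<alpha>..\<beta>} x \<partial>lborel) \<le> ennreal C"
proof -
  have C0: "0 \<le> C" using bnd[of 0] by linarith
  have [measurable]: "f \<in> borel_measurable borel" by (rule borel_measurable_mono[OF f])
  let ?I = "\<lambda>g. \<integral>\<^sup>+x. ennreal (g x) * indicator {\<alpha>..\<beta>} x \<partial>lborel"
  have le: "f x \<le> f (x + \<delta>)" for x using monoD[OF f] \<delta> by simp
  have "?I (\<lambda>x. f (x + \<delta>) - f x) + ?I f = ?I (\<lambda>x. f (x + \<delta>))"
    using le bnd(1) by (subst nn_integral_add[symmetric])
      (auto simp: distrib_right[symmetric] ennreal_plus[symmetric] simp del: ennreal_plus intro!: nn_integral_cong)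
  also have "\<dots> = (\<integral>\<^sup>+x. ennreal (f x) * indicator {\<alpha>+\<delta>..\<beta>+\<delta>} x \<partial>lborel)"
    by (subst (2) nn_integral_real_affine[where c = 1 and t = \<delta>])
       (auto intro!: nn_integral_cong simp: indicator_def algebra_simps)
  also have "\<dots> \<le> (\<integral>\<^sup>+x. ennreal (f x) * indicator {\<alpha>..\<beta>} x + ennreal C * indicator {\<beta>..\<beta>+\<delta>} x \<partial>lborel)"
    using bnd \<delta> by (intro nn_integral_mono) (auto simp: indicator_def ennreal_leI)
  also have "\<dots> = ?I f + ennreal C * ennreal \<delta>"
    using \<delta> by (subst nn_integral_add) (auto simp: nn_integral_cmult)
  finally have "?I f + ?I (\<lambda>x. f (x + \<delta>) - f x) \<le> ?I f + ennreal (C * \<delta>)"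
    using C0 \<delta> by (simp add: ennreal_mult add.commute)
  moreover have "?I f \<noteq> \<infinity>"
  proof -
    have "?I f \<le> (\<integral>\<^sup>+x. ennreal C * indicator {\<alpha>..\<beta>} x \<partial>lborel)"
      using bnd by (intro nn_integral_mono mult_right_mono) (auto simp: ennreal_leI)
    also have "\<dots> = ennreal (C * (\<beta> - \<alpha>))"
      using ab C0 by (simp add: nn_integral_cmult ennreal_mult)
    finally show ?thesis by (auto simp: top_unique)
  qed
  ultimately have I: "?I (\<lambda>x. f (x + \<delta>) - f x) \<le> ennreal (C * \<delta>)"
    using ennreal_add_left_cancel_le by auto
  have "?I (\<lambda>x. (f (x + \<delta>) - f x) / \<delta>) = ?I (\<lambda>x. f (x + \<delta>) - f x) * ennreal (1/\<delta>)"
    using \<delta> le by (subst nn_integral_multc[symmetric])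
      (auto intro!: nn_integral_cong simp: ennreal_mult[symmetric] indicator_def)
  also have "\<dots> \<le> ennreal (C * \<delta>) * ennreal (1/\<delta>)" using I by (rule mult_right_mono) simp
  also have "\<dots> = ennreal C" using \<delta> C0 by (simp add: ennreal_mult[symmetric])
  finally show ?thesis .
qed

text \<open>The iterated lower limit of the difference quotients, first for the step tending to zero and
  then for \<open>n\<close> tending to infinity, has a finite integral over bounded intervals by the lemma of
  Fatou, since all difference quotients have integral at most \<open>C\<close>. Hence it is finite almost
  everywhere, and any larger real number serves as \<open>B\<close> for infinitely many \<open>n\<close>.\<close>

lemma AE_mono_seq_bounded_slopes:
  fixes f :: "nat \<Rightarrow> real \<Rightarrow> real"
  assumes f: "\<And>n. mono (f n)" and bnd: "\<And>n x. 0 \<le> f n x" "\<And>n x. f n x \<le> C"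
  shows "AE x in lebesgue. \<exists>B\<ge>0. \<exists>\<^sub>\<infinity>n. \<forall>d>0. \<exists>\<delta>. 0 < \<delta> \<and> \<delta> < d \<and> f n (x + \<delta>) \<le> f n x + B * \<delta>"
    (is "AE x in lebesgue. ?P x")
proof -
  have [measurable]: "f n \<in> borel_measurable borel" for n by (rule borel_measurable_mono[OF f])
  define \<delta> where "\<delta> k = inverse (real (Suc k))" for k
  have \<delta>: "0 < \<delta> k" for k by (simp add: \<delta>_def)
  define D where "D n k x = ennreal ((f n (x + \<delta> k) - f n x) / \<delta> k)" for n k x
  have [measurable]: "D n k \<in> borel_measurable borel" for n k unfolding D_def by measurable
  define h where "h x = liminf (\<lambda>n. liminf (\<lambda>k. D n k x))" for x
  have [measurable]: "h \<in> borel_measurable borel" unfolding h_def by measurable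
  have fin: "AE x in lborel. h x * indicator {-real m..real m} x \<noteq> \<infinity>" for m
  proof (rule nn_integral_noteq_infinite)
    let ?J = "indicator {-real m..real m} :: real \<Rightarrow> ennreal"
    have mult: "liminf a * ?J x = liminf (\<lambda>k. a k * ?J x)" for a :: "nat \<Rightarrow> ennreal" and x
      by (simp add: indicator_def Liminf_const)
    have "(\<integral>\<^sup>+x. h x * ?J x \<partial>lborel) = (\<integral>\<^sup>+x. liminf (\<lambda>n. liminf (\<lambda>k. D n k x * ?J x)) \<partial>lborel)"
      by (simp add: h_def mult)
    also have "\<dots> \<le> liminf (\<lambda>n. \<integral>\<^sup>+x. liminf (\<lambda>k. D n k x * ?J x) \<partial>lborel)"
      by (intro nn_integral_liminf) measurable
    also have "\<dots> \<le> liminf (\<lambda>n. liminf (\<lambda>k. \<integral>\<^sup>+x. D n k x * ?J x \<partial>lborel))"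
      by (intro Liminf_mono always_eventually allI nn_integral_liminf) measurable
    also have "\<dots> \<le> liminf (\<lambda>n. liminf (\<lambda>k. ennreal C))"
      unfolding D_def
      by (intro Liminf_mono always_eventually allI mono_difference_quotient_integral f bnd \<delta>) auto
    also have "\<dots> = ennreal C" by (simp add: Liminf_const)
    finally show "(\<integral>\<^sup>+x. h x * ?J x \<partial>lborel) \<noteq> \<infinity>" by (auto simp: top_unique)
  qed measurable
  have "AE x in lborel. \<forall>m. h x * indicator {-real m..real m} x \<noteq> \<infinity>"
    using fin by (simp add: AE_all_countable)
  then have "AE x in lborel. ?P x"
  proof (rule AE_mp, intro AE_I2 impI)
    fix x assume *: "\<forall>m. h x * indicator {-real m..real m} x \<noteq> \<infinity>"
    obtain m where "\<bar>x\<bar> \<le> real m" using real_arch_simple by blast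
    then have "x \<in> {-real m..real m}" by auto
    then have "h x < \<infinity>" using *[rule_format, of m] by (simp add: less_top)
    then obtain B where B: "h x < ennreal B" "0 \<le> B"
      by (metis ennreal_Ex_less_of_nat ennreal_of_nat_eq_real_of_nat of_nat_0_le_iff infinity_ennreal_def)
    have "\<exists>\<^sub>\<infinity>n. liminf (\<lambda>k. D n k x) < ennreal B"
    proof (rule ccontr)
      assume "\<not> ?thesis"
      then have "\<forall>\<^sub>F n in sequentially. ennreal B \<le> liminf (\<lambda>k. D n k x)"
        by (simp add: not_INFM not_frequently linorder_not_less cofinite_eq_sequentially)
      then have "ennreal B \<le> h x" unfolding h_def by (rule Liminf_bounded)
      then show False using B by simp
    qed
    then have "\<exists>\<^sub>\<infinity>n. \<forall>d>0. \<exists>\<delta>. 0 < \<delta> \<and> \<delta> < d \<and> f n (x + \<delta>) \<le> f n x + B * \<delta>"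
    proof (rule INFM_mono)
      fix n assume lt: "liminf (\<lambda>k. D n k x) < ennreal B"
      show "\<forall>d>0. \<exists>\<delta>. 0 < \<delta> \<and> \<delta> < d \<and> f n (x + \<delta>) \<le> f n x + B * \<delta>"
      proof (intro allI impI)
        fix d :: real assume "0 < d"
        then have "\<forall>\<^sub>F k in sequentially. \<delta> k < d"
          unfolding \<delta>_def using LIMSEQ_inverse_real_of_nat by (rule order_tendstoD(2)[rotated])
        moreover have "\<exists>\<^sub>F k in sequentially. D n k x < ennreal B"
        proof (rule ccontr)
          assume "\<not> ?thesis"
          then have "\<forall>\<^sub>F k in sequentially. ennreal B \<le> D n k x" by (simp add: not_frequently not_less)
          then have "ennreal B \<le> liminf (\<lambda>k. D n k x)" by (rule Liminf_bounded)
          then show False using lt by simp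
        qed
        ultimately have "\<exists>\<^sub>F k in sequentially. D n k x < ennreal B \<and> \<delta> k < d"
          by (rule frequently_eventually_frequently[rotated])
        then obtain k where k: "D n k x < ennreal B" "\<delta> k < d" by (auto dest: frequently_ex)
        have "f n x \<le> f n (x + \<delta> k)" using monoD[OF f[of n]] \<delta>[of k] by simp
        then have "(f n (x + \<delta> k) - f n x) / \<delta> k < B"
          using k(1) \<delta>[of k] unfolding D_def by (subst (asm) ennreal_less_iff) auto
        then have "f n (x + \<delta> k) \<le> f n x + B * \<delta> k" using \<delta>[of k] by (simp add: field_simps)
        then show "\<exists>\<delta>. 0 < \<delta> \<and> \<delta> < d \<and> f n (x + \<delta>) \<le> f n x + B * \<delta>" using k(2) \<delta>[of k] by blast
      qed
    qed
    then show "?P x" using B(2) by blast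
  qed
  then show ?thesis by (rule AE_completion)
qed

section \<open>Mountain pass levels depending on a parameter\<close>

definition paths_between :: "'x::topological_space set \<Rightarrow> 'x \<Rightarrow> 'x \<Rightarrow> (real \<Rightarrow> 'x) set" where
  "paths_between X p q =
     {\<gamma>. continuous_on {0..1} \<gamma> \<and> \<gamma> ` {0..1} \<subseteq> X \<and> \<gamma> 0 = p \<and> \<gamma> 1 = q}"

definition pass_level ::
    "'x::topological_space set \<Rightarrow> ('x \<Rightarrow> real) \<Rightarrow> ('x \<Rightarrow> real) \<Rightarrow> 'x \<Rightarrow> 'x \<Rightarrow> real \<Rightarrow> real" where
  "pass_level X L A p q \<mu> =
     (INF \<gamma>\<in>paths_between X p q. SUP t\<in>{0..1}. \<mu> * L (\<gamma> t) - A (\<gamma> t))"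

locale mountain_pass =
  fixes X :: "'x::topological_space set" and L A :: "'x \<Rightarrow> real" and p q :: 'x
  assumes cont_L: "continuous_on X L" and cont_A: "continuous_on X A"
    and L_nonneg: "\<And>u. u \<in> X \<Longrightarrow> 0 \<le> L u"
    and L_start: "L p = 0" and A_start: "A p = 0"
    and paths_nonempty: "paths_between X p q \<noteq> {}"
begin

abbreviation "level \<equiv> pass_level X L A p q"

lemma cont_F_path:
  assumes "\<gamma> \<in> paths_between X p q"
  shows "continuous_on {0..1} (\<lambda>t. \<mu> * L (\<gamma> t) - A (\<gamma> t))"
proof -
  have "continuous_on {0..1} \<gamma>" "\<gamma> ` {0..1} \<subseteq> X"
    using assms by (auto simp: paths_between_def)
  then show ?thesis
    by (intro continuous_intros continuous_on_compose2[OF cont_L] continuous_on_compose2[OF cont_A]) auto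
qed

lemma bdd_F_path:
  assumes "\<gamma> \<in> paths_between X p q"
  shows "bdd_above ((\<lambda>t. \<mu> * L (\<gamma> t) - A (\<gamma> t)) ` {0..1})"
  using compact_continuous_image[OF cont_F_path[OF assms]]
  by (simp add: bounded_imp_bdd_above compact_imp_bounded)

lemma sup_path_nonneg:
  assumes "\<gamma> \<in> paths_between X p q"
  shows "0 \<le> (SUP t\<in>{0..1}. \<mu> * L (\<gamma> t) - A (\<gamma> t))"
proof -
  have "\<mu> * L (\<gamma> 0) - A (\<gamma> 0) \<le> (SUP t\<in>{0..1}. \<mu> * L (\<gamma> t) - A (\<gamma> t))"
    by (intro cSUP_upper bdd_F_path[OF assms]) auto
  moreover have "\<gamma> 0 = p" using assms by (simp add: paths_between_def)
  ultimately show ?thesis by (simp add: L_start A_start)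
qed

lemma bdd_sups: "bdd_below ((\<lambda>\<gamma>. SUP t\<in>{0..1}. \<mu> * L (\<gamma> t) - A (\<gamma> t)) ` paths_between X p q)"
  using sup_path_nonneg by (intro bdd_belowI[of _ 0]) auto

lemma level_nonneg: "0 \<le> level \<mu>"
  unfolding pass_level_def using paths_nonempty sup_path_nonneg by (intro cINF_greatest) auto

lemma level_le:
  assumes "\<gamma> \<in> paths_between X p q" "\<And>t. t \<in> {0..1} \<Longrightarrow> \<mu> * L (\<gamma> t) - A (\<gamma> t) \<le> m"
  shows "level \<mu> \<le> m"
proof -
  have "level \<mu> \<le> (SUP t\<in>{0..1}. \<mu> * L (\<gamma> t) - A (\<gamma> t))"
    unfolding pass_level_def by (intro cINF_lower bdd_sups assms)
  also have "\<dots> \<le> m" using assms(2) by (intro cSUP_least) auto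
  finally show ?thesis .
qed

lemma level_lessE:
  assumes "level \<mu> < m"
  obtains \<gamma> where "\<gamma> \<in> paths_between X p q"
    "\<And>t. t \<in> {0..1} \<Longrightarrow> \<mu> * L (\<gamma> t) - A (\<gamma> t) < m"
proof -
  obtain \<gamma> where g: "\<gamma> \<in> paths_between X p q"
    and m: "(SUP t\<in>{0..1}. \<mu> * L (\<gamma> t) - A (\<gamma> t)) < m"
    using assms cINF_less_iff[OF paths_nonempty bdd_sups] unfolding pass_level_def by blast
  show ?thesis
  proof (rule that[OF g])
    fix t :: real assume "t \<in> {0..1}"
    then have "\<mu> * L (\<gamma> t) - A (\<gamma> t) \<le> (SUP t\<in>{0..1}. \<mu> * L (\<gamma> t) - A (\<gamma> t))"
      by (intro cSUP_upper bdd_F_path[OF g])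
    then show "\<mu> * L (\<gamma> t) - A (\<gamma> t) < m" using m by linarith
  qed
qed

lemma level_ge:
  assumes "\<And>\<gamma>. \<gamma> \<in> paths_between X p q \<Longrightarrow> \<exists>t\<in>{0..1}. m \<le> \<mu> * L (\<gamma> t) - A (\<gamma> t)"
  shows "m \<le> level \<mu>"
  using assms level_lessE[of \<mu> m] by (metis linorder_not_less)

lemma mono_level: "mono level"
proof
  fix \<mu> \<nu> :: real assume le: "\<mu> \<le> \<nu>"
  show "level \<mu> \<le> level \<nu>"
  proof (rule field_le_epsilon)
    fix e :: real assume "0 < e"
    then obtain \<gamma> where g: "\<gamma> \<in> paths_between X p q"
      and lt: "\<And>t. t \<in> {0..1} \<Longrightarrow> \<nu> * L (\<gamma> t) - A (\<gamma> t) < level \<nu> + e"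
      using level_lessE[of \<nu> "level \<nu> + e"] by auto
    show "level \<mu> \<le> level \<nu> + e"
    proof (rule level_le[OF g])
      fix t :: real assume t: "t \<in> {0..1}"
      have "\<gamma> t \<in> X" using g t by (auto simp: paths_between_def)
      then have "\<mu> * L (\<gamma> t) \<le> \<nu> * L (\<gamma> t)" using le L_nonneg by (intro mult_right_mono) auto
      then show "\<mu> * L (\<gamma> t) - A (\<gamma> t) \<le> level \<nu> + e" using lt[OF t] by linarith
    qed
  qed
qed

text \<open>Struwe's monotonicity trick. Take a path that is almost optimal for \<open>\<mu> + \<delta>\<close>. Where the functional
  with parameter \<open>\<mu>\<close> is within \<open>\<delta>\<close> of the level or above, comparing both parameters gives
  \<open>\<delta> * L \<le> (B + 2) * \<delta>\<close>, so the descent hypothesis, which concerns only points with \<open>L \<le> B + 2\<close>,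
  applies there. Moving these points by \<open>\<Phi>\<close> gains \<open>g * \<eta>\<close>, which is more than the excess of order \<open>\<delta>\<close>
  once \<open>\<delta>\<close> is small, and the new path stays strictly below the level.\<close>

lemma no_descent_at_level:
  fixes \<Phi> :: "real \<Rightarrow> 'x \<Rightarrow> 'x"
  assumes level_pos: "0 < level \<mu>" and end_neg: "\<mu> * L q - A q \<le> 0"
    and slope: "\<And>d. 0 < d \<Longrightarrow> \<exists>\<delta>. 0 < \<delta> \<and> \<delta> < d \<and> level (\<mu> + \<delta>) \<le> level \<mu> + B * \<delta>"
    and B: "0 \<le> B" and pos: "0 < \<eta>" "0 < g"
    and cont: "continuous_on ({0..\<eta>} \<times> X) (\<lambda>z. \<Phi> (fst z) (snd z))"
    and \<Phi>_0: "\<And>u. u \<in> X \<Longrightarrow> \<Phi> 0 u = u"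
    and \<Phi>_in: "\<And>s u. s \<in> {0..\<eta>} \<Longrightarrow> u \<in> X \<Longrightarrow> \<Phi> s u \<in> X"
    and descent: "\<And>s u. s \<in> {0..\<eta>} \<Longrightarrow> u \<in> X \<Longrightarrow> L u \<le> B + 2 \<Longrightarrow>
       level \<mu> / 2 \<le> \<mu> * L u - A u \<Longrightarrow>
       \<mu> * L (\<Phi> s u) - A (\<Phi> s u) \<le> \<mu> * L u - A u - g * s"
  shows False
proof -
  define c where "c = level \<mu>"
  define F where "F u = \<mu> * L u - A u" for u
  \<comment> \<open>the second bound makes the gain of one full step exceed the slack of the path\<close>
  define d where "d = min (c / 2) (\<eta> * g / (B + 2))"
  have "0 < d" using level_pos pos B by (simp add: d_def c_def)
  then obtain \<delta> where \<delta>: "0 < \<delta>" "\<delta> < d" "level (\<mu> + \<delta>) \<le> c + B * \<delta>"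
    using slope unfolding c_def by blast
  have \<delta>1: "\<delta> < c / 2" and \<delta>2: "(B + 2) * \<delta> < \<eta> * g"
    using \<delta>(2) B by (auto simp: d_def field_simps)
  obtain \<gamma> where \<gamma>: "\<gamma> \<in> paths_between X p q"
    and lt: "\<And>t. t \<in> {0..1} \<Longrightarrow> (\<mu> + \<delta>) * L (\<gamma> t) - A (\<gamma> t) < level (\<mu> + \<delta>) + \<delta>"
    using level_lessE[of "\<mu> + \<delta>" "level (\<mu> + \<delta>) + \<delta>"] \<delta>(1) by auto
  have \<gamma>c: "continuous_on {0..1} \<gamma>" and \<gamma>X: "\<And>t. t \<in> {0..1} \<Longrightarrow> \<gamma> t \<in> X" and \<gamma>e: "\<gamma> 0 = p" "\<gamma> 1 = q"
    using \<gamma> by (auto simp: paths_between_def)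
  \<comment> \<open>a cut-off: a full step where \<open>F\<close> is at least \<open>c - \<delta> / 2\<close>, none below \<open>c - \<delta>\<close>, in particular none at the end points\<close>
  define \<rho> where "\<rho> t = max 0 (min 1 (2 * (F (\<gamma> t) - (c - \<delta>)) / \<delta>))" for t
  define \<gamma>' where "\<gamma>' t = \<Phi> (\<eta> * \<rho> t) (\<gamma> t)" for t
  have \<rho>01: "0 \<le> \<rho> t" "\<rho> t \<le> 1" for t by (auto simp: \<rho>_def)
  have \<eta>\<rho>: "\<eta> * \<rho> t \<in> {0..\<eta>}" for t
    using \<rho>01[of t] pos by (auto intro: mult_left_le)
  have \<rho>c: "continuous_on {0..1} \<rho>"
    unfolding \<rho>_def F_def using \<delta>(1) by (intro continuous_intros cont_F_path[OF \<gamma>]) auto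
  have \<rho>0: "\<rho> t = 0" if "F (\<gamma> t) \<le> c - \<delta>" for t
  proof -
    have "2 * (F (\<gamma> t) - (c - \<delta>)) / \<delta> \<le> 0" using that \<delta>(1) by (intro divide_nonpos_pos) auto
    then show ?thesis by (simp add: \<rho>_def)
  qed
  have \<gamma>': "\<gamma>' \<in> paths_between X p q"
  proof -
    have "continuous_on {0..1} (\<lambda>t. (\<lambda>z. \<Phi> (fst z) (snd z)) (\<eta> * \<rho> t, \<gamma> t))"
      by (rule continuous_on_compose2[OF cont])
         (use \<eta>\<rho> \<gamma>X \<gamma>c \<rho>c in \<open>auto intro!: continuous_intros\<close>)
    moreover have "\<gamma>' t \<in> X" if "t \<in> {0..1}" for t
      unfolding \<gamma>'_def using \<Phi>_in \<eta>\<rho> \<gamma>X that by blast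
    moreover have "\<gamma>' 0 = p"
      using \<rho>0[of 0] \<delta>1 \<delta>(1) \<Phi>_0[of p] \<gamma>X[of 0] by (simp add: \<gamma>'_def \<gamma>e F_def L_start A_start)
    moreover have "\<gamma>' 1 = q"
      using \<rho>0[of 1] \<delta>1 \<delta>(1) end_neg \<Phi>_0[of q] \<gamma>X[of 1] by (simp add: \<gamma>'_def \<gamma>e F_def)
    ultimately show ?thesis unfolding paths_between_def \<gamma>'_def by auto
  qed
  have "F (\<gamma>' t) \<le> c - \<delta> / 2" if t: "t \<in> {0..1}" for t
  proof (cases "F (\<gamma> t) \<le> c - \<delta>")
    case True
    then have "\<gamma>' t = \<gamma> t" using \<rho>0 \<Phi>_0 \<gamma>X t by (simp add: \<gamma>'_def)
    then show ?thesis using True \<delta>(1) by simp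
  next
    case False
    \<comment> \<open>at the parameter \<open>\<mu> + \<delta>\<close> the functional exceeds \<open>F\<close> by exactly \<open>\<delta> * L\<close>\<close>
    have up: "F (\<gamma> t) + \<delta> * L (\<gamma> t) \<le> c + B * \<delta> + \<delta>"
      using lt[OF t] \<delta>(3) by (simp add: F_def algebra_simps)
    then have "\<delta> * L (\<gamma> t) \<le> \<delta> * (B + 2)" using False by (simp add: algebra_simps)
    then have "L (\<gamma> t) \<le> B + 2" using \<delta>(1) by simp
    moreover have "level \<mu> / 2 \<le> F (\<gamma> t)" using False \<delta>1 by (simp add: c_def)
    ultimately have desc: "F (\<gamma>' t) \<le> F (\<gamma> t) - g * (\<eta> * \<rho> t)"
      unfolding \<gamma>'_def F_def using \<eta>\<rho> \<gamma>X[OF t] by (intro descent) auto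
    show ?thesis
    proof (cases "F (\<gamma> t) \<le> c - \<delta> / 2")
      case True
      have "0 \<le> g * (\<eta> * \<rho> t)" using pos \<rho>01 by simp
      then show ?thesis using desc True by linarith
    next
      case False
      then have "1 \<le> 2 * (F (\<gamma> t) - (c - \<delta>)) / \<delta>" using \<delta>(1) by (simp add: field_simps)
      then have "\<rho> t = 1" by (simp add: \<rho>_def)
      moreover have "0 \<le> \<delta> * L (\<gamma> t)" using \<delta>(1) L_nonneg \<gamma>X t by simp
      ultimately show ?thesis using desc up \<delta>2 \<delta>(1) by (simp add: algebra_simps)
    qed
  qed
  then have "level \<mu> \<le> c - \<delta> / 2" using level_le[OF \<gamma>'] unfolding F_def by blast
  then show False using \<delta>(1) by (simp add: c_def)
qed

end

section \<open>Closed polygons\<close>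

text \<open>Closed polygons are indexed by all integers and periodic, so that neighbours of a vertex and
  cyclic shifts of sums need no special treatment at the ends.\<close>

definition polygons :: "nat \<Rightarrow> (int \<Rightarrow> real \<times> real) set" where
  "polygons N = {u. \<forall>j. u (j + int N) = u j}"

text \<open>The square root of the Dirichlet energy rather than the sum of the edge lengths: it dominates the
  length, and critical polygons of the functional below have edges of comparable length.\<close>

definition disc_length :: "nat \<Rightarrow> (int \<Rightarrow> real \<times> real) \<Rightarrow> real" where
  "disc_length N u = sqrt (real N * (\<Sum>j\<in>{0..<int N}. (norm (u (j + 1) - u j))\<^sup>2))"

definition second_diff :: "(int \<Rightarrow> real \<times> real) \<Rightarrow> int \<Rightarrow> real \<times> real" where
  "second_diff u j = (u (j + 1) - u j) - (u j - u (j - 1))"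

lemma polygonsD: "u \<in> polygons N \<Longrightarrow> u (j + int N) = u j"
  by (simp add: polygons_def)

lemma polygonsD':
  assumes "u \<in> polygons N"
  shows "u (j + int N + 1) = u (j + 1)" "u (j + int N - 1) = u (j - 1)"
  using polygonsD[OF assms, of "j + 1"] polygonsD[OF assms, of "j - 1"] by (simp_all add: algebra_simps)

lemma polygons_mod:
  assumes u: "u \<in> polygons N"
  shows "u (j mod int N) = u j"
proof -
  have nat: "u (i + int (k * N)) = u i" for i k
  proof (induction k)
    case (Suc k)
    have "u (i + int (Suc k * N)) = u (i + int (k * N) + int N)" by (simp add: algebra_simps)
    then show ?case using polygonsD[OF u] Suc by simp
  qed simp
  have "u (i + k * int N) = u i" for i k
  proof (cases "0 \<le> k")
    case True
    then show ?thesis using nat[of i "nat k"] by simp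
  next
    case False
    then show ?thesis using nat[of "i + k * int N" "nat (-k)"] by simp
  qed
  from this[of "j mod int N" "j div int N"] show ?thesis by simp
qed

lemma disc_length_nonneg: "0 \<le> disc_length N u"
  by (simp add: disc_length_def sum_nonneg)

lemma disc_length_sq: "(disc_length N u)\<^sup>2 = real N * (\<Sum>j\<in>{0..<int N}. (norm (u (j + 1) - u j))\<^sup>2)"
  by (simp add: disc_length_def sum_nonneg)

text \<open>The inequality of Cauchy and Schwarz.\<close>

lemma sum_edges_le_disc_length: "(\<Sum>j\<in>{0..<int N}. norm (u (j + 1) - u j)) \<le> disc_length N u"
  unfolding disc_length_def
  using sum_squared_le_sum_of_squares[of "\<lambda>j. norm (u (j + 1) - u j)" "{0..<int N}"]
  by (intro real_le_rsqrt) (simp add: mult.commute)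

lemma dist_le_disc_length:
  assumes u: "u \<in> polygons N" and N: "0 < N"
  shows "norm (u i - u j) \<le> disc_length N u"
proof -
  have *: "norm (u j - u i) \<le> disc_length N u" if "0 \<le> i" "i \<le> j" "j < int N" for i j
  proof -
    have "u j - u i = (\<Sum>k\<in>{i..<j}. u (k + 1) - u k)"
      using \<open>i \<le> j\<close> by (rule sum_int_telescope[symmetric])
    also have "norm \<dots> \<le> (\<Sum>k\<in>{i..<j}. norm (u (k + 1) - u k))" by (rule norm_sum)
    also have "\<dots> \<le> (\<Sum>k\<in>{0..<int N}. norm (u (k + 1) - u k))"
      using that by (intro sum_mono2) auto
    finally show ?thesis using sum_edges_le_disc_length[of u N] by linarith
  qed
  have "norm (u (i mod int N) - u (j mod int N)) \<le> disc_length N u"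
    using *[of "i mod int N" "j mod int N"] *[of "j mod int N" "i mod int N"] N
    by (metis linorder_linear norm_minus_commute of_nat_0_less_iff pos_mod_bound pos_mod_sign)
  then show ?thesis using polygons_mod[OF u] by simp
qed

lemma continuous_on_coord: "continuous_on S (\<lambda>u. u j)"
  by (rule continuous_on_subset[OF continuous_on_product_coordinates]) simp

lemma continuous_on_disc_length: "continuous_on S (disc_length N)"
  unfolding disc_length_def by (intro continuous_intros continuous_on_coord)

lemma closed_polygons: "closed (polygons N)"
  unfolding polygons_def by (intro closed_Collect_all closed_Collect_eq continuous_on_coord)

lemma compact_box: "compact {u::int \<Rightarrow> real \<times> real. \<forall>j. norm (u j) \<le> R}"
proof -
  have "compactin (product_topology (\<lambda>i. euclidean) UNIV) (PiE (UNIV::int set) (\<lambda>j. cball (0::real \<times> real) R))"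
    unfolding compactin_PiE by (simp add: compactin_euclidean_iff)
  also have "PiE (UNIV::int set) (\<lambda>j. cball (0::real \<times> real) R) = {u. \<forall>j. norm (u j) \<le> R}"
    by (auto simp: PiE_def)
  finally show ?thesis by (simp add: euclidean_product_topology compactin_euclidean_iff)
qed

section \<open>Length and weighted area of closed polygons\<close>

locale loop_functional = double_primitive K W U V for K W U V +
  fixes N :: nat and \<kappa> a b :: real
  assumes N: "0 < N" and K_bound: "\<And>x y. \<bar>K x y\<bar> \<le> \<kappa>" and \<kappa>: "0 < \<kappa>"
    and ab: "0 < a" "0 < b"
    and per_x: "\<And>x y. K (x + a) y = K x y" and per_y: "\<And>x y. K x (y + b) = K x y"
begin

abbreviation "X \<equiv> polygons N"
abbreviation "len \<equiv> disc_length N"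

text \<open>Joining \<open>u j\<close> to \<open>u (j + 1)\<close> by a horizontal and then a vertical segment gives a closed staircase;
  this is the integral of the one-form \<open>U dy\<close> along it, since only the vertical segments contribute.
  By Green's formula it is the integral of \<open>K\<close> over the enclosed region.\<close>

definition area :: "(int \<Rightarrow> real \<times> real) \<Rightarrow> real" where
  "area u = (\<Sum>j\<in>{0..<int N}. W (fst (u (j + 1))) (snd (u (j + 1))) - W (fst (u (j + 1))) (snd (u j)))"

definition area_grad :: "(int \<Rightarrow> real \<times> real) \<Rightarrow> int \<Rightarrow> real \<times> real" where
  "area_grad u j =
     (V (fst (u j)) (snd (u j)) - V (fst (u j)) (snd (u (j - 1))),
      U (fst (u j)) (snd (u j)) - U (fst (u (j + 1))) (snd (u j)))"

text \<open>The gradient of \<open>\<mu> * len - area\<close> multiplied by \<open>len\<close>. The factor removes the singularity of the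
  gradient of the square root, so that this field is continuous on all polygons.\<close>

definition scaled_grad :: "real \<Rightarrow> (int \<Rightarrow> real \<times> real) \<Rightarrow> int \<Rightarrow> real \<times> real" where
  "scaled_grad \<mu> u j = - (\<mu> * real N) *\<^sub>R second_diff u j - len u *\<^sub>R area_grad u j"

definition move :: "(int \<Rightarrow> real \<times> real) \<Rightarrow> (int \<Rightarrow> real \<times> real) \<Rightarrow> real \<Rightarrow> int \<Rightarrow> real \<times> real" where
  "move u v s j = u j + s *\<^sub>R v j"

lemma cont_W: "continuous_on UNIV (\<lambda>z. W (fst z) (snd z))"
  by (rule has_derivative_continuous_on[OF has_derivative_at_withinI[OF W_has_derivative]])

lemma continuous_on_area: "continuous_on S area"
  unfolding area_def
  by (intro continuous_intros continuous_on_coord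
        continuous_on_compose2[OF cont_W, where f="\<lambda>x. (f x, g x)" for f g, simplified])

lemma continuous_on_scaled_grad: "continuous_on S (\<lambda>u. scaled_grad \<mu> u j)"
  unfolding scaled_grad_def second_diff_def area_grad_def
  by (intro continuous_intros continuous_on_coord continuous_on_disc_length
        continuous_on_compose2[OF cont_U, where f="\<lambda>x. (f x, g x)" for f g, simplified]
        continuous_on_compose2[OF cont_V, where f="\<lambda>x. (f x, g x)" for f g, simplified])

lemma move_in_polygons: "u \<in> X \<Longrightarrow> v \<in> X \<Longrightarrow> move u v s \<in> X"
  by (simp add: polygons_def move_def)

lemma scaled_grad_in_polygons: "u \<in> X \<Longrightarrow> scaled_grad \<mu> u \<in> X"
  unfolding polygons_def mem_Collect_eq scaled_grad_def second_diff_def area_grad_def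
  using polygonsD'[of u N] by (simp add: polygons_def)

text \<open>The chain rule along each edge, followed by a cyclic shift of the terms that contain the
  next vertex.\<close>

lemma DERIV_area:
  assumes u: "u \<in> X" and v: "v \<in> X"
  shows "((\<lambda>s. area (move u v s)) has_real_derivative
           (\<Sum>j\<in>{0..<int N}. area_grad (move u v s) j \<bullet> v j)) (at s)"
proof -
  let ?w = "move u v s"
  have w: "?w \<in> X" by (rule move_in_polygons[OF u v])
  have W_line: "((\<lambda>s. W (p + s * p') (q + s * q')) has_real_derivative
      V (p + s * p') (q + s * q') * p' + U (p + s * p') (q + s * q') * q') (at s)" for p p' q q'
  proof -
    have "((\<lambda>s. (\<lambda>z. W (fst z) (snd z)) (p + s * p', q + s * q')) has_derivative
        (\<lambda>h. fst (h * p', h * q') * V (p + s * p') (q + s * q') + snd (h * p', h * q') * U (p + s * p') (q + s * q'))) (at s)"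
      by (rule has_derivative_compose[where g="\<lambda>z. W (fst z) (snd z)", OF _ W_has_derivative, THEN has_derivative_eq_rhs])
         (auto intro!: derivative_eq_intros)
    then show ?thesis
      by (simp add: has_field_derivative_def) (rule has_derivative_eq_rhs, assumption, auto simp: algebra_simps)
  qed
  define x y p q where "x j = fst (?w j)" and "y j = snd (?w j)" and "p j = fst (v j)" and "q j = snd (v j)" for j
  have "((\<lambda>s. area (move u v s)) has_real_derivative
     (\<Sum>j\<in>{0..<int N}. (V (x (j + 1)) (y (j + 1)) * p (j + 1) + U (x (j + 1)) (y (j + 1)) * q (j + 1))
        - (V (x (j + 1)) (y j) * p (j + 1) + U (x (j + 1)) (y j) * q j))) (at s)"
    unfolding area_def move_def x_def y_def p_def q_def fst_add snd_add fst_scaleR snd_scaleR real_scaleR_def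
    by (intro DERIV_sum DERIV_diff W_line)
  also have "(\<Sum>j\<in>{0..<int N}. (V (x (j + 1)) (y (j + 1)) * p (j + 1) + U (x (j + 1)) (y (j + 1)) * q (j + 1))
        - (V (x (j + 1)) (y j) * p (j + 1) + U (x (j + 1)) (y j) * q j))
     = (\<Sum>j\<in>{0..<int N}. (V (x (j + 1)) (y (j + 1)) - V (x (j + 1)) (y (j + 1 - 1))) * p (j + 1)
            + U (x (j + 1)) (y (j + 1)) * q (j + 1))
       - (\<Sum>j\<in>{0..<int N}. U (x (j + 1)) (y j) * q j)"
    unfolding sum_subtractf[symmetric] by (intro sum.cong) (auto simp: algebra_simps)
  also have "\<dots> = (\<Sum>j\<in>{0..<int N}. (V (x j) (y j) - V (x j) (y (j - 1))) * p j + U (x j) (y j) * q j)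
       - (\<Sum>j\<in>{0..<int N}. U (x (j + 1)) (y j) * q j)"
    using polygonsD[OF w] polygonsD'[OF w] polygonsD[OF v]
    by (subst sum_cyclic_shift[where f="\<lambda>j. (V (x j) (y j) - V (x j) (y (j - 1))) * p j + U (x j) (y j) * q j"])
       (simp_all add: x_def y_def p_def q_def)
  also have "\<dots> = (\<Sum>j\<in>{0..<int N}. area_grad ?w j \<bullet> v j)"
    unfolding sum_subtractf[symmetric]
    by (intro sum.cong) (auto simp: area_grad_def inner_prod_def x_def y_def p_def q_def algebra_simps)
  finally show ?thesis .
qed

text \<open>Summation by parts turns the differences of \<open>v\<close> into second differences of the polygon.\<close>

lemma DERIV_len:
  assumes u: "u \<in> X" and v: "v \<in> X" and pos: "0 < len (move u v s)"
  shows "((\<lambda>s. len (move u v s)) has_real_derivative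
           - real N * (\<Sum>j\<in>{0..<int N}. second_diff (move u v s) j \<bullet> v j) / len (move u v s)) (at s)"
proof -
  let ?w = "move u v s"
  have w: "?w \<in> X" by (rule move_in_polygons[OF u v])
  have "((\<lambda>s. real N * (\<Sum>j\<in>{0..<int N}. (norm (move u v s (j + 1) - move u v s j))\<^sup>2)) has_real_derivative
      real N * (\<Sum>j\<in>{0..<int N}. 2 * ((?w (j + 1) - ?w j) \<bullet> (v (j + 1) - v j)))) (at s)"
    unfolding move_def power2_norm_eq_inner has_field_derivative_def
    by (auto intro!: derivative_eq_intros simp: inner_commute algebra_simps sum_distrib_left inner_diff_left inner_diff_right
        intro!: sum.cong)
  also have "(\<Sum>j\<in>{0..<int N}. 2 * ((?w (j + 1) - ?w j) \<bullet> (v (j + 1) - v j)))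
      = 2 * ((\<Sum>j\<in>{0..<int N}. (?w (j + 1) - ?w (j + 1 - 1)) \<bullet> v (j + 1)) - (\<Sum>j\<in>{0..<int N}. (?w (j + 1) - ?w j) \<bullet> v j))"
    unfolding sum_subtractf[symmetric] sum_distrib_left by (intro sum.cong) (auto simp: algebra_simps inner_diff_right)
  also have "(\<Sum>j\<in>{0..<int N}. (?w (j + 1) - ?w (j + 1 - 1)) \<bullet> v (j + 1)) = (\<Sum>j\<in>{0..<int N}. (?w j - ?w (j - 1)) \<bullet> v j)"
    using polygonsD[OF w] polygonsD'[OF w] polygonsD[OF v]
    by (subst sum_cyclic_shift[where f="\<lambda>j. (?w j - ?w (j - 1)) \<bullet> v j"]) simp_all
  also have "\<dots> - (\<Sum>j\<in>{0..<int N}. (?w (j + 1) - ?w j) \<bullet> v j) = - (\<Sum>j\<in>{0..<int N}. second_diff ?w j \<bullet> v j)"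
    unfolding sum_subtractf[symmetric] sum_negf[symmetric]
    by (intro sum.cong) (auto simp: second_diff_def inner_diff_left)
  finally have D: "((\<lambda>s. real N * (\<Sum>j\<in>{0..<int N}. (norm (move u v s (j + 1) - move u v s j))\<^sup>2)) has_real_derivative
      real N * (2 * - (\<Sum>j\<in>{0..<int N}. second_diff ?w j \<bullet> v j))) (at s)" .
  have "0 < real N * (\<Sum>j\<in>{0..<int N}. (norm (?w (j + 1) - ?w j))\<^sup>2)"
    using pos by (simp add: disc_length_def)
  from DERIV_real_sqrt[OF this] D
  have "((\<lambda>s. len (move u v s)) has_real_derivative
      (inverse (len ?w) / 2) * (real N * (2 * - (\<Sum>j\<in>{0..<int N}. second_diff ?w j \<bullet> v j)))) (at s)"
    unfolding disc_length_def by (rule DERIV_chain2)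
  then show ?thesis by (simp add: field_simps)
qed

lemma DERIV_functional:
  assumes u: "u \<in> X" and v: "v \<in> X" and pos: "0 < len (move u v s)"
  shows "((\<lambda>s. \<mu> * len (move u v s) - area (move u v s)) has_real_derivative
           (\<Sum>j\<in>{0..<int N}. scaled_grad \<mu> (move u v s) j \<bullet> v j) / len (move u v s)) (at s)"
proof -
  let ?w = "move u v s"
  have "(\<Sum>j\<in>{0..<int N}. scaled_grad \<mu> ?w j \<bullet> v j) =
      - (\<mu> * real N) * (\<Sum>j\<in>{0..<int N}. second_diff ?w j \<bullet> v j) - len ?w * (\<Sum>j\<in>{0..<int N}. area_grad ?w j \<bullet> v j)"
    unfolding sum_distrib_left sum_subtractf[symmetric]
    by (intro sum.cong) (auto simp: scaled_grad_def inner_diff_left)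
  then show ?thesis
    using pos by (auto intro!: derivative_eq_intros DERIV_len[OF u v pos] DERIV_area[OF u v] simp: field_simps)
qed

end

section \<open>Critical polygons\<close>

text \<open>A positive function stays positive in a uniform neighbourhood of the compact set \<open>{0} \<times> S\<close>: the first
  components of the points of \<open>{0..1} \<times> S\<close> where it is not positive form a compact set that avoids \<open>0\<close>.\<close>

lemma positive_near_zero:
  fixes S :: "'a::t2_space set" and h :: "real \<times> 'a \<Rightarrow> real"
  assumes S: "compact S" and h: "continuous_on UNIV h" and pos: "\<And>u. u \<in> S \<Longrightarrow> 0 < h (0, u)"
  obtains \<eta> where "0 < \<eta>" "\<And>s u. s \<in> {0..\<eta>} \<Longrightarrow> u \<in> S \<Longrightarrow> 0 < h (s, u)"
proof -
  define Z where "Z = ({0..1} \<times> S) \<inter> {z. h z \<le> 0}"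
  have "compact Z"
    unfolding Z_def by (intro compact_Int_closed compact_Times S compact_Icc closed_Collect_le h continuous_on_const)
  then have Z: "compact (fst ` Z)" by (intro compact_continuous_image continuous_on_fst continuous_on_id)
  have pos_Z: "0 < s" if s: "s \<in> fst ` Z" for s
  proof -
    obtain u where "(s, u) \<in> Z" using s by force
    then show ?thesis using pos[of u] by (cases "s = 0") (auto simp: Z_def)
  qed
  show thesis
  proof (cases "fst ` Z = {}")
    case True
    then show thesis using that[of 1] by (force simp: Z_def)
  next
    case False
    then obtain s0 where s0: "s0 \<in> fst ` Z" "\<And>s. s \<in> fst ` Z \<Longrightarrow> s0 \<le> s"
      using compact_attains_inf[OF Z] by blast
    have "s0 \<le> 1" using s0(1) by (auto simp: Z_def)
    show thesis
    proof (rule that[of "s0 / 2"])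
      show "0 < s0 / 2" using pos_Z[OF s0(1)] by simp
      fix s u assume s: "s \<in> {0..s0 / 2}" and u: "u \<in> S"
      show "0 < h (s, u)"
      proof (rule ccontr)
        assume "\<not> 0 < h (s, u)"
        then have "(s, u) \<in> Z" using s u \<open>s0 \<le> 1\<close> by (auto simp: Z_def)
        then have "s0 \<le> s" using s0(2) by force
        then show False using s pos_Z[OF s0(1)] by auto
      qed
    qed
  qed
qed

context double_primitive begin

text \<open>The mixed difference is the integral of \<open>K\<close> over a rectangle.\<close>

lemma W_mixed_difference:
  assumes "\<And>x y. \<bar>K x y\<bar> \<le> \<kappa>"
  shows "\<bar>(W x' y' - W x' y) - (W x y' - W x y)\<bar> \<le> \<kappa> * \<bar>x' - x\<bar> * \<bar>y' - y\<bar>"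
proof -
  have "\<bar>V x y' - V x y\<bar> \<le> \<kappa> * \<bar>y' - y\<bar>" for x
    by (rule lipschitz_from_derivative_bound[OF V_y assms])
  then have "\<bar>(W x' y' - W x' y) - (W x y' - W x y)\<bar> \<le> (\<kappa> * \<bar>y' - y\<bar>) * \<bar>x' - x\<bar>"
    by (intro lipschitz_from_derivative_bound[where f="\<lambda>x. W x y' - W x y" and f'="\<lambda>x. V x y' - V x y"] DERIV_diff W_x)
  then show ?thesis by (simp add: mult_ac)
qed

end

context loop_functional begin

text \<open>Subtracting the same expression with all abscissas replaced by that of the vertex \<open>0\<close> changes
  nothing, because that expression telescopes to zero. Each remaining term is an integral of \<open>K\<close> over
  a rectangle whose sides are bounded by the length and by the current edge.\<close>

lemma area_bound:
  assumes u: "u \<in> X"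
  shows "\<bar>area u\<bar> \<le> \<kappa> * (len u)\<^sup>2"
proof -
  define x y where "x j = fst (u j)" and "y j = snd (u j)" for j
  have "(\<Sum>j\<in>{0..<int N}. W (x 0) (y (j + 1)) - W (x 0) (y j)) = 0"
    using polygonsD[OF u] by (intro sum_cyclic_diff) (simp add: x_def y_def)
  then have "area u = (\<Sum>j\<in>{0..<int N}. (W (x (j + 1)) (y (j + 1)) - W (x (j + 1)) (y j))
      - (W (x 0) (y (j + 1)) - W (x 0) (y j)))"
    by (simp only: sum_subtractf[where g="\<lambda>j. W (x 0) (y (j + 1)) - W (x 0) (y j)"]) (simp add: area_def x_def y_def)
  also have "\<bar>\<dots>\<bar> \<le> (\<Sum>j\<in>{0..<int N}. \<kappa> * len u * norm (u (j + 1) - u j))"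
  proof (rule order_trans[OF sum_abs], rule sum_mono)
    fix j
    have "\<bar>x (j + 1) - x 0\<bar> \<le> len u"
      using abs_fst_le[of "u (j + 1) - u 0"] dist_le_disc_length[OF u N, of "j + 1" 0] by (simp add: x_def)
    moreover have "\<bar>y (j + 1) - y j\<bar> \<le> norm (u (j + 1) - u j)"
      using abs_snd_le[of "u (j + 1) - u j"] by (simp add: y_def)
    ultimately have "\<kappa> * \<bar>x (j + 1) - x 0\<bar> * \<bar>y (j + 1) - y j\<bar> \<le> \<kappa> * len u * norm (u (j + 1) - u j)"
      using \<kappa> disc_length_nonneg by (intro mult_mono) auto
    with W_mixed_difference[OF K_bound]
    show "\<bar>W (x (j + 1)) (y (j + 1)) - W (x (j + 1)) (y j) - (W (x 0) (y (j + 1)) - W (x 0) (y j))\<bar>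
        \<le> \<kappa> * len u * norm (u (j + 1) - u j)" by (rule order_trans)
  qed
  also have "\<dots> = \<kappa> * len u * (\<Sum>j\<in>{0..<int N}. norm (u (j + 1) - u j))" by (simp add: sum_distrib_left)
  also have "\<dots> \<le> \<kappa> * len u * len u"
    using \<kappa> disc_length_nonneg sum_edges_le_disc_length by (intro mult_left_mono) auto
  finally show ?thesis by (simp add: power2_eq_square mult_ac)
qed

definition shift :: "(int \<Rightarrow> real \<times> real) \<Rightarrow> real \<times> real \<Rightarrow> int \<Rightarrow> real \<times> real" where
  "shift u \<tau> j = u j + \<tau>"

lemma shift_in_polygons: "u \<in> X \<Longrightarrow> shift u \<tau> \<in> X"
  by (simp add: shift_def polygons_def)

lemma len_shift: "len (shift u \<tau>) = len u"
  by (simp add: disc_length_def shift_def)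

lemma
  assumes px: "\<And>x y. K (x + \<alpha>) y = K x y" and py: "\<And>x y. K x (y + \<beta>) = K x y"
  shows area_shift: "u \<in> X \<Longrightarrow> area (shift u (\<alpha>, \<beta>)) = area u"
    and scaled_grad_shift: "scaled_grad \<mu> (shift u (\<alpha>, \<beta>)) = scaled_grad \<mu> u"
proof -
  note per = W_period_x[OF px] W_period_y[OF py] U_period_x[OF px] U_period_y[OF py]
    V_period_x[OF px] V_period_y[OF py]
  have "area_grad (shift u (\<alpha>, \<beta>)) = area_grad u"
    by (auto simp: area_grad_def shift_def per)
  then show "scaled_grad \<mu> (shift u (\<alpha>, \<beta>)) = scaled_grad \<mu> u"
    by (simp add: fun_eq_iff scaled_grad_def second_diff_def len_shift) (simp add: shift_def)
  assume u: "u \<in> X"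
  have "area (shift u (\<alpha>, \<beta>)) =
      area u + (\<Sum>j\<in>{0..<int N}. W \<alpha> (snd (u (j + 1))) - W \<alpha> (snd (u j)))"
    unfolding area_def sum.distrib[symmetric] by (intro sum.cong) (auto simp: shift_def per)
  also have "(\<Sum>j\<in>{0..<int N}. W \<alpha> (snd (u (j + 1))) - W \<alpha> (snd (u j))) = 0"
    using polygonsD[OF u] by (intro sum_cyclic_diff) simp
  finally show "area (shift u (\<alpha>, \<beta>)) = area u" by simp
qed

lemma lattice_normalize:
  obtains \<alpha> \<beta> where "\<And>x y. K (x + \<alpha>) y = K x y" "\<And>x y. K x (y + \<beta>) = K x y"
    "norm (shift u (\<alpha>, \<beta>) 0) \<le> a + b"
proof -
  define \<alpha> \<beta> where "\<alpha> = of_int (- \<lfloor>fst (u 0) / a\<rfloor>) * a" and "\<beta> = of_int (- \<lfloor>snd (u 0) / b\<rfloor>) * b"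
  have red: "\<bar>x + of_int (- \<lfloor>x / c\<rfloor>) * c\<bar> \<le> c" if "0 < c" for x c :: real
    using reduce_modulo_period[OF that, of x] by auto
  have "norm (shift u (\<alpha>, \<beta>) 0) \<le> \<bar>fst (u 0) + \<alpha>\<bar> + \<bar>snd (u 0) + \<beta>\<bar>"
    unfolding shift_def using norm_Pair_le[of "fst (u 0) + \<alpha>" "snd (u 0) + \<beta>"]
    by (simp add: plus_prod_def)
  also have "\<dots> \<le> a + b" unfolding \<alpha>_def \<beta>_def by (intro add_mono red ab)
  finally show thesis
    unfolding \<alpha>_def \<beta>_def
    by (rule that[rotated 2, unfolded \<alpha>_def \<beta>_def])
       (rule period_multiple[of "\<lambda>x. K x y" a for y, OF per_x] period_multiple[of "\<lambda>y. K x y" b for x, OF per_y])+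
qed

definition descend :: "real \<Rightarrow> real \<Rightarrow> (int \<Rightarrow> real \<times> real) \<Rightarrow> int \<Rightarrow> real \<times> real" where
  "descend \<mu> s u = move u (scaled_grad \<mu> u) (- s)"

lemma continuous_on_descend: "continuous_on S (\<lambda>z. descend \<mu> (fst z) (snd z))"
proof (rule continuous_on_coordinatewise_then_product)
  fix j
  have "continuous_on S (\<lambda>z. snd z j)"
    by (rule continuous_on_compose2[OF continuous_on_coord[of UNIV j] continuous_on_snd[OF continuous_on_id]]) simp
  moreover have "continuous_on S (\<lambda>z. scaled_grad \<mu> (snd z) j)"
    by (rule continuous_on_compose2[OF continuous_on_scaled_grad[of UNIV] continuous_on_snd[OF continuous_on_id]]) simp
  ultimately show "continuous_on S (\<lambda>z. descend \<mu> (fst z) (snd z) j)"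
    unfolding descend_def move_def
    by (intro continuous_on_add continuous_on_scaleR continuous_on_minus continuous_on_fst continuous_on_id)
qed

lemma descend_in_polygons: "u \<in> X \<Longrightarrow> descend \<mu> s u \<in> X"
  unfolding descend_def by (intro move_in_polygons scaled_grad_in_polygons)

lemma descend_0: "descend \<mu> 0 u = u"
  by (simp add: descend_def move_def fun_eq_iff)

lemma functional_shift_descend:
  assumes px: "\<And>x y. K (x + \<alpha>) y = K x y" and py: "\<And>x y. K x (y + \<beta>) = K x y" and u: "u \<in> X"
  shows "len (descend \<mu> s (shift u (\<alpha>, \<beta>))) = len (descend \<mu> s u)"
    "area (descend \<mu> s (shift u (\<alpha>, \<beta>))) = area (descend \<mu> s u)"
proof -
  have "descend \<mu> s (shift u (\<alpha>, \<beta>)) = shift (descend \<mu> s u) (\<alpha>, \<beta>)"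
    by (simp add: descend_def scaled_grad_shift[OF px py] fun_eq_iff) (simp add: move_def shift_def)
  then show "len (descend \<mu> s (shift u (\<alpha>, \<beta>))) = len (descend \<mu> s u)"
    "area (descend \<mu> s (shift u (\<alpha>, \<beta>))) = area (descend \<mu> s u)"
    by (simp_all add: len_shift area_shift[OF px py descend_in_polygons[OF u]])
qed

text \<open>A polygon of length zero also has area zero.\<close>

lemma len_pos_if_functional_pos:
  assumes "u \<in> X" "0 < \<mu> * len u - area u"
  shows "0 < len u"
  using assms area_bound[OF assms(1)] disc_length_nonneg[of N u] by (cases "len u = 0") auto

text \<open>The bounds on the length and on the vertex \<open>0\<close> confine all vertices to a ball.\<close>

lemma compact_normalized_sublevel:
  "compact {u \<in> X. len u \<le> M \<and> m \<le> \<mu> * len u - area u \<and> norm (u 0) \<le> R}" (is "compact ?S")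
proof -
  have "?S = {u. \<forall>j. norm (u j) \<le> R + M} \<inter> (X \<inter> {u. len u \<le> M} \<inter> {u. m \<le> \<mu> * len u - area u} \<inter> {u. norm (u 0) \<le> R})"
  proof -
    have "norm (u j) \<le> R + M" if "u \<in> ?S" for u j
    proof -
      have "norm (u j) \<le> norm (u 0) + norm (u j - u 0)" by (metis add.commute diff_add_cancel norm_triangle_ineq)
      then show ?thesis using that dist_le_disc_length[of u N j 0] N by auto
    qed
    then show ?thesis by blast
  qed
  then show ?thesis
    by (auto intro!: compact_Int_closed compact_box closed_Int closed_polygons closed_Collect_le
        continuous_intros continuous_on_disc_length continuous_on_area continuous_on_coord)
qed

text \<open>Without critical points in the region, the gradient is bounded away from zero there, by
  compactness modulo translations, and a single explicit step against it of uniform size decreases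
  the functional at a uniform rate.\<close>

lemma uniform_descent:
  assumes m: "0 < m" and M: "0 \<le> M"
    and noncrit: "\<And>u. u \<in> X \<Longrightarrow> len u \<le> M \<Longrightarrow> m \<le> \<mu> * len u - area u \<Longrightarrow> \<exists>j. scaled_grad \<mu> u j \<noteq> 0"
  obtains \<eta> g where "0 < \<eta>" "0 < g"
    "\<And>s u. s \<in> {0..\<eta>} \<Longrightarrow> u \<in> X \<Longrightarrow> len u \<le> M \<Longrightarrow> m \<le> \<mu> * len u - area u \<Longrightarrow>
       \<mu> * len (descend \<mu> s u) - area (descend \<mu> s u) \<le> \<mu> * len u - area u - g * s"
proof -
  define S where "S = {u \<in> X. len u \<le> M \<and> m \<le> \<mu> * len u - area u \<and> norm (u 0) \<le> a + b}"
  define \<psi> where "\<psi> z = (\<Sum>j\<in>{0..<int N}. scaled_grad \<mu> (descend \<mu> (fst z) (snd z)) j \<bullet> scaled_grad \<mu> (snd z) j)" for z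
  have S: "compact S" unfolding S_def by (rule compact_normalized_sublevel)
  have cG: "continuous_on UNIV (\<lambda>z :: real \<times> (int \<Rightarrow> real \<times> real). scaled_grad \<mu> (snd z) j)" for j
    by (rule continuous_on_compose2[OF continuous_on_scaled_grad[of UNIV]]) (auto intro!: continuous_on_snd continuous_on_id)
  have c\<psi>: "continuous_on UNIV \<psi>"
    unfolding \<psi>_def by (intro continuous_intros cG continuous_on_compose2[OF continuous_on_scaled_grad[of UNIV] continuous_on_descend]) auto
  have cl: "continuous_on UNIV (\<lambda>z. len (descend \<mu> (fst z) (snd z)))"
    by (rule continuous_on_compose2[OF continuous_on_disc_length[of UNIV] continuous_on_descend]) auto
  have \<psi>_pos: "0 < \<psi> (0, u)" if "u \<in> S" for u
  proof -
    have u: "u \<in> X" and "\<exists>j. scaled_grad \<mu> u j \<noteq> 0" using that noncrit by (auto simp: S_def)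
    then obtain j where j: "scaled_grad \<mu> u (j mod int N) \<noteq> 0"
      using polygons_mod[OF scaled_grad_in_polygons[OF u]] by metis
    show ?thesis unfolding \<psi>_def fst_conv snd_conv descend_0
      by (rule sum_pos2[of _ "j mod int N"]) (use j N in auto)
  qed
  have "\<exists>g0>0. \<forall>u\<in>S. g0 \<le> \<psi> (0, u)"
  proof (cases "S = {}")
    case False
    have "continuous_on S (\<lambda>u. \<psi> (0, u))"
      by (rule continuous_on_compose2[OF c\<psi>]) (auto intro!: continuous_intros)
    then show ?thesis using continuous_attains_inf[OF S False] \<psi>_pos by blast
  qed (auto intro: exI[of _ 1])
  then obtain g0 where g0: "0 < g0" "\<And>u. u \<in> S \<Longrightarrow> g0 \<le> \<psi> (0, u)" by blast
  \<comment> \<open>dividing the decrease \<open>\<psi>\<close> by the length, which is at most \<open>M\<close>, still leaves a rate above \<open>g\<close>\<close>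
  define g where "g = g0 / (2 * (M + 1))"
  have g: "0 < g" "g * M < g0" using g0 M by (auto simp: g_def field_simps intro: add_nonneg_pos)
  define h where "h z = min (len (descend \<mu> (fst z) (snd z))) (\<psi> z - g * len (descend \<mu> (fst z) (snd z)))" for z
  obtain \<eta> where \<eta>: "0 < \<eta>" "\<And>s u. s \<in> {0..\<eta>} \<Longrightarrow> u \<in> S \<Longrightarrow> 0 < h (s, u)"
  proof (rule positive_near_zero[OF S])
    show "continuous_on UNIV h" unfolding h_def by (intro continuous_intros cl c\<psi>)
    fix u assume u: "u \<in> S"
    have "0 < len u" using u m by (intro len_pos_if_functional_pos[of _ \<mu>]) (auto simp: S_def)
    moreover have "g * len u \<le> g * M" using u g by (intro mult_left_mono) (auto simp: S_def)
    ultimately show "0 < h (0, u)" using g0(2)[OF u] g(2) unfolding h_def fst_conv snd_conv descend_0 by linarith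
  qed blast
  show thesis
  proof (rule that[OF \<eta>(1) g(1)])
    fix s u assume s: "s \<in> {0..\<eta>}" and u: "u \<in> X" "len u \<le> M" "m \<le> \<mu> * len u - area u"
    obtain \<alpha> \<beta> where per: "\<And>x y. K (x + \<alpha>) y = K x y" "\<And>x y. K x (y + \<beta>) = K x y"
      and norm: "norm (shift u (\<alpha>, \<beta>) 0) \<le> a + b" using lattice_normalize[of u] by blast
    define w where "w = shift u (\<alpha>, \<beta>)"
    have w: "w \<in> S"
      using u norm by (simp add: S_def w_def shift_in_polygons len_shift area_shift[OF per u(1)])
    then have wX: "w \<in> X" by (simp add: S_def)
    define f where "f s = \<mu> * len (descend \<mu> s w) - area (descend \<mu> s w) + g * s" for s
    have "f s \<le> f 0"
    proof (rule DERIV_nonpos_imp_nonincreasing[of 0 s f])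
      show "0 \<le> s" using s by simp
      fix \<sigma> assume "0 \<le> \<sigma>" "\<sigma> \<le> s"
      then have h: "0 < h (\<sigma>, w)" using \<eta>(2) s w by auto
      then have pos: "0 < len (descend \<mu> \<sigma> w)" and \<psi>: "g * len (descend \<mu> \<sigma> w) < \<psi> (\<sigma>, w)" by (auto simp: h_def)
      have "((\<lambda>\<sigma>. \<mu> * len (move w (scaled_grad \<mu> w) \<sigma>) - area (move w (scaled_grad \<mu> w) \<sigma>)) has_real_derivative
          \<psi> (\<sigma>, w) / len (descend \<mu> \<sigma> w)) (at (- \<sigma>))"
        using DERIV_functional[OF wX scaled_grad_in_polygons[OF wX], of \<mu> "- \<sigma>" \<mu>] pos
        by (simp add: \<psi>_def descend_def)
      from DERIV_chain2[OF this DERIV_minus[OF DERIV_ident]]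
      have "(f has_real_derivative \<psi> (\<sigma>, w) / len (descend \<mu> \<sigma> w) * (- 1) + g) (at \<sigma>)"
        unfolding f_def descend_def by (intro DERIV_add) (auto intro!: derivative_eq_intros)
      moreover have "g \<le> \<psi> (\<sigma>, w) / len (descend \<mu> \<sigma> w)" using pos \<psi> by (simp add: field_simps)
      ultimately show "\<exists>y. (f has_real_derivative y) (at \<sigma>) \<and> y \<le> 0" by (intro exI conjI) auto
    qed
    then show "\<mu> * len (descend \<mu> s u) - area (descend \<mu> s u) \<le> \<mu> * len u - area u - g * s"
      by (simp add: f_def descend_0 w_def functional_shift_descend[OF per u(1)] len_shift area_shift[OF per u(1)])
  qed
qed

definition ray :: "(int \<Rightarrow> real \<times> real) \<Rightarrow> real \<Rightarrow> int \<Rightarrow> real \<times> real" where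
  "ray e t j = t *\<^sub>R e j"

lemma ray_path: "e \<in> X \<Longrightarrow> ray e \<in> paths_between X (\<lambda>_. 0) e"
  unfolding paths_between_def
  by (auto simp: ray_def polygons_def intro!: continuous_on_coordinatewise_then_product continuous_intros)

lemma mountain_pass_polygons:
  assumes "e \<in> X"
  shows "mountain_pass X len area (\<lambda>_. 0) e"
  using ray_path[OF assms]
  by unfold_locales (auto simp: disc_length_nonneg continuous_on_disc_length continuous_on_area,
     auto simp: disc_length_def area_def)

abbreviation "polygon_level e \<equiv> pass_level X len area (\<lambda>_. 0) e"

lemma len_ray: "0 \<le> t \<Longrightarrow> len (ray e t) = t * len e"
proof -
  assume "0 \<le> t"
  have "real N * (\<Sum>j\<in>{0..<int N}. (norm (ray e t (j + 1) - ray e t j))\<^sup>2) =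
      t\<^sup>2 * (real N * (\<Sum>j\<in>{0..<int N}. (norm (e (j + 1) - e j))\<^sup>2))"
    by (simp add: ray_def scaleR_diff_right[symmetric] power_mult_distrib sum_distrib_left mult_ac)
  then show ?thesis using \<open>0 \<le> t\<close> by (simp only: disc_length_def real_sqrt_mult) simp
qed

lemma polygon_level_le:
  assumes e: "e \<in> X" and "0 \<le> \<mu>"
  shows "polygon_level e \<mu> \<le> \<mu> * len e + \<kappa> * (len e)\<^sup>2"
proof -
  interpret mountain_pass X len area "\<lambda>_. 0" e by (rule mountain_pass_polygons[OF e])
  show ?thesis
  proof (rule level_le[OF ray_path[OF e]])
    fix t :: real assume t: "t \<in> {0..1}"
    have le: "len (ray e t) \<le> len e"
      using t disc_length_nonneg[of N e] by (simp add: len_ray mult_left_le_one_le)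
    have "ray e t \<in> X" using ray_path[OF e] t by (auto simp: paths_between_def)
    then have "- area (ray e t) \<le> \<kappa> * (len (ray e t))\<^sup>2" using area_bound by (metis abs_le_D2)
    also have "\<dots> \<le> \<kappa> * (len e)\<^sup>2"
      using le \<kappa> disc_length_nonneg by (intro mult_left_mono power_mono) auto
    finally show "\<mu> * len (ray e t) - area (ray e t) \<le> \<mu> * len e + \<kappa> * (len e)\<^sup>2"
      using mult_left_mono[OF le \<open>0 \<le> \<mu>\<close>] by linarith
  qed
qed

text \<open>A path from a constant polygon to one on which the functional is negative must pass through
  polygons of length \<open>\<mu> / (2 * \<kappa>)\<close>, and there the functional is at least \<open>\<mu>\<^sup>2 / (4 * \<kappa>)\<close> because the
  area is at most \<open>\<kappa> * len\<^sup>2\<close>.\<close>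

lemma polygon_level_pos:
  assumes e: "e \<in> X" and \<mu>: "0 < \<mu>" and neg: "\<mu> * len e - area e < 0"
  shows "0 < polygon_level e \<mu>"
proof -
  interpret mountain_pass X len area "\<lambda>_. 0" e by (rule mountain_pass_polygons[OF e])
  have "\<mu>\<^sup>2 / (4 * \<kappa>) \<le> polygon_level e \<mu>"
  proof (rule level_ge)
    fix \<gamma> assume \<gamma>: "\<gamma> \<in> paths_between X (\<lambda>_. 0) e"
    \<comment> \<open>the length that maximizes \<open>\<mu> * r - \<kappa> * r\<^sup>2\<close>\<close>
    define r where "r = \<mu> / (2 * \<kappa>)"
    have "\<mu> * len e < \<kappa> * (len e)\<^sup>2" using neg area_bound[OF e] by linarith
    then have "\<mu> < \<kappa> * len e"
      using disc_length_nonneg[of N e] by (auto simp: power2_eq_square mult.assoc[symmetric] mult_less_cancel_right)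
    then have r: "0 \<le> r" "r \<le> len e" using \<mu> \<kappa> by (auto simp: r_def field_simps)
    have "continuous_on {0..1} (\<lambda>t. len (\<gamma> t))"
      using \<gamma> by (intro continuous_on_compose2[OF cont_L]) (auto simp: paths_between_def)
    moreover have "len (\<gamma> 0) \<le> r" "r \<le> len (\<gamma> 1)" using \<gamma> r L_start by (auto simp: paths_between_def)
    ultimately obtain t where t: "0 \<le> t" "t \<le> 1" "len (\<gamma> t) = r"
      using IVT'[of "\<lambda>t. len (\<gamma> t)" 0 r 1] by auto
    have "\<gamma> t \<in> X" using \<gamma> t by (auto simp: paths_between_def)
    then have "area (\<gamma> t) \<le> \<kappa> * r\<^sup>2" using area_bound t(3) by (metis abs_le_D1)
    then have "\<mu> * r - \<kappa> * r\<^sup>2 \<le> \<mu> * len (\<gamma> t) - area (\<gamma> t)" using t(3) by simp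
    moreover have "\<mu> * r - \<kappa> * r\<^sup>2 = \<mu>\<^sup>2 / (4 * \<kappa>)"
      using \<kappa> by (simp add: r_def field_simps power2_eq_square)
    ultimately show "\<exists>t\<in>{0..1}. \<mu>\<^sup>2 / (4 * \<kappa>) \<le> \<mu> * len (\<gamma> t) - area (\<gamma> t)"
      using t by (intro bexI[of _ t]) auto
  qed
  moreover have "0 < \<mu>\<^sup>2 / (4 * \<kappa>)" using \<mu> \<kappa> by simp
  ultimately show ?thesis by linarith
qed

text \<open>Otherwise \<open>uniform_descent\<close> provides the descent that \<open>no_descent_at_level\<close> forbids. The
  critical polygon may be translated by periods, which gives the bound on its vertex \<open>0\<close>.\<close>

lemma critical_polygon_exists:
  assumes e: "e \<in> X" and \<mu>: "0 < \<mu>" and neg: "\<mu> * len e - area e < 0" and B: "0 \<le> B"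
    and slope: "\<And>d. 0 < d \<Longrightarrow> \<exists>\<delta>. 0 < \<delta> \<and> \<delta> < d \<and> polygon_level e (\<mu> + \<delta>) \<le> polygon_level e \<mu> + B * \<delta>"
  shows "\<exists>u\<in>X. 0 < len u \<and> len u \<le> B + 2 \<and> norm (u 0) \<le> a + b \<and> (\<forall>j. scaled_grad \<mu> u j = 0)"
proof (rule ccontr)
  assume no: "\<not> ?thesis"
  interpret mountain_pass X len area "\<lambda>_. 0" e by (rule mountain_pass_polygons[OF e])
  define m where "m = polygon_level e \<mu> / 2"
  have m: "0 < m" unfolding m_def using polygon_level_pos[OF e \<mu> neg] by simp
  have noncrit: "\<exists>j. scaled_grad \<mu> u j \<noteq> 0" if u: "u \<in> X" "len u \<le> B + 2" "m \<le> \<mu> * len u - area u" for u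
  proof -
    obtain \<alpha> \<beta> where per: "\<And>x y. K (x + \<alpha>) y = K x y" "\<And>x y. K x (y + \<beta>) = K x y"
      and norm: "norm (shift u (\<alpha>, \<beta>) 0) \<le> a + b" using lattice_normalize[of u] by blast
    have "0 < len u" using u m by (intro len_pos_if_functional_pos[of _ \<mu>]) auto
    then have "\<exists>j. scaled_grad \<mu> (shift u (\<alpha>, \<beta>)) j \<noteq> 0"
      using no norm u shift_in_polygons[OF u(1)] by (metis len_shift)
    then show ?thesis by (simp add: scaled_grad_shift[OF per])
  qed
  obtain \<eta> g where "0 < \<eta>" "0 < g"
    "\<And>s u. s \<in> {0..\<eta>} \<Longrightarrow> u \<in> X \<Longrightarrow> len u \<le> B + 2 \<Longrightarrow> m \<le> \<mu> * len u - area u \<Longrightarrow>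
       \<mu> * len (descend \<mu> s u) - area (descend \<mu> s u) \<le> \<mu> * len u - area u - g * s"
  proof (rule uniform_descent[OF m, of "B + 2" \<mu>])
    show "0 \<le> B + 2" using B by simp
  qed (use noncrit in blast)+
  then show False
    using neg B polygon_level_pos[OF e \<mu> neg]
    by (intro no_descent_at_level[of \<mu> B \<eta> g "descend \<mu>"] slope)
       (auto simp: m_def descend_0 descend_in_polygons continuous_on_descend)
qed

end

section \<open>Rectangles made of period cells\<close>

definition ramp :: "real \<Rightarrow> real" where
  "ramp r = max 0 (min 1 r)"

lemma ramp_values: "1 \<le> r \<Longrightarrow> ramp r = 1" "r \<le> 0 \<Longrightarrow> ramp r = 0"
  by (auto simp: ramp_def)

lemma ramp_lipschitz: "\<bar>ramp x - ramp y\<bar> \<le> \<bar>x - y\<bar>"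
  by (auto simp: ramp_def)

lemma ramp_min_lipschitz:
  assumes "\<bar>x - x'\<bar> \<le> h" "\<bar>y - y'\<bar> \<le> h"
  shows "\<bar>ramp (min x y) - ramp (min x' y')\<bar> \<le> h"
proof -
  have "\<bar>min x y - min x' y'\<bar> \<le> h" using assms by (auto simp: min_def)
  then show ?thesis using ramp_lipschitz by (rule order_trans[rotated])
qed

text \<open>The boundary of \<open>{0..A} \<times> {0..B}\<close> run through counterclockwise, with \<open>k\<close> edges on each side. The
  corners are vertices and all edges are parallel to the axes, so the polygon coincides with its
  staircase.\<close>

definition rectangle :: "real \<Rightarrow> real \<Rightarrow> nat \<Rightarrow> int \<Rightarrow> real \<times> real" where
  "rectangle A B k j =
     (let r = real_of_int (j mod (4 * int k)) / real k
      in (A * ramp (min r (3 - r)), B * ramp (min (r - 1) (4 - r))))"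

context loop_functional begin

context
  fixes A B :: real and k :: nat
  assumes Nk: "N = 4 * k" and AB: "0 \<le> A" "0 \<le> B"
begin

lemma k_pos: "0 < k"
  using N Nk by simp

lemma rectangle_in_polygons: "rectangle A B k \<in> X"
  by (simp add: polygons_def rectangle_def Nk)

lemma rectangle_eq:
  assumes "0 \<le> j" "j \<le> 4 * int k"
  shows "rectangle A B k j = (A * ramp (min (j / k) (3 - j / k)), B * ramp (min (j / k - 1) (4 - j / k)))"
proof (cases "j = 4 * int k")
  case True
  then show ?thesis using k_pos by (simp add: rectangle_def ramp_def)
next
  case False
  then show ?thesis using assms by (simp add: rectangle_def Let_def)
qed

lemma len_rectangle: "len (rectangle A B k) \<le> 4 * (A + B)"
proof -
  let ?e = "rectangle A B k"
  have edge: "norm (?e (j + 1) - ?e j) \<le> (A + B) / k" if j: "j \<in> {0..<int N}" for j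
  proof -
    define r where "r = j / k"
    have r1: "real_of_int (j + 1) / k = r + 1 / k" by (simp add: r_def add_divide_distrib)
    have e: "?e j = (A * ramp (min r (3 - r)), B * ramp (min (r - 1) (4 - r)))"
      using rectangle_eq[of j] j Nk by (simp add: r_def)
    have e1: "?e (j + 1) = (A * ramp (min (r + 1 / k) (3 - (r + 1 / k))), B * ramp (min (r + 1 / k - 1) (4 - (r + 1 / k))))"
      using rectangle_eq[of "j + 1"] j Nk unfolding r1 by simp
    have k: "0 < 1 / real k" using k_pos by simp
    have lip: "\<bar>ramp (min (r + 1 / k) (3 - (r + 1 / k))) - ramp (min r (3 - r))\<bar> \<le> 1 / k"
      "\<bar>ramp (min (r + 1 / k - 1) (4 - (r + 1 / k))) - ramp (min (r - 1) (4 - r))\<bar> \<le> 1 / k"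
      using k by (auto intro!: ramp_min_lipschitz)
    have scale: "\<bar>D * x - D * y\<bar> \<le> D * h" if "0 \<le> D" "\<bar>x - y\<bar> \<le> h" for D x y h :: real
      using that by (simp add: right_diff_distrib[symmetric] abs_mult mult_left_mono)
    have "norm (?e (j + 1) - ?e j) \<le> \<bar>A * ramp (min (r + 1 / k) (3 - (r + 1 / k))) - A * ramp (min r (3 - r))\<bar>
        + \<bar>B * ramp (min (r + 1 / k - 1) (4 - (r + 1 / k))) - B * ramp (min (r - 1) (4 - r))\<bar>"
      unfolding e e1 diff_Pair using norm_Pair_le by (metis real_norm_def)
    also have "\<dots> \<le> A * (1 / k) + B * (1 / k)"
      using scale[OF AB(1) lip(1)] scale[OF AB(2) lip(2)] by (rule add_mono)
    finally show ?thesis by (simp add: add_divide_distrib)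
  qed
  have "(len ?e)\<^sup>2 \<le> real N * (\<Sum>j\<in>{0..<int N}. ((A + B) / k)\<^sup>2)"
    unfolding disc_length_sq using edge by (intro mult_left_mono sum_mono power_mono) auto
  also have "\<dots> = (4 * (A + B))\<^sup>2"
  proof -
    have "4 * (A + B) = real N * ((A + B) / k)" using k_pos by (simp add: Nk)
    then show ?thesis by (simp add: power_mult_distrib power2_eq_square)
  qed
  finally show ?thesis by (rule power2_le_imp_le) (use AB in simp)
qed

text \<open>Vertical edges on the left side contribute \<open>0\<close> since \<open>W 0 y = 0\<close>, horizontal ones contribute nothing
  by definition, and the right side telescopes.\<close>

lemma area_rectangle: "area (rectangle A B k) = W A B"
proof -
  let ?e = "rectangle A B k"
  define t where "t j = W (fst (?e (j + 1))) (snd (?e (j + 1))) - W (fst (?e (j + 1))) (snd (?e j))" for j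
  have ratio: "real_of_int i / k \<le> real m \<longleftrightarrow> i \<le> int m * int k" "real m \<le> real_of_int i / k \<longleftrightarrow> int m * int k \<le> i" for i m
  proof -
    have "real_of_int i / k \<le> real m \<longleftrightarrow> real_of_int i \<le> real_of_int (int m * int k)"
      "real m \<le> real_of_int i / k \<longleftrightarrow> real_of_int (int m * int k) \<le> real_of_int i"
      using k_pos by (simp_all add: field_simps)
    then show "real_of_int i / k \<le> real m \<longleftrightarrow> i \<le> int m * int k" "real m \<le> real_of_int i / k \<longleftrightarrow> int m * int k \<le> i"
      by (simp_all only: of_int_le_iff)
  qed
  note ratio' = ratio(1)[of _ 1] ratio(1)[of _ 2] ratio(1)[of _ 3] ratio(2)[of 1] ratio(2)[of 2] ratio(2)[of 3]
  have right: "fst (?e j) = A" if "int k \<le> j" "j \<le> 2 * int k" for j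
    using that ratio'[of j] by (subst rectangle_eq) (auto simp: min_le_iff_disj intro!: ramp_values)
  have left: "fst (?e j) = 0" if "3 * int k \<le> j" "j \<le> 4 * int k" for j
    using that ratio'[of j] by (subst rectangle_eq) (auto simp: min_le_iff_disj intro!: ramp_values)
  have bottom: "snd (?e j) = 0" if "0 \<le> j" "j \<le> int k" for j
    using that ratio'[of j] by (subst rectangle_eq) (auto simp: min_le_iff_disj intro!: ramp_values)
  have top: "snd (?e j) = B" if "2 * int k \<le> j" "j \<le> 3 * int k" for j
    using that ratio'[of j] by (subst rectangle_eq) (auto simp: min_le_iff_disj intro!: ramp_values)
  have zero: "t j = 0" if j: "j \<in> {0..<4 * int k} - {int k..<2 * int k}" for j
  proof -
    consider "0 \<le> j" "j + 1 \<le> int k" | "2 * int k \<le> j" "j + 1 \<le> 3 * int k" | "3 * int k \<le> j" "j + 1 \<le> 4 * int k"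
      using j by force
    then show ?thesis
      by cases (auto simp: t_def W_0 left bottom top)
  qed
  have "area ?e = sum t {0..<4 * int k}" unfolding area_def t_def by (simp only: Nk of_nat_mult of_nat_numeral)
  also have "\<dots> = sum t {int k..<2 * int k}"
    by (rule sum.mono_neutral_right) (use zero in auto)
  also have "\<dots> = (\<Sum>j\<in>{int k..<2 * int k}. W A (snd (?e (j + 1))) - W A (snd (?e j)))"
  proof (rule sum.cong)
    fix j assume j: "j \<in> {int k..<2 * int k}"
    then have "fst (?e (j + 1)) = A" by (intro right) auto
    then show "t j = W A (snd (?e (j + 1))) - W A (snd (?e j))" by (simp add: t_def)
  qed simp
  also have "\<dots> = W A (snd (?e (2 * int k))) - W A (snd (?e (int k)))"
    by (rule sum_int_telescope) simp
  also have "\<dots> = W A B" by (simp add: top bottom W_0)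
  finally show ?thesis .
qed

end
end

section \<open>Estimates for discrete Euler-Lagrange equations\<close>

text \<open>A function with mean zero is bounded by its oscillation.\<close>

lemma mean_zero_cyclic_bound:
  fixes f :: "int \<Rightarrow> real"
  assumes step: "\<And>j. \<bar>f (j + 1) - f j\<bar> \<le> \<delta>" and sum0: "(\<Sum>j\<in>{0..<int N}. f j) = 0"
    and i: "i \<in> {0..<int N}"
  shows "\<bar>f i\<bar> \<le> real N * \<delta>"
proof -
  have \<delta>: "0 \<le> \<delta>" using step[of 0] by linarith
  have "real N * f i = (\<Sum>j\<in>{0..<int N}. f i - f j)" using sum0 by (simp add: sum_subtractf)
  also have "\<bar>\<dots>\<bar> \<le> (\<Sum>j\<in>{0..<int N}. \<delta> * real N)"
  proof (rule order_trans[OF sum_abs], rule sum_mono)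
    fix j assume j: "j \<in> {0..<int N}"
    have "\<bar>f i - f j\<bar> \<le> \<delta> * \<bar>i - j\<bar>" using int_steps_bound[of f \<delta> i j] step by simp
    also have "\<dots> \<le> \<delta> * real N" using i j \<delta> by (intro mult_left_mono) auto
    finally show "\<bar>f i - f j\<bar> \<le> \<delta> * real N" .
  qed
  also have "\<dots> = real N * (real N * \<delta>)" by simp
  finally show ?thesis using i by (simp add: abs_mult)
qed

text \<open>The equations of a critical polygon in terms of the velocity \<open>v\<close>, with \<open>c = l / \<mu>\<close>: a semi-implicit
  Euler scheme with step \<open>1 / N\<close> for \<open>u' = v\<close>, \<open>v' = c K(u) rot v\<close>, in which \<open>K\<close> is evaluated at
  intermediate points of adjacent edges.\<close>

definition euler_lagrange ::
    "(real \<Rightarrow> real \<Rightarrow> real) \<Rightarrow> nat \<Rightarrow> real \<Rightarrow> real \<Rightarrow> (int \<Rightarrow> real \<times> real) \<Rightarrow> (int \<Rightarrow> real \<times> real) \<Rightarrow> bool" where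
  "euler_lagrange K N c l u v \<longleftrightarrow>
     u \<in> polygons N \<and> v \<in> polygons N \<and>
     (\<forall>j. u (j + 1) - u j = v j /\<^sub>R real N) \<and>
     (\<Sum>j\<in>{0..<int N}. (norm (v j))\<^sup>2) = real N * l\<^sup>2 \<and>
     (\<forall>j. \<exists>\<eta>. \<bar>\<eta> - snd (u j)\<bar> \<le> \<bar>snd (u (j + 1)) - snd (u j)\<bar> \<and>
        fst (v (j + 1)) - fst (v j) = - (c / real N * K (fst (u (j + 1))) \<eta> * snd (v j))) \<and>
     (\<forall>j. \<exists>\<xi>. \<bar>\<xi> - fst (u j)\<bar> \<le> \<bar>fst (u (j + 1)) - fst (u j)\<bar> \<and>
        snd (v j) - snd (v (j - 1)) = c / real N * K \<xi> (snd (u j)) * fst (v j))"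

context loop_functional begin

text \<open>The gradient of the area consists of increments of \<open>V\<close> and \<open>U\<close> in one variable, which the mean
  value theorem expresses through \<open>K\<close>.\<close>

lemma critical_imp_euler_lagrange:
  assumes u: "u \<in> X" and \<mu>: "0 < \<mu>" and crit: "\<And>j. scaled_grad \<mu> u j = 0"
  shows "euler_lagrange K N (len u / \<mu>) (len u) u (\<lambda>j. real N *\<^sub>R (u (j + 1) - u j))"
proof -
  define v where "v j = real N *\<^sub>R (u (j + 1) - u j)" for j
  have Npos: "0 < real N" using N by simp
  have eq: "v j - v (j - 1) = - (len u / \<mu>) *\<^sub>R area_grad u j" for j
  proof -
    have sd: "v j - v (j - 1) = real N *\<^sub>R second_diff u j"
      by (simp add: v_def second_diff_def algebra_simps)
    have "\<mu> *\<^sub>R (v j - v (j - 1)) = - (len u *\<^sub>R area_grad u j)"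
      using crit[of j] by (simp add: sd scaled_grad_def) (metis add.inverse_inverse)
    then have "(1 / \<mu>) *\<^sub>R (\<mu> *\<^sub>R (v j - v (j - 1))) = (1 / \<mu>) *\<^sub>R (- (len u *\<^sub>R area_grad u j))" by simp
    then show ?thesis using \<mu> by simp
  qed
  have du: "u (j + 1) - u j = v j /\<^sub>R real N" for j
    using Npos by (simp add: v_def)
  have first: "\<exists>\<eta>. \<bar>\<eta> - snd (u j)\<bar> \<le> \<bar>snd (u (j + 1)) - snd (u j)\<bar> \<and>
        fst (v (j + 1)) - fst (v j) = - (len u / \<mu> / real N * K (fst (u (j + 1))) \<eta> * snd (v j))" for j
  proof -
    obtain \<eta> where \<eta>: "\<bar>\<eta> - snd (u j)\<bar> \<le> \<bar>snd (u (j + 1)) - snd (u j)\<bar>"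
      "V (fst (u (j + 1))) (snd (u (j + 1))) - V (fst (u (j + 1))) (snd (u j))
        = K (fst (u (j + 1))) \<eta> * (snd (u (j + 1)) - snd (u j))"
      using mvt_between[OF V_y] by blast
    have "fst (v (j + 1)) - fst (v j) = - (len u / \<mu>) * (K (fst (u (j + 1))) \<eta> * (snd (u (j + 1)) - snd (u j)))"
      using arg_cong[OF eq[of "j + 1"], of fst] by (simp add: area_grad_def \<eta>(2)[symmetric])
    also have "snd (u (j + 1)) - snd (u j) = snd (v j) / real N"
      using arg_cong[OF du[of j], of snd] by (simp add: divide_inverse_commute)
    finally show ?thesis using \<eta>(1) by (intro exI[of _ \<eta>]) simp
  qed
  have second: "\<exists>\<xi>. \<bar>\<xi> - fst (u j)\<bar> \<le> \<bar>fst (u (j + 1)) - fst (u j)\<bar> \<and>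
        snd (v j) - snd (v (j - 1)) = len u / \<mu> / real N * K \<xi> (snd (u j)) * fst (v j)" for j
  proof -
    obtain \<xi> where \<xi>: "\<bar>\<xi> - fst (u j)\<bar> \<le> \<bar>fst (u (j + 1)) - fst (u j)\<bar>"
      "U (fst (u (j + 1))) (snd (u j)) - U (fst (u j)) (snd (u j))
        = K \<xi> (snd (u j)) * (fst (u (j + 1)) - fst (u j))"
      using mvt_between[OF U_x] by blast
    have "snd (v j) - snd (v (j - 1)) = (len u / \<mu>) * (U (fst (u (j + 1))) (snd (u j)) - U (fst (u j)) (snd (u j)))"
      using arg_cong[OF eq[of j], of snd] by (simp add: area_grad_def right_diff_distrib)
    also note \<xi>(2)
    also have "fst (u (j + 1)) - fst (u j) = fst (v j) / real N"
      using arg_cong[OF du[of j], of fst] by (simp add: divide_inverse_commute)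
    finally show ?thesis using \<xi>(1) by (intro exI[of _ \<xi>]) simp
  qed
  have energy: "(\<Sum>j\<in>{0..<int N}. (norm (v j))\<^sup>2) = real N * (len u)\<^sup>2"
    unfolding v_def disc_length_sq norm_scaleR power_mult_distrib sum_distrib_left[symmetric]
    by (simp add: power2_eq_square[of "real N"] mult.assoc)
  have vX: "v \<in> X" using polygonsD[OF u] polygonsD'[OF u] by (simp add: polygons_def v_def)
  show ?thesis
    unfolding euler_lagrange_def v_def[symmetric]
    using u vX du energy first second by (simp add: v_def[symmetric])
qed

end

lemma power_one_plus_le_exp:
  assumes "0 \<le> h" "real n * h \<le> C"
  shows "(1 + h) ^ n \<le> exp (C::real)"
proof -
  have "(1 + h) ^ n \<le> exp h ^ n" using assms(1) by (intro power_mono exp_ge_add_one_self) auto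
  also have "\<dots> = exp (real n * h)" by (simp add: exp_of_nat_mult)
  also have "\<dots> \<le> exp C" using assms(2) by simp
  finally show ?thesis .
qed

context
  fixes K :: "real \<Rightarrow> real \<Rightarrow> real" and N :: nat and c l \<kappa> :: real and u v :: "int \<Rightarrow> real \<times> real"
  assumes el: "euler_lagrange K N c l u v" and N: "0 < N" and c: "0 \<le> c" and l: "0 < l"
    and K: "\<And>x y. \<bar>K x y\<bar> \<le> \<kappa>" and \<kappa>: "0 < \<kappa>"
begin

lemma el_step_fst: "\<bar>fst (v (j + 1)) - fst (v j)\<bar> \<le> c * \<kappa> / N * \<bar>snd (v j)\<bar>"
proof -
  obtain \<eta> where "fst (v (j + 1)) - fst (v j) = - (c / N * K (fst (u (j + 1))) \<eta> * snd (v j))"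
    using el unfolding euler_lagrange_def by blast
  then have "\<bar>fst (v (j + 1)) - fst (v j)\<bar> = c / N * \<bar>K (fst (u (j + 1))) \<eta>\<bar> * \<bar>snd (v j)\<bar>"
    using c by (simp add: abs_mult)
  also have "\<dots> \<le> c / N * \<kappa> * \<bar>snd (v j)\<bar>" using c K by (intro mult_right_mono mult_left_mono) auto
  finally show ?thesis by simp
qed

lemma el_step_snd: "\<bar>snd (v (j + 1)) - snd (v j)\<bar> \<le> c * \<kappa> / N * \<bar>fst (v (j + 1))\<bar>"
proof -
  obtain \<xi> where "snd (v (j + 1)) - snd (v (j + 1 - 1)) = c / N * K \<xi> (snd (u (j + 1))) * fst (v (j + 1))"
    using el unfolding euler_lagrange_def by blast
  then have "\<bar>snd (v (j + 1)) - snd (v j)\<bar> = c / N * \<bar>K \<xi> (snd (u (j + 1)))\<bar> * \<bar>fst (v (j + 1))\<bar>"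
    using c by (simp add: abs_mult)
  also have "\<dots> \<le> c / N * \<kappa> * \<bar>fst (v (j + 1))\<bar>" using c K by (intro mult_right_mono mult_left_mono) auto
  finally show ?thesis by simp
qed

text \<open>The mean square of the speed is \<open>l\<^sup>2\<close>, so some vertex has speed at most \<open>l\<close>; starting from it, at most
  \<open>N\<close> steps reach any other vertex, each of them increasing the speed by a factor of at most
  \<open>(1 + c * \<kappa> / N)\<^sup>2\<close>.\<close>

lemma el_speed_bound: "\<bar>fst (v j)\<bar> + \<bar>snd (v j)\<bar> \<le> 2 * l * exp (2 * c * \<kappa>)"
proof -
  define s where "s j = \<bar>fst (v j)\<bar> + \<bar>snd (v j)\<bar>" for j
  define h where "h = c * \<kappa> / N"
  have h: "0 \<le> h" using c \<kappa> by (simp add: h_def)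
  have vX: "v \<in> polygons N" using el by (simp add: euler_lagrange_def)
  have "\<exists>i\<in>{0..<int N}. (norm (v i))\<^sup>2 \<le> l\<^sup>2"
  proof (rule ccontr)
    assume "\<not> ?thesis"
    then have "(\<Sum>i\<in>{0..<int N}. l\<^sup>2) < (\<Sum>i\<in>{0..<int N}. (norm (v i))\<^sup>2)"
      using N by (intro sum_strict_mono) (auto simp: not_le)
    then show False using el by (simp add: euler_lagrange_def)
  qed
  then obtain i where "(norm (v i))\<^sup>2 \<le> l\<^sup>2" by blast
  then have "norm (v i) \<le> l" using l by (simp add: power2_le_iff_abs_le)
  then have si: "s i \<le> 2 * l" using abs_fst_le[of "v i"] abs_snd_le[of "v i"] unfolding s_def by linarith
  \<comment> \<open>the square appears because the second component is updated with the new value of the first\<close>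
  have step: "s (j + 1) \<le> (1 + h)\<^sup>2 * s j" for j
  proof -
    have 1: "\<bar>fst (v (j + 1))\<bar> \<le> \<bar>fst (v j)\<bar> + h * \<bar>snd (v j)\<bar>"
      using el_step_fst[of j] unfolding h_def by linarith
    have 2: "\<bar>snd (v (j + 1))\<bar> \<le> \<bar>snd (v j)\<bar> + h * \<bar>fst (v (j + 1))\<bar>"
      using el_step_snd[of j] unfolding h_def by linarith
    have "s (j + 1) \<le> (1 + h) * \<bar>fst (v (j + 1))\<bar> + \<bar>snd (v j)\<bar>"
      using 2 unfolding s_def by (simp add: algebra_simps)
    also have "\<dots> \<le> (1 + h) * (\<bar>fst (v j)\<bar> + h * \<bar>snd (v j)\<bar>) + \<bar>snd (v j)\<bar>"
      using 1 h by (intro add_right_mono mult_left_mono) auto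
    also have "\<dots> = (1 + h)\<^sup>2 * s j - (h * (1 + h) * \<bar>fst (v j)\<bar> + h * \<bar>snd (v j)\<bar>)"
      unfolding s_def by (simp add: algebra_simps power2_eq_square)
    also have "\<dots> \<le> (1 + h)\<^sup>2 * s j"
      using h by (simp only: diff_le_eq le_add_same_cancel1) (intro add_nonneg_nonneg mult_nonneg_nonneg; simp)
    finally show ?thesis .
  qed
  have iter: "s (i + int n) \<le> (1 + h) ^ (2 * n) * s i" for n
  proof (induction n)
    case (Suc n)
    have "s (i + int (Suc n)) \<le> (1 + h)\<^sup>2 * s (i + int n)" using step[of "i + int n"] by (simp add: algebra_simps)
    also have "\<dots> \<le> (1 + h)\<^sup>2 * ((1 + h) ^ (2 * n) * s i)" using Suc by (intro mult_left_mono) auto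
    finally show ?case by (simp add: power_add power2_eq_square mult_ac)
  qed simp
  define n where "n = nat ((j - i) mod int N)"
  have n: "n \<le> N" "i + int n = i + (j - i) mod int N" using N by (auto simp: n_def nat_le_iff less_imp_le)
  have "(i + int n) mod int N = j mod int N" unfolding n(2) by (simp add: mod_simps)
  then have "v (i + int n) = v j" using polygons_mod[OF vX] by metis
  then have "s j \<le> (1 + h) ^ (2 * n) * s i" using iter[of n] by (simp add: s_def)
  also have "\<dots> \<le> exp (2 * c * \<kappa>) * (2 * l)"
  proof (rule mult_mono)
    have "real (2 * n) * h \<le> 2 * real N * h" using n(1) h by (intro mult_right_mono) auto
    also have "\<dots> = 2 * c * \<kappa>" using N by (simp add: h_def)
    finally show "(1 + h) ^ (2 * n) \<le> exp (2 * c * \<kappa>)" by (intro power_one_plus_le_exp h)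
  qed (use si in \<open>auto simp: s_def\<close>)
  finally show ?thesis by (simp add: s_def mult_ac)
qed

text \<open>With \<open>c = l / \<mu>\<close> this bounds the length below. If \<open>c * \<kappa>\<close> were small, the velocity would be nearly
  constant along the polygon; but a closed polygon has mean velocity zero, so its largest velocity
  cannot exceed its oscillation.\<close>

lemma el_length_lower_bound: "1 / 2 \<le> c * \<kappa>"
proof -
  define s where "s j = \<bar>fst (v j)\<bar> + \<bar>snd (v j)\<bar>" for j
  have uX: "u \<in> polygons N" and vX: "v \<in> polygons N" using el by (auto simp: euler_lagrange_def)
  have v: "v j = real N *\<^sub>R (u (j + 1) - u j)" for j
    using el N by (simp add: euler_lagrange_def)
  have "Max (s ` {0..<int N}) \<in> s ` {0..<int N}" using N by (intro Max_in) auto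
  then obtain i where i: "i \<in> {0..<int N}" "s i = Max (s ` {0..<int N})" by auto
  have max: "s j \<le> s i" for j
  proof -
    have "s (j mod int N) \<le> s i" unfolding i(2) using N by (intro Max_ge) auto
    then show ?thesis using polygons_mod[OF vX] by (simp add: s_def)
  qed
  have "0 < s i"
  proof (rule ccontr)
    assume "\<not> 0 < s i"
    then have "v j = 0" for j using max[of j] by (auto simp: s_def prod_eq_iff)
    then have "real N * l\<^sup>2 = 0" using el by (simp add: euler_lagrange_def)
    then show False using N l by simp
  qed
  have sum0: "(\<Sum>j\<in>{0..<int N}. v j) = 0"
    unfolding v scaleR_sum_right[symmetric] using polygonsD[OF uX] by (subst sum_cyclic_diff) auto
  have comp: "\<bar>fst (v j)\<bar> \<le> s i" "\<bar>snd (v j)\<bar> \<le> s i" for j using max[of j] by (auto simp: s_def)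
  have h: "0 \<le> c * \<kappa> / N" using c \<kappa> by simp
  have "\<bar>fst (v i)\<bar> \<le> real N * (c * \<kappa> / N * s i)"
  proof (rule mean_zero_cyclic_bound[OF _ _ i(1)])
    show "\<bar>fst (v (j + 1)) - fst (v j)\<bar> \<le> c * \<kappa> / N * s i" for j
      using el_step_fst[of j] mult_left_mono[OF comp(2)[of j] h] by linarith
    show "(\<Sum>j\<in>{0..<int N}. fst (v j)) = 0" using sum0 by (simp add: fst_sum[symmetric])
  qed
  moreover have "\<bar>snd (v i)\<bar> \<le> real N * (c * \<kappa> / N * s i)"
  proof (rule mean_zero_cyclic_bound[OF _ _ i(1)])
    show "\<bar>snd (v (j + 1)) - snd (v j)\<bar> \<le> c * \<kappa> / N * s i" for j
      using el_step_snd[of j] mult_left_mono[OF comp(1)[of "j + 1"] h] by linarith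
    show "(\<Sum>j\<in>{0..<int N}. snd (v j)) = 0" using sum0 by (simp add: snd_sum[symmetric])
  qed
  ultimately have "1 * s i \<le> (2 * (c * \<kappa>)) * s i" using N by (simp add: s_def algebra_simps)
  then show ?thesis using \<open>0 < s i\<close> by (simp add: mult_le_cancel_right)
qed

end

section \<open>Limits of Euler schemes\<close>

text \<open>McShane's extension of a Lipschitz function from the grid to the line, the largest such
  extension; the formula is invariant under translation by a period.\<close>

lemma lipschitz_interpolation_real:
  fixes f :: "int \<Rightarrow> real"
  assumes N: "0 < N" and step: "\<And>j. \<bar>f (j + 1) - f j\<bar> \<le> C / real N" and per: "\<And>j. f (j + int N) = f j"
  obtains g :: "real \<Rightarrow> real" where "\<And>j. g (j / N) = f j" "\<And>t. g (t + 1) = g t" "\<And>s t. \<bar>g s - g t\<bar> \<le> C * \<bar>s - t\<bar>"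
proof -
  define g where "g t = (INF i. f i + C * \<bar>t - real_of_int i / N\<bar>)" for t
  have C: "0 \<le> C" using step[of 0] N by (smt (verit) divide_neg_pos of_nat_0_less_iff)
  have lip: "\<bar>f i - f j\<bar> \<le> C * \<bar>real_of_int i / N - real_of_int j / N\<bar>" for i j
    using int_steps_bound[of f "C / real N" i j] step N by (simp add: diff_divide_distrib[symmetric])
  have bdd: "bdd_below (range (\<lambda>i. f i + C * \<bar>t - real_of_int i / N\<bar>))" for t
  proof (rule bdd_belowI2)
    fix i :: int
    have "C * \<bar>real_of_int i / N\<bar> \<le> C * (\<bar>t\<bar> + \<bar>t - real_of_int i / N\<bar>)" using C by (intro mult_left_mono) auto
    then show "f 0 - C * \<bar>t\<bar> \<le> f i + C * \<bar>t - real_of_int i / N\<bar>"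
      using lip[of 0 i] by (simp add: distrib_left)
  qed
  have le: "g s \<le> g t + C * \<bar>s - t\<bar>" for s t
  proof -
    have "g s - C * \<bar>s - t\<bar> \<le> f i + C * \<bar>t - real_of_int i / N\<bar>" for i
    proof -
      have "g s \<le> f i + C * \<bar>s - real_of_int i / N\<bar>" unfolding g_def by (rule cINF_lower[OF bdd]) simp
      also have "C * \<bar>s - real_of_int i / N\<bar> \<le> C * (\<bar>s - t\<bar> + \<bar>t - real_of_int i / N\<bar>)"
        using C by (intro mult_left_mono) auto
      finally show ?thesis by (simp add: distrib_left)
    qed
    then have "g s - C * \<bar>s - t\<bar> \<le> g t" unfolding g_def[of t] by (intro cINF_greatest) auto
    then show ?thesis by simp
  qed
  show thesis
  proof (rule that)
    fix j :: int
    have "g (j / N) \<le> f j + C * \<bar>real_of_int j / N - real_of_int j / N\<bar>"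
      unfolding g_def by (rule cINF_lower[OF bdd]) simp
    moreover have "f j \<le> g (j / N)"
      unfolding g_def
    proof (rule cINF_greatest)
      fix i show "f j \<le> f i + C * \<bar>real_of_int j / N - real_of_int i / N\<bar>" using lip[of j i] by linarith
    qed simp
    ultimately show "g (j / N) = f j" by simp
  next
    fix t :: real
    have "range (\<lambda>i. f i + C * \<bar>t + 1 - real_of_int i / N\<bar>) = range (\<lambda>i. f i + C * \<bar>t - real_of_int i / N\<bar>)"
    proof (intro set_eqI iffI; clarify)
      fix i :: int
      have "f (i - int N) = f i" using per[of "i - int N"] by simp
      moreover have "t - real_of_int (i - int N) / N = t + 1 - real_of_int i / N" using N by (simp add: diff_divide_distrib)
      ultimately show "f i + C * \<bar>t + 1 - real_of_int i / N\<bar> \<in> range (\<lambda>i. f i + C * \<bar>t - real_of_int i / N\<bar>)"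
        by (intro image_eqI[of _ _ "i - int N"]) auto
    next
      fix i :: int
      have "t + 1 - real_of_int (i + int N) / N = t - real_of_int i / N" using N by (simp add: add_divide_distrib)
      then show "f i + C * \<bar>t - real_of_int i / N\<bar> \<in> range (\<lambda>i. f i + C * \<bar>t + 1 - real_of_int i / N\<bar>)"
        using per[of i] by (intro image_eqI[of _ _ "i + int N"]) auto
    qed
    then show "g (t + 1) = g t" by (simp add: g_def)
  next
    fix s t show "\<bar>g s - g t\<bar> \<le> C * \<bar>s - t\<bar>" using le[of s t] le[of t s] by (simp add: abs_minus_commute)
  qed
qed

lemma lipschitz_interpolation:
  fixes f :: "int \<Rightarrow> 'e::euclidean_space"
  assumes N: "0 < N" and step: "\<And>j. norm (f (j + 1) - f j) \<le> C / real N" and per: "\<And>j. f (j + int N) = f j"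
  obtains g :: "real \<Rightarrow> 'e" where "\<And>j. g (j / N) = f j" "\<And>t. g (t + 1) = g t"
    "\<And>s t. norm (g s - g t) \<le> real DIM('e) * C * \<bar>s - t\<bar>"
proof -
  have "\<exists>h. (\<forall>j. h (real_of_int j / N) = f j \<bullet> b) \<and> (\<forall>t. h (t + 1) = h t) \<and> (\<forall>s t. \<bar>h s - h t\<bar> \<le> C * \<bar>s - t\<bar>)"
    if b: "b \<in> Basis" for b
  proof (rule lipschitz_interpolation_real[OF N, of "\<lambda>j. f j \<bullet> b" C])
    show "\<bar>f (j + 1) \<bullet> b - f j \<bullet> b\<bar> \<le> C / real N" for j
      unfolding inner_diff_left[symmetric] using Basis_le_norm[OF b] step by (rule order_trans)
  qed (use per in auto)
  then obtain h where h: "\<And>b j. b \<in> Basis \<Longrightarrow> h b (real_of_int j / N) = f j \<bullet> b"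
    "\<And>b t. b \<in> Basis \<Longrightarrow> h b (t + 1) = h b t" "\<And>b s t. b \<in> Basis \<Longrightarrow> \<bar>h b s - h b t\<bar> \<le> C * \<bar>s - t\<bar>"
    by metis
  define g where "g t = (\<Sum>b\<in>Basis. h b t *\<^sub>R b)" for t
  show thesis
  proof (rule that)
    show "g (real_of_int j / N) = f j" for j
      unfolding g_def using h(1) by (simp add: euclidean_representation cong: sum.cong)
    show "g (t + 1) = g t" for t unfolding g_def using h(2) by (simp cong: sum.cong)
    show "norm (g s - g t) \<le> real DIM('e) * C * \<bar>s - t\<bar>" for s t
    proof -
      have "g s - g t = (\<Sum>b\<in>Basis. (h b s - h b t) *\<^sub>R b)"
        by (simp add: g_def sum_subtractf scaleR_diff_left)
      also have "norm \<dots> \<le> (\<Sum>b\<in>(Basis :: 'e set). C * \<bar>s - t\<bar>)"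
        using h(3) by (intro sum_norm_le) simp
      finally show ?thesis by simp
    qed
  qed
qed

text \<open>Convergence on \<open>{0..1}\<close> is transported to the line by the fractional part.\<close>

lemma periodic_Arzela_Ascoli:
  fixes Z :: "nat \<Rightarrow> real \<Rightarrow> 'e::euclidean_space"
  assumes per: "\<And>n t. Z n (t + 1) = Z n t" and bdd: "\<And>n t. norm (Z n t) \<le> R"
    and lip: "\<And>n s t. norm (Z n s - Z n t) \<le> C * \<bar>s - t\<bar>"
  obtains r g where "strict_mono (r :: nat \<Rightarrow> nat)" "\<And>t. g (t + 1) = g t"
    "\<And>e. 0 < e \<Longrightarrow> \<exists>n0. \<forall>n\<ge>n0. \<forall>t. norm (Z (r n) t - g t) < e"
proof (rule Arzela_Ascoli[of "{0..1}" Z R])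
  have C: "0 \<le> C" using order_trans[OF norm_ge_zero lip[of 0 0 1]] by simp
  show "\<exists>d>0. \<forall>n y. y \<in> {0..1} \<and> norm (x - y) < d \<longrightarrow> norm (Z n x - Z n y) < e" if "0 < e" for x e
  proof (intro exI conjI allI impI)
    show "0 < e / (C + 1)" using C that by simp
    fix n y assume "y \<in> {0..1} \<and> norm (x - y) < e / (C + 1)"
    then have "(C + 1) * \<bar>x - y\<bar> < e" using C by (simp add: field_simps)
    moreover have "C * \<bar>x - y\<bar> \<le> (C + 1) * \<bar>x - y\<bar>" by (intro mult_right_mono) auto
    ultimately show "norm (Z n x - Z n y) < e" using lip[of n x y] by linarith
  qed
next
  fix g0 and r :: "nat \<Rightarrow> nat"
  assume r: "strict_mono r"
    and conv: "\<And>e. 0 < e \<Longrightarrow> \<exists>n0. \<forall>n x. n0 \<le> n \<and> x \<in> {0..1} \<longrightarrow> norm (Z (r n) x - g0 x) < e"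
  show thesis
  proof (rule that[OF r])
    show "g0 (frac (t + 1)) = g0 (frac t)" for t by (simp add: frac_1_eq)
    fix e :: real assume "0 < e"
    then obtain n0 where n0: "\<And>n x. n0 \<le> n \<Longrightarrow> x \<in> {0..1} \<Longrightarrow> norm (Z (r n) x - g0 x) < e" using conv by blast
    have "norm (Z (r n) t - g0 (frac t)) < e" if "n0 \<le> n" for n t
    proof -
      have "Z (r n) (frac t) = Z (r n) t"
        using period_multiple[of "Z (r n)" 1 t "- \<lfloor>t\<rfloor>", OF per] by (simp add: frac_def)
      moreover have "frac t \<in> {0..1}" using frac_lt_1[of t] by (simp add: less_imp_le)
      ultimately show ?thesis using n0[OF that] by metis
    qed
    then show "\<exists>n0. \<forall>n\<ge>n0. \<forall>t. norm (Z (r n) t - g0 (frac t)) < e" by blast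
  qed
qed (use bdd in auto)

text \<open>A forward secant estimate that is uniform in the base point also controls backward secants, once
  the base point is moved and continuity of \<open>g\<close> is used.\<close>

lemma has_vector_derivative_from_forward_secants:
  fixes f g :: "real \<Rightarrow> 'e::real_normed_vector"
  assumes g: "isCont g x"
    and sec: "\<And>\<epsilon>. 0 < \<epsilon> \<Longrightarrow> \<exists>d>0. \<forall>s t. s \<le> t \<longrightarrow> t < s + d \<longrightarrow> norm (f t - f s - (t - s) *\<^sub>R g s) \<le> \<epsilon> * (t - s)"
  shows "(f has_vector_derivative g x) (at x)"
  unfolding has_vector_derivative_def has_derivative_at_alt
proof (intro conjI allI impI)
  show "bounded_linear (\<lambda>h. h *\<^sub>R g x)" by (rule bounded_linear_scaleR_left)
  fix e :: real assume e: "0 < e"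
  obtain d1 where d1: "0 < d1" "\<And>y. \<bar>y - x\<bar> < d1 \<Longrightarrow> norm (g y - g x) < e / 2"
    using g e unfolding continuous_at_eps_delta dist_norm by (metis half_gt_zero real_norm_def)
  obtain d2 where d2: "0 < d2" "\<And>s t. s \<le> t \<Longrightarrow> t < s + d2 \<Longrightarrow> norm (f t - f s - (t - s) *\<^sub>R g s) \<le> e / 2 * (t - s)"
    using sec[of "e / 2"] e by auto
  show "\<exists>d>0. \<forall>y. norm (y - x) < d \<longrightarrow> norm (f y - f x - (y - x) *\<^sub>R g x) \<le> e * norm (y - x)"
  proof (intro exI conjI allI impI)
    show "0 < min d1 d2" using d1 d2 by simp
    fix y assume y: "norm (y - x) < min d1 d2"
    show "norm (f y - f x - (y - x) *\<^sub>R g x) \<le> e * norm (y - x)"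
    proof (cases "x \<le> y")
      case True
      then have "norm (f y - f x - (y - x) *\<^sub>R g x) \<le> e / 2 * (y - x)" using y d2(2)[of x y] by simp
      also have "\<dots> \<le> e * (y - x)" using True e by (intro mult_right_mono) auto
      finally show ?thesis using True by simp
    next
      case False
      have "f y - f x - (y - x) *\<^sub>R g x = (x - y) *\<^sub>R (g x - g y) - (f x - f y - (x - y) *\<^sub>R g y)"
        by (simp add: algebra_simps)
      also have "norm \<dots> \<le> norm ((x - y) *\<^sub>R (g x - g y)) + norm (f x - f y - (x - y) *\<^sub>R g y)"
        by (rule norm_triangle_ineq4)
      also have "norm ((x - y) *\<^sub>R (g x - g y)) = (x - y) * norm (g y - g x)"
        using False by (simp add: norm_minus_commute)
      also have "\<dots> \<le> (x - y) * (e / 2)"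
        using False y d1(2)[of y] by (intro mult_left_mono) auto
      also have "norm (f x - f y - (x - y) *\<^sub>R g y) \<le> e / 2 * (x - y)"
        using False y by (intro d2(2)) auto
      finally show ?thesis using False by (simp add: algebra_simps)
    qed
  qed
qed

lemma uniformly_close_on_ball:
  fixes f :: "'e::{real_normed_vector,heine_borel} \<Rightarrow> 'f::real_normed_vector"
  assumes f: "continuous_on UNIV f" and \<epsilon>: "0 < \<epsilon>"
  obtains d where "0 < d"
    "\<And>z w. norm z \<le> R \<Longrightarrow> norm w \<le> R \<Longrightarrow> norm (z - w) < d \<Longrightarrow> norm (f z - f w) < \<epsilon>"
proof -
  have "uniformly_continuous_on (cball 0 R) f"
    by (intro compact_uniformly_continuous continuous_on_subset[OF f]) auto
  then obtain d where d: "0 < d" "\<And>w z. w \<in> cball 0 R \<Longrightarrow> z \<in> cball 0 R \<Longrightarrow> dist z w < d \<Longrightarrow> dist (f z) (f w) < \<epsilon>"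
    using \<epsilon> unfolding uniformly_continuous_on_def by meson
  show thesis by (rule that[OF d(1)]) (use d(2) in \<open>auto simp: dist_norm\<close>)
qed

text \<open>The error of each step only has to be \<open>o(1 / N)\<close>. Summing the steps over a short time interval
  \<open>{s..t}\<close> and comparing the field along the way with its value at \<open>s\<close>, which is possible because all
  approximations have a common Lipschitz constant, yields uniform forward secant estimates that pass
  to the limit.\<close>

lemma euler_scheme_limit:
  fixes Z :: "nat \<Rightarrow> real \<Rightarrow> 'e::euclidean_space" and N :: "nat \<Rightarrow> nat"
  assumes \<Psi>: "continuous_on UNIV \<Psi>"
    and N: "\<And>n. 0 < N n" "filterlim N at_top sequentially"
    and bdd: "\<And>n t. norm (Z n t) \<le> R" and lip: "\<And>n s t. norm (Z n s - Z n t) \<le> C * \<bar>s - t\<bar>"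
    and consistent: "\<And>\<epsilon>. 0 < \<epsilon> \<Longrightarrow> \<forall>\<^sub>F n in sequentially. \<forall>j::int.
       norm (Z n (real_of_int (j + 1) / N n) - Z n (j / N n) - \<Psi> (Z n (j / N n)) /\<^sub>R N n) \<le> \<epsilon> / N n"
    and conv: "\<And>t. (\<lambda>n. Z n t) \<longlonglongrightarrow> g t"
  shows "(g has_vector_derivative \<Psi> (g t)) (at t)"
proof -
  have C: "0 \<le> C" using order_trans[OF norm_ge_zero lip[of 0 0 1]] by simp
  have g_lip: "norm (g s - g t) \<le> C * \<bar>s - t\<bar>" for s t
    by (rule tendsto_upperbound[OF tendsto_norm[OF tendsto_diff[OF conv conv]]])
       (auto intro!: always_eventually lip)
  have "continuous_on UNIV g"
    by (rule lipschitz_on_continuous_on[of C]) (auto simp: lipschitz_on_def dist_norm g_lip C)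
  then have cont: "isCont (\<lambda>t. \<Psi> (g t)) t"
    by (metis \<Psi> continuous_on_compose2 continuous_on_eq_continuous_at open_UNIV subset_UNIV UNIV_I)
  have real_N: "filterlim (\<lambda>n. real (N n)) at_top sequentially"
    using filterlim_compose[OF filterlim_real_sequentially N(2)] by simp
  have grid: "(\<lambda>n. real_of_int \<lfloor>real (N n) * t\<rfloor> / N n) \<longlonglongrightarrow> t" for t
  proof (rule tendsto_sandwich[of "\<lambda>n. t - 1 / N n" _ _ "\<lambda>n. t"])
    show "(\<lambda>n. t - 1 / real (N n)) \<longlonglongrightarrow> t"
      using tendsto_diff[OF tendsto_const[of t] tendsto_divide_0[OF tendsto_const[of 1] filterlim_at_top_imp_at_infinity[OF real_N]]]
      by simp
    have "t - 1 / N n \<le> real_of_int \<lfloor>real (N n) * t\<rfloor> / N n \<and> real_of_int \<lfloor>real (N n) * t\<rfloor> / N n \<le> t" for n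
    proof -
      have "real (N n) * t - 1 \<le> real_of_int \<lfloor>real (N n) * t\<rfloor>" "real_of_int \<lfloor>real (N n) * t\<rfloor> \<le> real (N n) * t"
        by linarith+
      then have "(real (N n) * t - 1) / N n \<le> real_of_int \<lfloor>real (N n) * t\<rfloor> / N n"
        "real_of_int \<lfloor>real (N n) * t\<rfloor> / N n \<le> real (N n) * t / N n"
        by (intro divide_right_mono; simp)+
      then show ?thesis using N(1)[of n] by (simp add: diff_divide_distrib)
    qed
    then show "\<forall>\<^sub>F n in sequentially. t - 1 / real (N n) \<le> real_of_int \<lfloor>real (N n) * t\<rfloor> / N n"
      "\<forall>\<^sub>F n in sequentially. real_of_int \<lfloor>real (N n) * t\<rfloor> / N n \<le> t" by auto
  qed auto
  have Zgrid: "(\<lambda>n. Z n (real_of_int \<lfloor>real (N n) * t\<rfloor> / N n)) \<longlonglongrightarrow> g t" for t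
  proof -
    have "(\<lambda>n. C * \<bar>real_of_int \<lfloor>real (N n) * t\<rfloor> / N n - t\<bar>) \<longlonglongrightarrow> C * \<bar>t - t\<bar>"
      by (intro tendsto_intros grid)
    then have "(\<lambda>n. Z n (real_of_int \<lfloor>real (N n) * t\<rfloor> / N n) - Z n t) \<longlonglongrightarrow> 0"
      by (intro Lim_null_comparison[OF always_eventually[OF allI[OF lip]]]) simp
    from tendsto_add[OF this conv[of t]] show ?thesis by simp
  qed
  show ?thesis
  proof (rule has_vector_derivative_from_forward_secants[OF cont])
    fix \<epsilon> :: real assume "0 < \<epsilon>"
    then have \<epsilon>: "0 < \<epsilon> / 2" by simp
    obtain d0 where d0: "0 < d0"
      "\<And>z w. norm z \<le> R \<Longrightarrow> norm w \<le> R \<Longrightarrow> norm (z - w) < d0 \<Longrightarrow> norm (\<Psi> z - \<Psi> w) < \<epsilon> / 2"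
      using uniformly_close_on_ball[OF \<Psi> \<epsilon>] by blast
    define d where "d = d0 / (C + 1)"
    have d: "0 < d" "C * d < d0" using d0(1) C by (auto simp: d_def field_simps intro: add_nonneg_pos)
    have discrete: "norm (Z n (j / N n) - Z n (i / N n) - (j / N n - i / N n) *\<^sub>R \<Psi> (Z n (i / N n))) \<le> \<epsilon> * (j / N n - i / N n)"
      if cons: "\<forall>j::int. norm (Z n (real_of_int (j + 1) / N n) - Z n (j / N n) - \<Psi> (Z n (j / N n)) /\<^sub>R N n) \<le> \<epsilon> / 2 / N n"
        and ij: "i \<le> j" "j / N n - i / N n < d" for n and i j :: int
      using ij
    proof (induction j rule: int_ge_induct)
      case (step j)
      let ?h = "1 / real (N n)" and ?Zi = "Z n (i / N n)" and ?Zj = "Z n (j / N n)"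
      have Nn: "0 < real (N n)" using N(1) by simp
      have j1: "real_of_int (j + 1) / N n = j / N n + ?h" by (simp add: add_divide_distrib)
      have lt: "j / N n - i / N n < d" using step.prems Nn j1 by (smt (verit) divide_pos_pos)
      have nonneg: "0 \<le> real_of_int j / N n - i / N n"
        using step.hyps Nn by (simp add: diff_divide_distrib[symmetric])
      have "norm (?Zj - ?Zi) \<le> C * \<bar>j / N n - i / N n\<bar>" by (rule lip)
      also have "\<dots> \<le> C * d" using lt nonneg C by (intro mult_left_mono) auto
      finally have "norm (\<Psi> ?Zj - \<Psi> ?Zi) < \<epsilon> / 2" using d(2) by (intro d0(2) bdd) auto
      then have "?h * norm (\<Psi> ?Zj - \<Psi> ?Zi) \<le> ?h * (\<epsilon> / 2)"
        using Nn by (intro mult_left_mono) auto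
      then have \<Psi>_close: "norm (?h *\<^sub>R (\<Psi> ?Zj - \<Psi> ?Zi)) \<le> ?h * (\<epsilon> / 2)"
        using Nn by simp
      have split: "Z n (real_of_int (j + 1) / N n) - ?Zi - (real_of_int (j + 1) / N n - i / N n) *\<^sub>R \<Psi> ?Zi
          = (?Zj - ?Zi - (j / N n - i / N n) *\<^sub>R \<Psi> ?Zi)
            + (Z n (real_of_int (j + 1) / N n) - ?Zj - \<Psi> ?Zj /\<^sub>R N n) + ?h *\<^sub>R (\<Psi> ?Zj - \<Psi> ?Zi)"
        unfolding j1 by (simp add: algebra_simps inverse_eq_divide)
      have "norm (Z n (real_of_int (j + 1) / N n) - ?Zi - (real_of_int (j + 1) / N n - i / N n) *\<^sub>R \<Psi> ?Zi)
          \<le> \<epsilon> * (j / N n - i / N n) + \<epsilon> / 2 / N n + ?h * (\<epsilon> / 2)"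
        unfolding split using step.IH[OF lt] cons \<Psi>_close by (intro order_trans[OF norm_triangle_ineq] add_mono) auto
      also have "\<dots> = \<epsilon> * (real_of_int (j + 1) / N n - i / N n)"
      proof -
        have alg: "e * (x - y) + h * (e / 2) + h * (e / 2) = e * (x + h - y)" for e x y h :: real
          by (simp add: algebra_simps)
        have "\<epsilon> / 2 / N n = ?h * (\<epsilon> / 2)" by (simp only: times_divide_eq_left mult_1)
        then show ?thesis using alg[of \<epsilon> "j / N n" "i / N n" ?h] by (simp only: j1)
      qed
      finally show ?case .
    qed simp
    show "\<exists>d>0. \<forall>s t. s \<le> t \<longrightarrow> t < s + d \<longrightarrow> norm (g t - g s - (t - s) *\<^sub>R \<Psi> (g s)) \<le> \<epsilon> * (t - s)"
    proof (intro exI[of _ d] conjI allI impI d(1))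
      fix s t :: real assume st: "s \<le> t" "t < s + d"
      let ?i = "\<lambda>n. real_of_int \<lfloor>real (N n) * s\<rfloor> / N n" and ?j = "\<lambda>n. real_of_int \<lfloor>real (N n) * t\<rfloor> / N n"
      have \<Psi>g: "(\<lambda>n. \<Psi> (Z n (?i n))) \<longlonglongrightarrow> \<Psi> (g s)"
        by (rule continuous_on_tendsto_compose[OF \<Psi> Zgrid]) auto
      have lim1: "(\<lambda>n. norm (Z n (?j n) - Z n (?i n) - (?j n - ?i n) *\<^sub>R \<Psi> (Z n (?i n)))) \<longlonglongrightarrow> norm (g t - g s - (t - s) *\<^sub>R \<Psi> (g s))"
        by (intro tendsto_intros Zgrid grid \<Psi>g)
      have lim2: "(\<lambda>n. \<epsilon> * (?j n - ?i n)) \<longlonglongrightarrow> \<epsilon> * (t - s)" by (intro tendsto_intros grid)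
      have "\<forall>\<^sub>F n in sequentially. ?j n - ?i n < d"
        using st by (intro order_tendstoD(2)[OF tendsto_diff[OF grid grid]]) simp
      moreover note consistent[OF \<epsilon>]
      ultimately have "\<forall>\<^sub>F n in sequentially. norm (Z n (?j n) - Z n (?i n) - (?j n - ?i n) *\<^sub>R \<Psi> (Z n (?i n))) \<le> \<epsilon> * (?j n - ?i n)"
      proof eventually_elim
        case (elim n)
        show ?case
          using elim st by (intro discrete) (auto intro!: floor_mono mult_left_mono)
      qed
      then show "norm (g t - g s - (t - s) *\<^sub>R \<Psi> (g s)) \<le> \<epsilon> * (t - s)"
        by (rule tendsto_le[OF _ lim2 lim1, rotated]) simp
    qed
  qed
qed

section \<open>Passage from critical polygons to loops\<close>

text \<open>The polygon, its velocity and its length are treated as one state \<open>(u, v, l)\<close> of an autonomous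
  system, so that a single compactness argument covers all three. In the limit the speed is constant
  because \<open>v\<close> is orthogonal to \<open>rot v\<close>; it equals \<open>l\<close> because \<open>l\<^sup>2\<close> is the mean square of the discrete
  speeds, which converge uniformly.\<close>

lemma loop_from_euler_lagrange:
  fixes K :: "real \<times> real \<Rightarrow> real" and N :: "nat \<Rightarrow> nat" and u v :: "nat \<Rightarrow> int \<Rightarrow> real \<times> real"
  assumes K: "continuous_on UNIV K" and K_bound: "\<And>p. \<bar>K p\<bar> \<le> \<kappa>" and \<kappa>: "0 < \<kappa>" and \<mu>: "0 < \<mu>"
    and N: "\<And>n. 0 < N n" "filterlim N at_top sequentially"
    and el: "\<And>n. euler_lagrange (\<lambda>x y. K (x, y)) (N n) (l n / \<mu>) (l n) (u n) (v n)"
    and l: "\<And>n. 0 < l n" "\<And>n. l n \<le> M" and start: "\<And>n. norm (u n 0) \<le> R0"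
  shows "\<exists>C. is_loop (\<lambda>p. K p / \<mu>) C"
proof -
  define c where "c n = l n / \<mu>" for n
  define c0 where "c0 = M / \<mu>"
  define D where "D = 2 * M * exp (2 * c0 * \<kappa>)"
  have M: "0 < M" using l[of 0] by linarith
  have c: "0 \<le> c n" "c n \<le> c0" for n
    using l[of n] \<mu> by (auto simp: c_def c0_def divide_right_mono)
  have c0: "0 < c0" and D: "0 < D" using M \<mu> by (auto simp: c0_def D_def)
  have el': "euler_lagrange (\<lambda>x y. K (x, y)) (N n) (c n) (l n) (u n) (v n)" for n
    using el by (simp add: c_def)
  have speed: "\<bar>fst (v n j)\<bar> + \<bar>snd (v n j)\<bar> \<le> D" for n j
  proof -
    have "\<bar>fst (v n j)\<bar> + \<bar>snd (v n j)\<bar> \<le> 2 * l n * exp (2 * c n * \<kappa>)"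
      by (rule el_speed_bound[OF el' N(1) c(1) l(1) K_bound \<kappa>])
    also have "\<dots> \<le> D" unfolding D_def
      using l[of n] c[of n] \<kappa> M by (intro mult_mono) auto
    finally show ?thesis .
  qed
  have comp: "\<bar>fst (v n j)\<bar> \<le> D" "\<bar>snd (v n j)\<bar> \<le> D" for n j using speed[of n j] by auto
  have norm_v: "norm (v n j) \<le> D" for n j
    using norm_Pair_le[of "fst (v n j)" "snd (v n j)"] speed[of n j] by simp
  have Npos: "0 < real (N n)" for n using N(1) by simp
  have du: "u n (j + 1) - u n j = v n j /\<^sub>R N n" for n j using el' by (simp add: euler_lagrange_def)
  have du_comp: "\<bar>fst (u n (j + 1)) - fst (u n j)\<bar> \<le> D / N n" "\<bar>snd (u n (j + 1)) - snd (u n j)\<bar> \<le> D / N n" for n j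
    using arg_cong[OF du[of n j], of fst] arg_cong[OF du[of n j], of snd] comp[of n j] Npos[of n]
    by (simp_all add: abs_mult divide_inverse_commute)
  have dv1: "\<bar>fst (v n (j + 1)) - fst (v n j)\<bar> \<le> c0 * \<kappa> * D / N n" for n j
  proof -
    have "\<bar>fst (v n (j + 1)) - fst (v n j)\<bar> \<le> c n * \<kappa> / N n * \<bar>snd (v n j)\<bar>"
      by (rule el_step_fst[OF el' N(1) c(1) l(1) K_bound \<kappa>])
    also have "\<dots> \<le> c0 * \<kappa> / N n * D"
      using c[of n] comp[of n j] \<kappa> Npos[of n] c0 by (intro mult_mono divide_right_mono mult_right_mono) auto
    finally show ?thesis by simp
  qed
  have dv2: "\<bar>snd (v n (j + 1)) - snd (v n j)\<bar> \<le> c0 * \<kappa> * D / N n" for n j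
  proof -
    have "\<bar>snd (v n (j + 1)) - snd (v n j)\<bar> \<le> c n * \<kappa> / N n * \<bar>fst (v n (j + 1))\<bar>"
      by (rule el_step_snd[OF el' N(1) c(1) l(1) K_bound \<kappa>])
    also have "\<dots> \<le> c0 * \<kappa> / N n * D"
      using c[of n] comp[of n "j + 1"] \<kappa> Npos[of n] c0 by (intro mult_mono divide_right_mono mult_right_mono) auto
    finally show ?thesis by simp
  qed
  define z where "z n j = (u n j, v n j, l n)" for n j
  define C1 where "C1 = D + 2 * (c0 * \<kappa> * D)"
  have z_step: "norm (z n (j + 1) - z n j) \<le> C1 / N n" for n j
  proof -
    have "norm (z n (j + 1) - z n j) \<le> norm (u n (j + 1) - u n j) + norm (v n (j + 1) - v n j)"
      unfolding z_def using norm_Pair_le[of "u n (j + 1) - u n j" "(v n (j + 1) - v n j, 0::real)"]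
        norm_Pair_le[of "v n (j + 1) - v n j" "0::real"] by simp
    also have "norm (u n (j + 1) - u n j) \<le> D / N n"
      unfolding du using norm_v[of n j] Npos[of n] by (simp add: divide_inverse_commute)
    also have "norm (v n (j + 1) - v n j) \<le> c0 * \<kappa> * D / N n + c0 * \<kappa> * D / N n"
      using norm_le_abs_sum[of "v n (j + 1) - v n j"] dv1[of n j] dv2[of n j]
      unfolding fst_diff snd_diff by linarith
    finally show ?thesis by (simp add: C1_def add_divide_distrib mult_ac)
  qed
  have z_per: "z n (j + int (N n)) = z n j" for n j
    using el' polygonsD by (simp add: z_def euler_lagrange_def)
  define C where "C = real DIM((real \<times> real) \<times> (real \<times> real) \<times> real) * C1"
  have "\<exists>h. (\<forall>j. h (real_of_int j / N n) = z n j) \<and> (\<forall>t. h (t + 1) = h t) \<and> (\<forall>s t. norm (h s - h t) \<le> C * \<bar>s - t\<bar>)" for n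
    unfolding C_def by (rule lipschitz_interpolation[OF N(1) z_step z_per]) blast
  then obtain Z where Z: "\<And>n j. Z n (real_of_int j / N n) = z n j" "\<And>n t. Z n (t + 1) = Z n t"
    "\<And>n s t. norm (Z n s - Z n t) \<le> C * \<bar>s - t\<bar>" by metis
  define R where "R = R0 + D + M + C"
  have C: "0 \<le> C" using order_trans[OF norm_ge_zero Z(3)[of 0 0 1]] by simp
  have Z_bdd: "norm (Z n t) \<le> R" for n t
  proof -
    have "Z n (frac t) = Z n t"
      using period_multiple[of "Z n" 1 t "- \<lfloor>t\<rfloor>", OF Z(2)] by (simp add: frac_def)
    moreover have "norm (Z n (frac t) - Z n 0) \<le> C"
    proof -
      have "norm (Z n (frac t) - Z n 0) \<le> C * \<bar>frac t - 0\<bar>" by (rule Z(3))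
      also have "\<dots> \<le> C * 1" using C frac_lt_1[of t] by (intro mult_left_mono) auto
      finally show ?thesis by simp
    qed
    moreover have "norm (Z n 0) \<le> R0 + D + M"
    proof -
      have "Z n 0 = (u n 0, v n 0, l n)" using Z(1)[of n 0] by (simp add: z_def)
      then show ?thesis
        using norm_Pair_le[of "u n 0" "(v n 0, l n)"] norm_Pair_le[of "v n 0" "l n"] start[of n] norm_v[of n 0] l[of n]
        by simp
    qed
    ultimately show ?thesis
      using norm_triangle_ineq2[of "Z n (frac t)" "Z n 0"] by (simp add: R_def)
  qed
  have u_bdd: "norm (u n j) \<le> R" for n j
    using norm_fst_le[of "u n j" "(v n j, l n)"] Z_bdd[of n "real_of_int j / N n"] by (simp add: Z(1) z_def)
  have real_N: "filterlim (\<lambda>n. real (N n)) at_top sequentially"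
    using filterlim_compose[OF filterlim_real_sequentially N(2)] by simp
  define \<Psi> where "\<Psi> y = (fst (snd y), (snd (snd y) / \<mu> * K (fst y)) *\<^sub>R rot (fst (snd y)), 0::real)"
    for y :: "(real \<times> real) \<times> (real \<times> real) \<times> real"
  have \<Psi>_cont: "continuous_on UNIV \<Psi>"
    unfolding \<Psi>_def rot_def using \<mu>
    by (intro continuous_intros continuous_on_compose2[OF K]) auto
  have consistent: "\<forall>\<^sub>F n in sequentially. \<forall>j::int.
       norm (Z n (real_of_int (j + 1) / N n) - Z n (j / N n) - \<Psi> (Z n (j / N n)) /\<^sub>R N n) \<le> \<epsilon> / N n"
    if \<epsilon>: "0 < \<epsilon>" for \<epsilon>
  proof -
    \<comment> \<open>the error of one step is at most \<open>2 * c0 * D * \<omega> + O(1 / N)\<close>, divided by \<open>N\<close>\<close>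
    define \<omega> where "\<omega> = \<epsilon> / (4 * c0 * D)"
    have \<omega>: "0 < \<omega>" using \<epsilon> c0 D by (simp add: \<omega>_def)
    obtain d where d: "0 < d"
      "\<And>p p'. norm p \<le> R + 3 * D \<Longrightarrow> norm p' \<le> R + 3 * D \<Longrightarrow> norm (p - p') < d \<Longrightarrow> norm (K p - K p') < \<omega>"
      using uniformly_close_on_ball[OF K \<omega>] by blast
    have "\<forall>\<^sub>F n in sequentially. 3 * D / d < real (N n)" "\<forall>\<^sub>F n in sequentially. 4 * c0\<^sup>2 * \<kappa>\<^sup>2 * D / \<epsilon> < real (N n)"
      using real_N by (simp_all add: filterlim_at_top_dense)
    then show ?thesis
    proof eventually_elim
      case (elim n)
      have N1: "3 * D / N n < d" using elim(1) d(1) Npos[of n] by (simp add: field_simps)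
      have N2: "c0\<^sup>2 * \<kappa>\<^sup>2 * D / N n \<le> \<epsilon> / 4" using elim(2) \<epsilon> Npos[of n] by (simp add: field_simps)
      have "1 \<le> real (N n)" using N(1)[of n] by linarith
      then have DN: "3 * D / N n \<le> 3 * D" using D by (simp add: divide_le_eq mult_le_cancel_left1)
      show ?case
      proof
        fix j :: int
        define x y p q where "x i = fst (u n i)" and "y i = snd (u n i)" and "p i = fst (v n i)" and "q i = snd (v n i)" for i
        have uj: "u n j = (x j, y j)" by (simp add: x_def y_def)
        have K_close: "\<bar>K (x', y') - K (u n j)\<bar> \<le> \<omega>" if "\<bar>x' - x j\<bar> + \<bar>y' - y j\<bar> \<le> 3 * D / N n" for x' y'
        proof -
          have close: "norm ((x', y') - u n j) \<le> 3 * D / N n"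
            unfolding uj using that norm_Pair_le[of "x' - x j" "y' - y j"] by simp
          then have "norm (x', y') \<le> R + 3 * D"
            using u_bdd[of n j] DN norm_triangle_ineq2[of "(x', y')" "u n j"] by linarith
          moreover have "norm (u n j) \<le> R + 3 * D" using u_bdd[of n j] D by linarith
          ultimately have "norm (K (x', y') - K (u n j)) < \<omega>"
            using close N1 by (intro d(2)) auto
          then show ?thesis by simp
        qed
        obtain \<eta> where \<eta>: "\<bar>\<eta> - y j\<bar> \<le> \<bar>y (j + 1) - y j\<bar>"
          "p (j + 1) - p j = - (c n / N n * K (x (j + 1), \<eta>) * q j)"
          using el'[of n] unfolding euler_lagrange_def x_def y_def p_def q_def by blast
        obtain \<xi> where \<xi>: "\<bar>\<xi> - x (j + 1)\<bar> \<le> \<bar>x (j + 1 + 1) - x (j + 1)\<bar>"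
          "q (j + 1) - q (j + 1 - 1) = c n / N n * K (\<xi>, y (j + 1)) * p (j + 1)"
          using el'[of n] unfolding euler_lagrange_def x_def y_def p_def q_def by blast
        note dx = du_comp(1)[of n, folded x_def] and dy = du_comp(2)[of n, folded y_def]
        have K1: "\<bar>K (x (j + 1), \<eta>) - K (u n j)\<bar> \<le> \<omega>"
        proof (rule K_close)
          have "0 \<le> D / N n" using D Npos[of n] by simp
          then show "\<bar>x (j + 1) - x j\<bar> + \<bar>\<eta> - y j\<bar> \<le> 3 * D / N n" using dx[of j] dy[of j] \<eta>(1) by simp
        qed
        have K2: "\<bar>K (\<xi>, y (j + 1)) - K (u n j)\<bar> \<le> \<omega>"
        proof (rule K_close)
          show "\<bar>\<xi> - x j\<bar> + \<bar>y (j + 1) - y j\<bar> \<le> 3 * D / N n"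
            using dx[of j] dx[of "j + 1"] dy[of j] \<xi>(1) by simp
        qed
        define e where "e = v n (j + 1) - v n j - ((c n * K (u n j)) *\<^sub>R rot (v n j)) /\<^sub>R N n"
        have "fst e = (c n / N n) * (q j * (K (u n j) - K (x (j + 1), \<eta>)))"
          using \<eta>(2) by (simp add: e_def rot_def p_def q_def divide_inverse algebra_simps)
        also have "\<bar>\<dots>\<bar> \<le> (c0 / N n) * (D * \<omega>)"
          unfolding abs_mult using c[of n] comp(2)[of n j] K1 Npos[of n] D c0 \<omega>
          by (intro mult_mono) (auto simp: q_def abs_minus_commute divide_right_mono)
        finally have e1: "\<bar>fst e\<bar> \<le> (c0 / N n) * (D * \<omega>)" .
        have "snd e = (c n / N n) * (p (j + 1) * (K (\<xi>, y (j + 1)) - K (u n j)) + K (u n j) * (p (j + 1) - p j))"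
          using \<xi>(2) by (simp add: e_def rot_def p_def q_def divide_inverse algebra_simps)
        also have "\<bar>\<dots>\<bar> \<le> (c0 / N n) * (D * \<omega> + \<kappa> * (c0 * \<kappa> * D / N n))"
          unfolding abs_mult[of "c n / N n"]
        proof (rule mult_mono)
          show "\<bar>p (j + 1) * (K (\<xi>, y (j + 1)) - K (u n j)) + K (u n j) * (p (j + 1) - p j)\<bar>
              \<le> D * \<omega> + \<kappa> * (c0 * \<kappa> * D / N n)"
          proof (rule order_trans[OF abs_triangle_ineq add_mono])
            show "\<bar>p (j + 1) * (K (\<xi>, y (j + 1)) - K (u n j))\<bar> \<le> D * \<omega>"
              unfolding abs_mult p_def using comp(1)[of n "j + 1"] K2 D by (intro mult_mono) auto
            show "\<bar>K (u n j) * (p (j + 1) - p j)\<bar> \<le> \<kappa> * (c0 * \<kappa> * D / N n)"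
              unfolding abs_mult p_def using K_bound[of "u n j"] dv1[of n j] \<kappa> by (intro mult_mono) auto
          qed
        qed (use c[of n] c0 Npos[of n] in \<open>auto simp: divide_right_mono\<close>)
        finally have e2: "\<bar>snd e\<bar> \<le> (c0 / N n) * (D * \<omega> + \<kappa> * (c0 * \<kappa> * D / N n))" .
        have "Z n (real_of_int (j + 1) / N n) - Z n (j / N n) - \<Psi> (Z n (j / N n)) /\<^sub>R N n = (0, e, 0)"
          using du[of n j] by (simp only: Z(1)) (simp add: z_def \<Psi>_def e_def c_def scaleR_prod_def)
        then have "norm (Z n (real_of_int (j + 1) / N n) - Z n (j / N n) - \<Psi> (Z n (j / N n)) /\<^sub>R N n) = norm e"
          by (simp add: norm_Pair)
        also have "\<dots> \<le> \<bar>fst e\<bar> + \<bar>snd e\<bar>" using norm_Pair_le[of "fst e" "snd e"] by simp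
        also have "\<dots> \<le> (2 * (c0 * D * \<omega>) + c0\<^sup>2 * \<kappa>\<^sup>2 * D / N n) / N n"
        proof -
          have "(c0 / N n) * (D * \<omega>) + (c0 / N n) * (D * \<omega> + \<kappa> * (c0 * \<kappa> * D / N n))
              = (2 * (c0 * D * \<omega>) + c0\<^sup>2 * \<kappa>\<^sup>2 * D / N n) / N n"
            using Npos[of n] by (simp add: field_simps power2_eq_square)
          then show ?thesis using e1 e2 by linarith
        qed
        also have "\<dots> \<le> \<epsilon> / N n"
        proof (rule divide_right_mono)
          have "c0 * D * \<omega> = \<epsilon> / 4" using c0 D by (simp add: \<omega>_def)
          then show "2 * (c0 * D * \<omega>) + c0\<^sup>2 * \<kappa>\<^sup>2 * D / N n \<le> \<epsilon>" using N2 \<epsilon> by linarith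
        qed simp
        finally show "norm (Z n (real_of_int (j + 1) / N n) - Z n (j / N n) - \<Psi> (Z n (j / N n)) /\<^sub>R N n) \<le> \<epsilon> / N n" .
      qed
    qed
  qed
  have "\<exists>(r :: nat \<Rightarrow> nat) g. strict_mono r \<and> (\<forall>t. g (t + 1) = g t) \<and>
      (\<forall>e>0. \<exists>n0. \<forall>n\<ge>n0. \<forall>t. norm (Z (r n) t - g t) < e)"
    by (rule periodic_Arzela_Ascoli[of Z R C, OF Z(2) Z_bdd Z(3)]) blast
  then obtain r :: "nat \<Rightarrow> nat" and g where r: "strict_mono r" and g_per: "\<And>t. g (t + 1) = g t"
    and unif: "\<And>e. 0 < e \<Longrightarrow> \<exists>n0. \<forall>n\<ge>n0. \<forall>t. norm (Z (r n) t - g t) < e"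
    by blast
  have conv: "(\<lambda>n. Z (r n) t) \<longlonglongrightarrow> g t" for t
    unfolding LIMSEQ_iff using unif by blast
  have r_lim: "filterlim r sequentially sequentially" by (rule filterlim_subseq[OF r])
  have g_deriv: "(g has_vector_derivative \<Psi> (g t)) (at t)" for t
  proof (rule euler_scheme_limit[of \<Psi> "\<lambda>n. N (r n)" "\<lambda>n. Z (r n)" R C g t])
    show "filterlim (\<lambda>n. N (r n)) at_top sequentially" by (rule filterlim_compose[OF N(2) r_lim])
    show "\<forall>\<^sub>F n in sequentially. \<forall>j. norm (Z (r n) (real_of_int (j + 1) / N (r n)) - Z (r n) (real_of_int j / N (r n))
        - \<Psi> (Z (r n) (real_of_int j / N (r n))) /\<^sub>R N (r n)) \<le> \<epsilon> / N (r n)" if "0 < \<epsilon>" for \<epsilon>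
      using eventually_compose_filterlim[OF consistent[OF that] r_lim] .
  qed (use \<Psi>_cont N(1) Z_bdd Z(3) conv in auto)
  define w where "w t = fst (g t)" for t
  define \<nu> where "\<nu> t = fst (snd (g t))" for t
  define L where "L = snd (snd (g 0))"
  have "((\<lambda>t. snd (snd (g t))) has_real_derivative 0) (at t)" for t
    using bounded_linear.has_vector_derivative[OF bounded_linear_compose[OF bounded_linear_snd bounded_linear_snd] g_deriv[of t]]
    by (simp add: \<Psi>_def has_real_derivative_iff_has_vector_derivative)
  then have "snd (snd (g t)) = snd (snd (g 0))" for t by (intro DERIV_isconst_all) auto
  then have g_eq: "g t = (w t, \<nu> t, L)" for t by (simp add: w_def \<nu>_def L_def prod_eq_iff)
  have w_deriv: "(w has_vector_derivative \<nu> t) (at t)" for t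
    using bounded_linear.has_vector_derivative[OF bounded_linear_fst g_deriv[of t]]
    by (simp add: w_def[abs_def] \<nu>_def \<Psi>_def)
  have \<nu>_deriv: "(\<nu> has_vector_derivative (L * (K (w t) / \<mu>)) *\<^sub>R rot (\<nu> t)) (at t)" for t
    using bounded_linear.has_vector_derivative[OF bounded_linear_compose[OF bounded_linear_fst bounded_linear_snd] g_deriv[of t]]
    by (simp add: g_eq \<Psi>_def)
  have "((\<lambda>t. \<nu> t \<bullet> \<nu> t) has_real_derivative 0) (at t)" for t
  proof -
    have "((\<lambda>t. \<nu> t \<bullet> \<nu> t) has_derivative
        (\<lambda>h. \<nu> t \<bullet> (h *\<^sub>R (L * (K (w t) / \<mu>)) *\<^sub>R rot (\<nu> t)) + (h *\<^sub>R (L * (K (w t) / \<mu>)) *\<^sub>R rot (\<nu> t)) \<bullet> \<nu> t)) (at t)"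
      using \<nu>_deriv[of t] unfolding has_vector_derivative_def by (intro has_derivative_inner)
    then show ?thesis by (simp add: has_field_derivative_def inner_rot inner_commute[of "rot _"] lambda_zero)
  qed
  then have "\<nu> t \<bullet> \<nu> t = \<nu> 0 \<bullet> \<nu> 0" for t by (intro DERIV_isconst_all) auto
  then have \<nu>_const: "norm (\<nu> t) = norm (\<nu> 0)" for t by (simp add: norm_eq_sqrt_inner)
  have l_conv: "(\<lambda>n. l (r n)) \<longlonglongrightarrow> L"
  proof -
    have "(\<lambda>n. snd (snd (Z (r n) 0))) \<longlonglongrightarrow> snd (snd (g 0))" by (intro tendsto_intros conv)
    moreover have "snd (snd (Z n 0)) = l n" for n using Z(1)[of n 0] by (simp add: z_def)
    ultimately show ?thesis by (simp add: L_def)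
  qed
  have "\<mu> / (2 * \<kappa>) \<le> l n" for n
  proof -
    have "1 / 2 \<le> c n * \<kappa>" by (rule el_length_lower_bound[OF el' N(1) c(1) l(1) K_bound \<kappa>])
    then show ?thesis using \<mu> \<kappa> by (simp add: c_def field_simps)
  qed
  then have "\<mu> / (2 * \<kappa>) \<le> L" by (intro LIMSEQ_le_const[OF l_conv]) auto
  moreover have "0 < \<mu> / (2 * \<kappa>)" using \<mu> \<kappa> by simp
  ultimately have L: "0 < L" by linarith
  have "(\<lambda>n. (l (r n))\<^sup>2) \<longlonglongrightarrow> (norm (\<nu> 0))\<^sup>2"
  proof (rule LIMSEQ_I)
    fix e :: real assume e: "0 < e"
    \<comment> \<open>bounds the sum of the two speeds whose squares are compared; the summand \<open>1\<close> keeps it positive\<close>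
    define B where "B = D + norm (\<nu> 0) + 1"
    have B: "0 < B" using D norm_ge_zero[of "\<nu> 0"] unfolding B_def by linarith
    obtain n0 where n0: "\<And>n t. n0 \<le> n \<Longrightarrow> norm (Z (r n) t - g t) < e / (2 * B)" using unif[of "e / (2 * B)"] e B by auto
    have "norm ((l (r n))\<^sup>2 - (norm (\<nu> 0))\<^sup>2) < e" if n: "n0 \<le> n" for n
    proof -
      let ?m = "r n"
      have close: "\<bar>(norm (v ?m j))\<^sup>2 - (norm (\<nu> 0))\<^sup>2\<bar> \<le> e / 2" for j
      proof -
        let ?t = "real_of_int j / N ?m"
        have "norm (v ?m j - \<nu> ?t) \<le> norm (Z ?m ?t - g ?t)"
          using norm_snd_le[of "(v ?m j - \<nu> ?t, l ?m - L)" "u ?m j - w ?t"] norm_fst_le[of "v ?m j - \<nu> ?t" "l ?m - L"]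
          by (simp add: Z(1) z_def g_eq)
        then have 1: "\<bar>norm (v ?m j) - norm (\<nu> 0)\<bar> \<le> e / (2 * B)"
          using n0[OF n, of ?t] norm_triangle_ineq3[of "v ?m j" "\<nu> ?t"] unfolding \<nu>_const[of ?t] by linarith
        have "\<bar>(norm (v ?m j))\<^sup>2 - (norm (\<nu> 0))\<^sup>2\<bar> = (norm (v ?m j) + norm (\<nu> 0)) * \<bar>norm (v ?m j) - norm (\<nu> 0)\<bar>"
          by (simp add: power2_eq_square square_diff_square_factored abs_mult)
        also have "\<dots> \<le> B * (e / (2 * B))"
          using 1 norm_v[of ?m j] B by (intro mult_mono) (auto simp: B_def)
        finally show ?thesis using B by simp
      qed
      have "real (N ?m) * ((l ?m)\<^sup>2 - (norm (\<nu> 0))\<^sup>2) = (\<Sum>j\<in>{0..<int (N ?m)}. (norm (v ?m j))\<^sup>2 - (norm (\<nu> 0))\<^sup>2)"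
        using el'[of ?m] by (simp add: euler_lagrange_def sum_subtractf right_diff_distrib)
      also have "\<bar>\<dots>\<bar> \<le> (\<Sum>j\<in>{0..<int (N ?m)}. e / 2)"
        by (rule order_trans[OF sum_abs sum_mono]) (rule close)
      finally have "real (N ?m) * \<bar>(l ?m)\<^sup>2 - (norm (\<nu> 0))\<^sup>2\<bar> \<le> real (N ?m) * (e / 2)"
        by (simp add: abs_mult)
      then have "\<bar>(l ?m)\<^sup>2 - (norm (\<nu> 0))\<^sup>2\<bar> \<le> e / 2" using Npos[of ?m] by (simp only: mult_le_cancel_left_pos)
      then show ?thesis using e by simp
    qed
    then show "\<exists>n0. \<forall>n\<ge>n0. norm ((l (r n))\<^sup>2 - (norm (\<nu> 0))\<^sup>2) < e" by blast
  qed
  then have "L\<^sup>2 = (norm (\<nu> 0))\<^sup>2" using tendsto_power[OF l_conv] LIMSEQ_unique by blast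
  then have "norm (\<nu> t) = L" for t using L \<nu>_const[of t] by (simp add: power2_eq_iff_nonneg)
  moreover have "w (t + 1) = w t" for t by (simp add: w_def g_per)
  moreover have "continuous_on UNIV (\<lambda>p. K p / \<mu>)" using \<mu> by (intro continuous_intros K) auto
  ultimately have "is_loop (\<lambda>p. K p / \<mu>) (range w)"
    using L w_deriv \<nu>_deriv by (intro is_loop_of_constant_speed[of _ L w \<nu>]) auto
  then show ?thesis by blast
qed

section \<open>Existence for almost every parameter\<close>

lemma doubly_periodic_bounded:
  fixes K :: "real \<times> real \<Rightarrow> real"
  assumes K: "continuous_on UNIV K" and ab: "0 < a" "0 < b"
    and px: "\<And>x y. K (x + a, y) = K (x, y)" and py: "\<And>x y. K (x, y + b) = K (x, y)"
  obtains \<kappa> where "0 < \<kappa>" "\<And>p. \<bar>K p\<bar> \<le> \<kappa>"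
proof -
  have "bounded (K ` cbox (0, 0) (a, b))"
    by (intro compact_imp_bounded compact_continuous_image continuous_on_subset[OF K]) auto
  then obtain \<kappa> where \<kappa>: "0 < \<kappa>" "\<And>p. p \<in> cbox (0, 0) (a, b) \<Longrightarrow> \<bar>K p\<bar> \<le> \<kappa>"
    unfolding bounded_pos by auto
  have "\<bar>K (x, y)\<bar> \<le> \<kappa>" for x y
  proof -
    have "K (x + of_int i * a, y + of_int j * b) = K (x, y)" for i j
      using period_multiple[of "\<lambda>x. K (x, y + of_int j * b)" a x i, OF px]
        period_multiple[of "\<lambda>y. K (x, y)" b y j, OF py] by simp
    then have "K (x, y) = K (x + of_int (- \<lfloor>x / a\<rfloor>) * a, y + of_int (- \<lfloor>y / b\<rfloor>) * b)" by metis
    also have "\<bar>\<dots>\<bar> \<le> \<kappa>" using reduce_modulo_period[OF ab(1), of x] reduce_modulo_period[OF ab(2), of y]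
      by (intro \<kappa>(2)) auto
    finally show ?thesis .
  qed
  then show thesis by (intro that[OF \<kappa>(1)]) auto
qed

text \<open>On a bounded range of parameters one and the same rectangle ends the paths for all \<open>N\<close>, and the
  levels are bounded uniformly in \<open>N\<close>.\<close>

lemma AE_loops_up_to:
  fixes K :: "real \<times> real \<Rightarrow> real" and m :: nat
  assumes K: "continuous_on UNIV K" and ab: "0 < a" "0 < b"
    and px: "\<And>x y. K (x + a, y) = K (x, y)" and py: "\<And>x y. K (x, y + b) = K (x, y)"
    and mean: "0 < (LINT p:{0..a} \<times> {0..b}|lebesgue. K p)"
  shows "AE \<mu> in lebesgue. 0 < \<mu> \<longrightarrow> \<mu> < real m \<longrightarrow> (\<exists>C. is_loop (\<lambda>p. K p / \<mu>) C)"
proof -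
  obtain \<kappa> where \<kappa>: "0 < \<kappa>" "\<And>p. \<bar>K p\<bar> \<le> \<kappa>" using doubly_periodic_bounded[OF K ab px py] by blast
  obtain W U V where prim: "double_primitive (\<lambda>x y. K (x, y)) W U V"
    and W_int: "\<And>a b. 0 \<le> a \<Longrightarrow> 0 \<le> b \<Longrightarrow> W a b = integral (cbox (0, 0) (a, b)) K"
    using double_primitive_exists[OF K] by blast
  have W_pos: "0 < W a b"
  proof -
    have box: "cbox (0, 0) (a, b) = {0..a} \<times> {0..b}" by (simp add: cbox_Pair_eq)
    have "K absolutely_integrable_on cbox (0, 0) (a, b)"
      by (intro absolutely_integrable_continuous continuous_on_subset[OF K]) auto
    then have "(LINT p:{0..a} \<times> {0..b}|lebesgue. K p) = integral (cbox (0, 0) (a, b)) K"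
      unfolding box by (rule set_lebesgue_integral_eq_integral(2))
    then show ?thesis using mean ab by (simp add: W_int)
  qed
  \<comment> \<open>enough cells that the area of the rectangle outweighs \<open>\<mu>\<close> times its length for all \<open>\<mu> < m\<close>\<close>
  obtain p :: nat where p: "4 * real m * (a + b) / W a b < real p" using reals_Archimedean2 by blast
  have p': "4 * real m * (a + b) < real p * W a b" using p W_pos by (simp add: field_simps)
  have p_pos: "0 < real p" using p W_pos ab by (smt (verit) divide_nonneg_pos mult_nonneg_nonneg of_nat_0_le_iff)
  define A B where "A = real p * a" and "B = real p * b"
  have AB: "0 \<le> A" "0 \<le> B" using ab by (auto simp: A_def B_def)
  define N where "N n = 4 * Suc n" for n
  define e where "e n = rectangle A B (Suc n)" for n
  have loc: "loop_functional (\<lambda>x y. K (x, y)) W U V (N n) \<kappa> a b" for n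
    using prim \<kappa> ab px py by (simp add: loop_functional_def loop_functional_axioms_def N_def)
  define ar where "ar n = loop_functional.area W (N n)" for n
  define lev where "lev n = pass_level (polygons (N n)) (disc_length (N n)) (ar n) (\<lambda>_. 0) (e n)" for n
  have e: "e n \<in> polygons (N n)" and e_len: "disc_length (N n) (e n) \<le> 4 * (A + B)"
    and e_area: "ar n (e n) = (real p)\<^sup>2 * W a b" for n
  proof -
    interpret loop_functional "\<lambda>x y. K (x, y)" W U V "N n" \<kappa> a b by (rule loc)
    show "e n \<in> polygons (N n)" "disc_length (N n) (e n) \<le> 4 * (A + B)"
      unfolding e_def by (rule rectangle_in_polygons len_rectangle; simp add: N_def AB)+
    have "area (e n) = W A B" unfolding e_def by (rule area_rectangle) (simp_all add: N_def AB)
    then show "ar n (e n) = (real p)\<^sup>2 * W a b"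
      unfolding ar_def A_def B_def using W_lattice[OF px py] by (simp add: power2_eq_square)
  qed
  have mp: "mountain_pass (polygons (N n)) (disc_length (N n)) (ar n) (\<lambda>_. 0) (e n)" for n
    unfolding ar_def by (rule loop_functional.mountain_pass_polygons[OF loc e])
  define C where "C = real m * (4 * (A + B)) + \<kappa> * (4 * (A + B))\<^sup>2"
  \<comment> \<open>capping the parameter makes the levels bounded on the whole line\<close>
  define f where "f n \<mu> = lev n (min \<mu> (real m))" for n \<mu>
  have mono_lev: "mono (lev n)" for n unfolding lev_def by (rule mountain_pass.mono_level[OF mp])
  have "mono (f n)" for n
    unfolding f_def by (intro monoI monoD[OF mono_lev]) auto
  moreover have "0 \<le> f n \<mu>" for n \<mu> unfolding f_def lev_def by (rule mountain_pass.level_nonneg[OF mp])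
  moreover have "f n \<mu> \<le> C" for n \<mu>
  proof -
    have "f n \<mu> \<le> lev n (real m)" unfolding f_def by (rule monoD[OF mono_lev]) simp
    also have "\<dots> \<le> real m * disc_length (N n) (e n) + \<kappa> * (disc_length (N n) (e n))\<^sup>2"
      unfolding lev_def ar_def by (rule loop_functional.polygon_level_le[OF loc e]) simp
    also have "\<dots> \<le> C"
      unfolding C_def using e_len[of n] \<kappa>(1) disc_length_nonneg[of "N n" "e n"]
      by (intro add_mono mult_left_mono power_mono) auto
    finally show ?thesis .
  qed
  ultimately have "AE \<mu> in lebesgue. \<exists>B\<ge>0. \<exists>\<^sub>\<infinity>n. \<forall>d>0. \<exists>\<delta>. 0 < \<delta> \<and> \<delta> < d \<and> f n (\<mu> + \<delta>) \<le> f n \<mu> + B * \<delta>"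
    by (rule AE_mono_seq_bounded_slopes)
  then show ?thesis
  proof (rule AE_mp, intro AE_I2 impI)
    fix \<mu> assume \<mu>: "0 < \<mu>" "\<mu> < real m"
      and "\<exists>B\<ge>0. \<exists>\<^sub>\<infinity>n. \<forall>d>0. \<exists>\<delta>. 0 < \<delta> \<and> \<delta> < d \<and> f n (\<mu> + \<delta>) \<le> f n \<mu> + B * \<delta>"
    then obtain B' where B': "0 \<le> B'"
      and inf: "infinite {n. \<forall>d>0. \<exists>\<delta>. 0 < \<delta> \<and> \<delta> < d \<and> f n (\<mu> + \<delta>) \<le> f n \<mu> + B' * \<delta>}"
      unfolding frequently_cofinite by blast
    obtain r :: "nat \<Rightarrow> nat" where r: "strict_mono r"
      and slope: "\<And>n d. 0 < d \<Longrightarrow> \<exists>\<delta>. 0 < \<delta> \<and> \<delta> < d \<and> f (r n) (\<mu> + \<delta>) \<le> f (r n) \<mu> + B' * \<delta>"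
      using infinite_enumerate[OF inf] by blast
    have slope': "\<exists>\<delta>. 0 < \<delta> \<and> \<delta> < d \<and> lev (r n) (\<mu> + \<delta>) \<le> lev (r n) \<mu> + B' * \<delta>" if d: "0 < d" for n d
    proof -
      obtain \<delta> where "0 < \<delta>" "\<delta> < min d (real m - \<mu>)" "f (r n) (\<mu> + \<delta>) \<le> f (r n) \<mu> + B' * \<delta>"
        using slope[of "min d (real m - \<mu>)" n] \<mu> d by auto
      then show ?thesis using \<mu> by (intro exI[of _ \<delta>]) (auto simp: f_def min_def split: if_splits)
    qed
    have neg: "\<mu> * disc_length (N n) (e n) - ar n (e n) < 0" for n
    proof -
      have "\<mu> * disc_length (N n) (e n) \<le> real m * (4 * (A + B))"
        using \<mu> e_len[of n] disc_length_nonneg[of "N n" "e n"] by (intro mult_mono) auto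
      also have "\<dots> = real p * (4 * real m * (a + b))" by (simp add: A_def B_def algebra_simps)
      also have "\<dots> < real p * (real p * W a b)" using p' p_pos by (rule mult_strict_left_mono)
      finally show ?thesis by (simp add: e_area power2_eq_square)
    qed
    have "\<exists>u. 0 < disc_length (N (r n)) u \<and> disc_length (N (r n)) u \<le> B' + 2 \<and> norm (u 0) \<le> a + b \<and>
        euler_lagrange (\<lambda>x y. K (x, y)) (N (r n)) (disc_length (N (r n)) u / \<mu>) (disc_length (N (r n)) u) u
          (\<lambda>j. real (N (r n)) *\<^sub>R (u (j + 1) - u j))" for n
    proof -
      interpret loop_functional "\<lambda>x y. K (x, y)" W U V "N (r n)" \<kappa> a b by (rule loc)
      show ?thesis
        using critical_polygon_exists[OF e \<mu>(1) neg[of "r n", unfolded ar_def] B' slope'[of _ n, unfolded lev_def ar_def]]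
          critical_imp_euler_lagrange[OF _ \<mu>(1)] by blast
    qed
    then have "\<forall>n. \<exists>u. 0 < disc_length (N (r n)) u \<and> disc_length (N (r n)) u \<le> B' + 2 \<and> norm (u 0) \<le> a + b \<and>
        euler_lagrange (\<lambda>x y. K (x, y)) (N (r n)) (disc_length (N (r n)) u / \<mu>) (disc_length (N (r n)) u) u
          (\<lambda>j. real (N (r n)) *\<^sub>R (u (j + 1) - u j))" by (rule allI)
    from choice[OF this] obtain u where u: "\<And>n. 0 < disc_length (N (r n)) (u n)" "\<And>n. disc_length (N (r n)) (u n) \<le> B' + 2"
      "\<And>n. norm (u n 0) \<le> a + b"
      "\<And>n. euler_lagrange (\<lambda>x y. K (x, y)) (N (r n)) (disc_length (N (r n)) (u n) / \<mu>) (disc_length (N (r n)) (u n)) (u n)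
          (\<lambda>j. real (N (r n)) *\<^sub>R (u n (j + 1) - u n j))"
      by blast
    have "strict_mono (\<lambda>n. N (r n))" using r by (simp add: N_def strict_mono_def)
    then have lim: "filterlim (\<lambda>n. N (r n)) at_top sequentially" by (rule filterlim_subseq)
    show "\<exists>C. is_loop (\<lambda>p. K p / \<mu>) C"
      by (rule loop_from_euler_lagrange[OF K \<kappa>(2) \<kappa>(1) \<mu>(1) _ lim u(4) u(1) u(2) u(3)]) (simp add: N_def)
  qed
qed

text \<open>The inversion \<open>\<mu> = 1 / l\<close> and the reflection \<open>l \<mapsto> - l\<close> preserve null sets.\<close>

lemma AE_loops_of_positive_mean:
  fixes K :: "real \<times> real \<Rightarrow> real"
  assumes K: "continuous_on UNIV K" and ab: "0 < a" "0 < b"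
    and px: "\<And>x y. K (x + a, y) = K (x, y)" and py: "\<And>x y. K (x, y + b) = K (x, y)"
    and mean: "0 < (LINT p:{0..a} \<times> {0..b}|lebesgue. K p)"
  shows "AE l in lebesgue. l \<noteq> 0 \<longrightarrow> (\<exists>C. is_loop (\<lambda>p. l * K p) C)"
proof -
  have "AE \<mu> in lebesgue. \<forall>m::nat. 0 < \<mu> \<longrightarrow> \<mu> < real m \<longrightarrow> (\<exists>C. is_loop (\<lambda>p. K p / \<mu>) C)"
    unfolding AE_all_countable using AE_loops_up_to[OF assms] by blast
  then obtain S where S: "negligible S"
    "{\<mu>. \<not> (\<forall>m::nat. 0 < \<mu> \<longrightarrow> \<mu> < real m \<longrightarrow> (\<exists>C. is_loop (\<lambda>p. K p / \<mu>) C))} \<subseteq> S"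
    unfolding eventually_ae_filter_negligible by blast
  have loop: "\<exists>C. is_loop (\<lambda>p. K p / \<mu>) C" if "0 < \<mu>" "\<mu> \<notin> S" for \<mu>
    using S(2) that reals_Archimedean2[of \<mu>] by blast
  define T where "T = inverse ` (S \<inter> {0<..})"
  have T: "negligible T"
    unfolding T_def
    by (rule negligible_differentiable_image_negligible)
       (auto intro: negligible_Int S(1) intro!: derivative_intros simp: differentiable_on_def)
  moreover have "negligible (uminus ` T)"
    by (rule negligible_differentiable_image_negligible[OF _ T]) (auto intro!: derivative_intros simp: differentiable_on_def)
  ultimately have "negligible (T \<union> uminus ` T)" by (rule negligible_Un)
  moreover have "\<exists>C. is_loop (\<lambda>p. l * K p) C" if l: "l \<noteq> 0" "l \<notin> T \<union> uminus ` T" for l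
  proof -
    have pos: "\<exists>C. is_loop (\<lambda>p. k * K p) C" if "0 < k" "k \<notin> T" for k
    proof -
      have "inverse k \<notin> S"
      proof
        assume "inverse k \<in> S"
        then have "inverse (inverse k) \<in> T" unfolding T_def using that(1) by (intro imageI) auto
        then show False using that(2) by simp
      qed
      then show ?thesis using loop[of "inverse k"] that(1) by (simp add: divide_inverse mult.commute)
    qed
    show ?thesis
    proof (cases "0 < l")
      case True
      then show ?thesis using pos l by auto
    next
      case False
      have "- l \<notin> T" using l(2) by (metis UnI2 image_eqI minus_minus)
      then obtain C where "is_loop (\<lambda>p. - l * K p) C" using pos[of "- l"] False l(1) by auto
      from is_loop_reverse[OF this] show ?thesis by auto
    qed
  qed
  ultimately show ?thesis unfolding eventually_ae_filter_negligible by blast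
qed

theorem theorem1p1:
  fixes K :: "real \<times> real \<Rightarrow> real" and a b :: real
  assumes "continuous_on UNIV K"
    and "a > 0" and "b > 0"
    and "\<And>x y. K (x + a, y) = K (x, y)"
    and "\<And>x y. K (x, y + b) = K (x, y)"
    and "(LINT p:{0..a} \<times> {0..b}|lebesgue. K p) \<noteq> 0"
  shows "AE l in lebesgue. l \<noteq> 0 \<longrightarrow> (\<exists>C. is_loop (\<lambda>p. l * K p) C)"
proof (cases "0 < (LINT p:{0..a} \<times> {0..b}|lebesgue. K p)")
  case True
  then show ?thesis using assms by (intro AE_loops_of_positive_mean) auto
next
  case False
  have "AE l in lebesgue. l \<noteq> 0 \<longrightarrow> (\<exists>C. is_loop (\<lambda>p. l * - K p) C)"
    using assms False
    by (intro AE_loops_of_positive_mean[of "\<lambda>p. - K p" a b])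
       (auto intro: continuous_on_minus simp: set_lebesgue_integral_def)
  then show ?thesis
  proof (rule AE_mp, intro AE_I2 impI)
    fix l :: real assume "l \<noteq> 0" "l \<noteq> 0 \<longrightarrow> (\<exists>C. is_loop (\<lambda>p. l * - K p) C)"
    then obtain C where "is_loop (\<lambda>p. l * - K p) C" by blast
    from is_loop_reverse[OF this] show "\<exists>C. is_loop (\<lambda>p. l * K p) C" by auto
  qed
qed

end
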